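(* Let $2<p\le1+\frac{2^*}{2}$ and $p<2+\frac4n$, let $u_0\in H^1_{\Gamma_0}(\Omega)$, and let $u$ be the maximal weak solution of problem (P) with initial datum $u_0$. Assume that $u$ blows up in finite time and that $u(t)\in N_-=\{w\in H^1_{\Gamma_0}(\Omega): K(w)<0\}$ for every $t\in[0,T_{max})$. Then \[T_{max}\ge\frac{\tilde C}{\big(\|u_0\|_2^2+\|u_0\|_{2,\Gamma_1}^2\big)^{\frac{2(p-2)}{4-n(p-2)}}},\] where the positive constant $\tilde C$ is given as follows: put $\theta=\frac{n(p-2)}{2p}$ (so that $2-p\theta>0$), let $S_3>0$ be a constant in the Gagliardo–Nirenberg inequality \[\|w\|_p^p\le S_3\,\|w\|_2^{p(1-\theta)}\|\nabla w\|_2^{p\theta}\qquad\text{for all } w\in H^1_{\Gamma_0}(\Omega),\] and set \[S_4=S_3^{\frac{2}{2-p\theta}}\,2^{\frac{p-p\theta}{2-p\theta}},\qquad \tilde C=\frac{2-p\theta}{S_4(p-2)}\,2^{\frac{p-2}{2-p\theta}}.\]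
   Context: Setting. $\Omega\subset\mathbb R^n$ ($n\ge1$) is a bounded open set with $C^1$ boundary, $\nu$ is the unit outward normal, $\partial\Omega=\Gamma_0\cup\Gamma_1$ is a partition into measurable sets with $\overline{\Gamma_0}\cap\overline{\Gamma_1}=\emptyset$, $\sigma$ is the $(n-1)$-dimensional surface measure, and $\sigma(\Gamma_0)>0$. $2^*=\frac{2n}{n-2}$ if $n\ge3$, $2^*=\infty$ if $n=1,2$. Problem (P) is \[u_t-\Delta u=|u|^{p-2}u \text{ in }\Omega,\ t>0;\quad u=0 \text{ on }\Gamma_0,\ t>0;\quad \tfrac{\partial u}{\partial\nu}=-u_t \text{ on }\Gamma_1,\ t>0;\quad u(x,0)=u_0(x) \text{ in }\Omega.\] Notation. $\|\cdot\|_q$, $\|\cdot\|_{q,\Gamma_1}$ are the norms of $L^q(\Omega)$, $L^q(\Gamma_1)$; $(\cdot,\cdot)$, $(\cdot,\cdot)_{\Gamma_1}$ are the inner products of $L^2(\Omega)$, $L^2(\Gamma_1)$. $H^1_{\Gamma_0}(\Omega)=\{w\in H^1(\Omega): w|_{\Gamma_0}=0\}$ (trace sense), with norm $\|w\|_{H^1_{\Gamma_0}}=(\|w\|_2^2+\|\nabla w\|_2^2)^{1/2}$. Standing fact: since $\sigma(\Gamma_0)>0$, a Poincaré-type inequality holds, so $\|\nabla w\|_2$ is an equivalent norm on $H^1_{\Gamma_0}(\Omega)$. Functional: $K(w)=\|\nabla w\|_2^2-\|w\|_p^p$ on $H^1_{\Gamma_0}(\Omega)$. Weak solution. For $u_0\in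 H^1_{\Gamma_0}(\Omega)$, $u$ is a weak solution of (P) in $[0,T]\times\Omega$ if: (a) $u\in L^\infty(0,T;H^1_{\Gamma_0}(\Omega))$ and $u_t\in L^2((0,T)\times\Omega)$; (b) the spatial trace of $u$ on $(0,T)\times\partial\Omega$ has a distributional time derivative, also denoted $u_t$, in $L^2((0,T)\times\partial\Omega)$; (c) for all $\phi\in H^1_{\Gamma_0}(\Omega)$ and a.e. $t\in[0,T]$, $(u_t(t),\phi)+(\nabla u(t),\nabla\phi)+(u_t(t),\phi)_{\Gamma_1}=\int_\Omega|u(t)|^{p-2}u(t)\phi\,dx$; (d) $u(0)=u_0$. Known local theory (may be assumed). For $2\le p\le1+\frac{2^*}{2}$ and every $u_0\in H^1_{\Gamma_0}(\Omega)$ there is a unique maximal weak solution $u$ in $[0,T_{max})\times\Omega$; $u\in C([0,T_{max});H^1_{\Gamma_0}(\Omega))$; $u_t\in L^2((0,T)\times\Gamma_1)\cap L^2((0,T)\times\Omega)$ for every $T\in(0,T_{max})$; for $0\le s\le t<T_{max}$, \[\tfrac12\|\nabla u\|_2^2\Big|_s^t+\int_s^t\big(\|u_t(\tau)\|_2^2+\|u_t(\tau)\|_{2,\Gamma_1}^2\big)d\tau=\int_s^t\int_\Omega|u|^{p-2}uu_t\,dx\,d\tau;\] and either $T_{max}=\infty$, or $T_{max}<\infty$ and $\lim_{t\to T_{max}^-}\|u(t)\|_{H^1_{\Gamma_0}}=+\infty$. "$u$ blows up in finite time" means that the second alternative holds. *)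

theory Defs
  imports "HOL-Analysis.Analysis"
begin

section \<open>Smooth functions and test functions\<close>

text \<open>The largest class of Frechet differentiable functions that is closed under taking
  directional derivatives, i.e. \<open>C\<^sup>\<infinity>\<close> on the whole space.\<close>

coinductive smooth :: "('a::euclidean_space \<Rightarrow> real) \<Rightarrow> bool" where
  "(\<And>x. f differentiable (at x)) \<Longrightarrow>
   (\<And>v. smooth (\<lambda>x. frechet_derivative f (at x) v)) \<Longrightarrow> smooth f"

definition test_function :: "'a::euclidean_space set \<Rightarrow> ('a \<Rightarrow> real) \<Rightarrow> bool" where
  "test_function U \<phi> \<longleftrightarrow>
     smooth \<phi> \<and> compact (closure {x. \<phi> x \<noteq> 0}) \<and> closure {x. \<phi> x \<noteq> 0} \<subseteq> U"

section \<open>Bounded domains with \<open>C\<^sup>1\<close> boundary and their surface measure\<close>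

text \<open>In the open set \<open>V\<close> the domain lies strictly above the graph of a \<open>C\<^sup>1\<close> function over
  the hyperplane orthogonal to the unit vector \<open>b\<close>. A function on that hyperplane is encoded as
  a function \<open>\<gamma>\<close> on the whole space that does not depend on the \<open>b\<close>-coordinate; \<open>D\<close> is its
  gradient.\<close>

definition C1_chart :: "'a::euclidean_space set \<Rightarrow> 'a set \<Rightarrow> 'a \<Rightarrow> ('a \<Rightarrow> real) \<Rightarrow> ('a \<Rightarrow> 'a) \<Rightarrow> bool"
  where
  "C1_chart \<Omega> V b \<gamma> D \<longleftrightarrow>
     open V \<and> norm b = 1 \<and>
     (\<forall>x s. \<gamma> (x + s *\<^sub>R b) = \<gamma> x) \<and>
     (\<forall>x. (\<gamma> has_derivative (\<lambda>h. D x \<bullet> h)) (at x)) \<and> continuous_on UNIV D \<and>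
     \<Omega> \<inter> V = {x \<in> V. \<gamma> x < x \<bullet> b}"

definition C1_boundary :: "'a::euclidean_space set \<Rightarrow> bool" where
  "C1_boundary \<Omega> \<longleftrightarrow> (\<forall>x\<in>frontier \<Omega>. \<exists>V b \<gamma> D. x \<in> V \<and> C1_chart \<Omega> V b \<gamma> D)"

text \<open>The surface measure of a piece of a graph is the integral of \<open>sqrt (1 + |\<nabla>\<gamma>|\<^sup>2)\<close> over its
  projection to the hyperplane orthogonal to \<open>b\<close>. The \<open>(n - 1)\<close>-dimensional integral of a
  function that does not depend on the \<open>b\<close>-coordinate is written as an \<open>n\<close>-dimensional integral
  over the slab \<open>0 \<le> x \<bullet> b \<le> 1\<close> of thickness one; \<open>x + (\<gamma> x - x \<bullet> b) b\<close> is the point of the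
  graph on the line through \<open>x\<close> in direction \<open>b\<close>. For \<open>n = 1\<close> this is the counting measure.\<close>

definition surface_measure :: "'a::euclidean_space set \<Rightarrow> 'a measure \<Rightarrow> bool" where
  "surface_measure \<Omega> \<sigma> \<longleftrightarrow>
     sets \<sigma> = sets borel \<and> emeasure \<sigma> (- frontier \<Omega>) = 0 \<and>
     (\<forall>V b \<gamma> D A. C1_chart \<Omega> V b \<gamma> D \<longrightarrow> A \<in> sets borel \<longrightarrow> A \<subseteq> frontier \<Omega> \<inter> V \<longrightarrow>
        emeasure \<sigma> A =
          (\<integral>\<^sup>+ x \<in> {x. 0 \<le> x \<bullet> b \<and> x \<bullet> b \<le> 1}.
             indicator A (x + (\<gamma> x - x \<bullet> b) *\<^sub>R b) * ennreal (sqrt (1 + (norm (D x))\<^sup>2)) \<partial>lborel))"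

section \<open>Lebesgue and Sobolev spaces\<close>

text \<open>Elements of the function spaces are represented by Borel functions; every class modulo null
  sets has such a representative.\<close>

abbreviation leb_on :: "'a::euclidean_space set \<Rightarrow> 'a measure" where
  "leb_on U \<equiv> restrict_space lborel U"

definition Lspace :: "real \<Rightarrow> 'a measure \<Rightarrow> ('a \<Rightarrow> 'b::euclidean_space) set" where
  "Lspace q M = {f \<in> borel_measurable M. integrable M (\<lambda>x. norm (f x) powr q)}"

definition Lnorm :: "real \<Rightarrow> 'a measure \<Rightarrow> ('a \<Rightarrow> 'b::euclidean_space) \<Rightarrow> real" where
  "Lnorm q M f = (LINT x|M. norm (f x) powr q) powr (1 / q)"

definition has_weak_grad :: "'a::euclidean_space set \<Rightarrow> ('a \<Rightarrow> real) \<Rightarrow> ('a \<Rightarrow> 'a) \<Rightarrow> bool" where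
  "has_weak_grad \<Omega> w G \<longleftrightarrow>
     (\<forall>\<phi>. test_function \<Omega> \<phi> \<longrightarrow> (\<forall>i\<in>Basis.
        (LINT x|leb_on \<Omega>. w x * frechet_derivative \<phi> (at x) i) =
        - (LINT x|leb_on \<Omega>. (G x \<bullet> i) * \<phi> x)))"

definition H1 :: "'a::euclidean_space set \<Rightarrow> ('a \<Rightarrow> real) set" where
  "H1 \<Omega> = {w \<in> Lspace 2 (leb_on \<Omega>). \<exists>G \<in> Lspace 2 (leb_on \<Omega>). has_weak_grad \<Omega> w G}"

text \<open>The weak gradient is determined up to a null set.\<close>

definition weak_grad :: "'a::euclidean_space set \<Rightarrow> ('a \<Rightarrow> real) \<Rightarrow> 'a \<Rightarrow> 'a" where
  "weak_grad \<Omega> w = (SOME G. G \<in> Lspace 2 (leb_on \<Omega>) \<and> has_weak_grad \<Omega> w G)"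

definition H1norm :: "'a::euclidean_space set \<Rightarrow> ('a \<Rightarrow> real) \<Rightarrow> real" where
  "H1norm \<Omega> w =
     sqrt ((Lnorm 2 (leb_on \<Omega>) w)\<^sup>2 + (Lnorm 2 (leb_on \<Omega>) (weak_grad \<Omega> w))\<^sup>2)"

text \<open>The trace operator is the continuous extension to \<open>H\<^sup>1\<close> of the restriction of smooth
  functions to the boundary.\<close>

definition has_trace ::
  "'a::euclidean_space set \<Rightarrow> 'a measure \<Rightarrow> ('a \<Rightarrow> real) \<Rightarrow> ('a \<Rightarrow> real) \<Rightarrow> bool" where
  "has_trace \<Omega> \<sigma> w g \<longleftrightarrow>
     w \<in> H1 \<Omega> \<and> g \<in> Lspace 2 \<sigma> \<and>
     (\<exists>v :: nat \<Rightarrow> 'a \<Rightarrow> real. (\<forall>k. smooth (v k)) \<and>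
        (\<lambda>k. H1norm \<Omega> (\<lambda>x. v k x - w x)) \<longlonglongrightarrow> 0 \<and>
        (\<lambda>k. Lnorm 2 \<sigma> (\<lambda>x. v k x - g x)) \<longlonglongrightarrow> 0)"

definition boundary_trace ::
  "'a::euclidean_space set \<Rightarrow> 'a measure \<Rightarrow> ('a \<Rightarrow> real) \<Rightarrow> 'a \<Rightarrow> real" where
  "boundary_trace \<Omega> \<sigma> w = (SOME g. has_trace \<Omega> \<sigma> w g)"

definition H1_0 ::
  "'a::euclidean_space set \<Rightarrow> 'a measure \<Rightarrow> 'a set \<Rightarrow> ('a \<Rightarrow> real) set" where
  "H1_0 \<Omega> \<sigma> \<Gamma>\<^sub>0 =
     {w \<in> H1 \<Omega>. \<exists>g. has_trace \<Omega> \<sigma> w g \<and> (AE x in \<sigma>. x \<in> \<Gamma>\<^sub>0 \<longrightarrow> g x = 0)}"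

text \<open>The critical exponent \<open>2\<^sup>*\<close> in dimension \<open>n\<close>.\<close>

definition sobolev_exponent :: "nat \<Rightarrow> ereal" where
  "sobolev_exponent n = (if n \<ge> 3 then ereal (2 * real n / (real n - 2)) else \<infinity>)"

section \<open>Weak solutions\<close>

text \<open>The space \<open>L\<^sup>\<infinity>(0,T;H\<^sup>1\<^sub>\<Gamma>\<^sub>0(\<Omega>))\<close>: essentially bounded functions that are strongly (Bochner)
  measurable, i.e. almost everywhere limits of simple functions.\<close>

definition Linf_H1_0 ::
  "'a::euclidean_space set \<Rightarrow> 'a measure \<Rightarrow> 'a set \<Rightarrow> real \<Rightarrow> (real \<Rightarrow> 'a \<Rightarrow> real) set" where
  "Linf_H1_0 \<Omega> \<sigma> \<Gamma>\<^sub>0 T =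
     {u. (AE t in leb_on {0<..<T}. u t \<in> H1_0 \<Omega> \<sigma> \<Gamma>\<^sub>0) \<and>
         (\<exists>s :: nat \<Rightarrow> real \<Rightarrow> 'a \<Rightarrow> real.
            (\<forall>k. simple_function (leb_on {0<..<T}) (s k)) \<and>
            (\<forall>k. \<forall>t\<in>{0<..<T}. s k t \<in> H1_0 \<Omega> \<sigma> \<Gamma>\<^sub>0) \<and>
            (AE t in leb_on {0<..<T}. (\<lambda>k. H1norm \<Omega> (\<lambda>x. s k t x - u t x)) \<longlonglongrightarrow> 0)) \<and>
         (\<exists>B. AE t in leb_on {0<..<T}. H1norm \<Omega> (u t) \<le> B)}"

text \<open>\<open>v\<close> is the distributional time derivative of \<open>u\<close> on \<open>(0,T) \<times> S\<close> and belongs to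
  \<open>L\<^sup>2((0,T) \<times> S)\<close>, where the measure \<open>M\<close> lives on \<open>S\<close>. It is used with \<open>S = U = \<Omega>\<close> and the Lebesgue
  measure, and with \<open>S = \<partial>\<Omega>\<close> and the surface measure; in the latter case \<open>U = UNIV\<close>, so that the
  test functions on \<open>(0,T) \<times> \<partial>\<Omega>\<close> are restrictions of test functions on \<open>(0,T) \<times> \<real>\<^sup>n\<close>.\<close>

definition has_L2_time_deriv ::
  "real \<Rightarrow> 'a::euclidean_space set \<Rightarrow> 'a measure \<Rightarrow> (real \<Rightarrow> 'a \<Rightarrow> real) \<Rightarrow> (real \<Rightarrow> 'a \<Rightarrow> real) \<Rightarrow> bool"
  where
  "has_L2_time_deriv T U M u v \<longleftrightarrow>
     (\<lambda>(t, x). v t x) \<in> Lspace 2 (leb_on {0<..<T} \<Otimes>\<^sub>M M) \<and>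
     (\<forall>\<phi> :: real \<times> 'a \<Rightarrow> real. test_function ({0<..<T} \<times> U) \<phi> \<longrightarrow>
        (LINT t|leb_on {0<..<T}. LINT x|M. u t x * frechet_derivative \<phi> (at (t, x)) (1, 0)) =
        - (LINT t|leb_on {0<..<T}. LINT x|M. v t x * \<phi> (t, x)))"

text \<open>The first condition and the existence of \<open>u\<^sub>t\<close> imply that \<open>u\<close> has a representative in
  \<open>C([0,T];L\<^sup>2(\<Omega>))\<close>, which alone gives a meaning to \<open>u(0) = u\<^sub>0\<close> and to \<open>u(t)\<close> for every \<open>t\<close>;
  \<open>u\<close> is required to be this representative. The function \<open>v\<close> is \<open>u\<^sub>t\<close> in \<open>\<Omega>\<close> and \<open>z\<close> is the time
  derivative of the trace.\<close>

definition weak_solution ::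
  "'a::euclidean_space set \<Rightarrow> 'a measure \<Rightarrow> 'a set \<Rightarrow> 'a set \<Rightarrow> real \<Rightarrow>
   ('a \<Rightarrow> real) \<Rightarrow> real \<Rightarrow> (real \<Rightarrow> 'a \<Rightarrow> real) \<Rightarrow> bool" where
  "weak_solution \<Omega> \<sigma> \<Gamma>\<^sub>0 \<Gamma>\<^sub>1 p u\<^sub>0 T u \<longleftrightarrow>
     u \<in> Linf_H1_0 \<Omega> \<sigma> \<Gamma>\<^sub>0 T \<and>
     (\<forall>t\<in>{0..T}. u t \<in> Lspace 2 (leb_on \<Omega>) \<and>
        ((\<lambda>s. Lnorm 2 (leb_on \<Omega>) (\<lambda>x. u s x - u t x)) \<longlongrightarrow> 0) (at t within {0..T})) \<and>
     (\<exists>v z.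
        has_L2_time_deriv T \<Omega> (leb_on \<Omega>) u v \<and>
        has_L2_time_deriv T UNIV \<sigma> (\<lambda>t. boundary_trace \<Omega> \<sigma> (u t)) z \<and>
        (\<forall>\<phi>\<in>H1_0 \<Omega> \<sigma> \<Gamma>\<^sub>0. AE t in leb_on {0<..<T}.
           (LINT x|leb_on \<Omega>. v t x * \<phi> x) +
           (LINT x|leb_on \<Omega>. weak_grad \<Omega> (u t) x \<bullet> weak_grad \<Omega> \<phi> x) +
           (LINT x|restrict_space \<sigma> \<Gamma>\<^sub>1. z t x * boundary_trace \<Omega> \<sigma> \<phi> x) =
           (LINT x|leb_on \<Omega>. \<bar>u t x\<bar> powr (p - 2) * u t x * \<phi> x))) \<and>
     (AE x in leb_on \<Omega>. u 0 x = u\<^sub>0 x)"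

definition weak_solution_before ::
  "'a::euclidean_space set \<Rightarrow> 'a measure \<Rightarrow> 'a set \<Rightarrow> 'a set \<Rightarrow> real \<Rightarrow>
   ('a \<Rightarrow> real) \<Rightarrow> ereal \<Rightarrow> (real \<Rightarrow> 'a \<Rightarrow> real) \<Rightarrow> bool" where
  "weak_solution_before \<Omega> \<sigma> \<Gamma>\<^sub>0 \<Gamma>\<^sub>1 p u\<^sub>0 T\<^sub>m u \<longleftrightarrow>
     0 < T\<^sub>m \<and> (\<forall>T. 0 < T \<and> ereal T < T\<^sub>m \<longrightarrow> weak_solution \<Omega> \<sigma> \<Gamma>\<^sub>0 \<Gamma>\<^sub>1 p u\<^sub>0 T u)"

definition maximal_weak_solution ::
  "'a::euclidean_space set \<Rightarrow> 'a measure \<Rightarrow> 'a set \<Rightarrow> 'a set \<Rightarrow> real \<Rightarrow>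
   ('a \<Rightarrow> real) \<Rightarrow> ereal \<Rightarrow> (real \<Rightarrow> 'a \<Rightarrow> real) \<Rightarrow> bool" where
  "maximal_weak_solution \<Omega> \<sigma> \<Gamma>\<^sub>0 \<Gamma>\<^sub>1 p u\<^sub>0 T\<^sub>m u \<longleftrightarrow>
     weak_solution_before \<Omega> \<sigma> \<Gamma>\<^sub>0 \<Gamma>\<^sub>1 p u\<^sub>0 T\<^sub>m u \<and>
     \<not> (\<exists>T' v. T\<^sub>m < T' \<and> weak_solution_before \<Omega> \<sigma> \<Gamma>\<^sub>0 \<Gamma>\<^sub>1 p u\<^sub>0 T' v \<and>
          (\<forall>t. 0 \<le> t \<and> ereal t < T\<^sub>m \<longrightarrow> (AE x in leb_on \<Omega>. v t x = u t x)))"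

definition blows_up ::
  "'a::euclidean_space set \<Rightarrow> ereal \<Rightarrow> (real \<Rightarrow> 'a \<Rightarrow> real) \<Rightarrow> bool" where
  "blows_up \<Omega> T\<^sub>m u \<longleftrightarrow>
     T\<^sub>m < \<infinity> \<and> filterlim (\<lambda>t. H1norm \<Omega> (u t)) at_top (at_left (real_of_ereal T\<^sub>m))"

definition K_functional :: "'a::euclidean_space set \<Rightarrow> real \<Rightarrow> ('a \<Rightarrow> real) \<Rightarrow> real" where
  "K_functional \<Omega> p w =
     (Lnorm 2 (leb_on \<Omega>) (weak_grad \<Omega> w))\<^sup>2 - Lnorm p (leb_on \<Omega>) w powr p"

definition N_minus ::
  "'a::euclidean_space set \<Rightarrow> 'a measure \<Rightarrow> 'a set \<Rightarrow> real \<Rightarrow> ('a \<Rightarrow> real) set" where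
  "N_minus \<Omega> \<sigma> \<Gamma>\<^sub>0 p = {w \<in> H1_0 \<Omega> \<sigma> \<Gamma>\<^sub>0. K_functional \<Omega> p w < 0}"

end

theory Submission
  imports Defs
begin

text \<open>Testing the equation with \<open>u\<close> itself shows that \<open>L = (\<parallel>u\<parallel>\<^sup>2 + \<parallel>tr u\<parallel>\<^sup>2) / 2\<close>, with the \<open>L\<^sup>2\<close> norms over
  \<open>\<Omega>\<close> and \<open>\<Gamma>\<^sub>1\<close>, satisfies \<open>L' = - K u\<close>, which is at most the \<open>p\<close>-th power \<open>P\<close> of the \<open>L\<^sup>p\<close> norm of \<open>u\<close>.
  On \<open>N_minus\<close> the Gagliardo--Nirenberg inequality can be solved for \<open>P\<close>, because \<open>\<parallel>\<nabla>u\<parallel>\<^sup>2 < P\<close>; this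
  gives \<open>P \<le> S\<^sub>4 * L powr a\<close> with \<open>a = (p - p * \<theta>) / (2 - p * \<theta>) > 1\<close>. Hence \<open>L powr (1 - a)\<close> decreases
  at most linearly with slope \<open>(a - 1) * S\<^sub>4\<close>. By the same bound the \<open>H\<^sup>1\<close> norm is controlled by \<open>L\<close>, so at
  the blow-up time \<open>L\<close> is unbounded and \<open>L powr (1 - a)\<close> has no positive lower bound.

  The chain rule for \<open>L\<close> needs the trace of \<open>u\<close> to be continuous in time. On compact time intervals
  \<open>u\<close> is bounded in \<open>H\<^sup>1\<close> and continuous in \<open>L\<^sup>2\<close>, so the interpolation form
  \<open>\<parallel>tr w\<parallel>\<^sup>2 \<le> C * (\<parallel>w\<parallel>\<^sup>2 + \<parallel>w\<parallel> * \<parallel>\<nabla>w\<parallel>)\<close> of the trace inequality yields it. The same inequality makes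
  the trace unique and linear.\<close>

text \<open>Constants: \<open>a - 1 = (p - 2) / (2 - p * \<theta>)\<close>, and
  \<open>p < 2 + 4 / n\<close> says exactly that \<open>p * \<theta> < 2\<close>, which is what
  allows a power of \<open>P\<close> to be absorbed. Bounding the squared norm over
  \<open>\<Omega>\<close> by \<open>2 * L\<close> produces the factor \<open>2 powr a\<close> in
  \<open>S\<^sub>4\<close>. Up to the blow-up time \<open>T\<close> the comparison gives
  \<open>L 0 powr (1 - a) \<le> (a - 1) * S\<^sub>4 * T\<close>, and writing \<open>L 0\<close> as
  half of the quantity in the theorem turns this into \<open>C\<close>.

  The identity for \<open>L'\<close> is only formal: time derivatives exist as distributions, and
  the null set of exceptional times in the weak formulation depends on the test function. It is
  replaced by an integral inequality for the increments of \<open>L\<close>, and the merely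
  continuous \<open>L\<close> is compared through its integral majorant.

  Traces are compared at given times, so the \<open>H\<^sup>1\<close> bound is needed at every time
  and not only almost everywhere. Instability supplies it: on a compact interval the norm over
  \<open>\<Omega>\<close> is bounded by continuity, hence so is \<open>P\<close>, which dominates
  the squared norm of the gradient.\<close>

section \<open>Smooth functions and cutoffs\<close>

text \<open>The finite stages of the coinductive predicate \<open>smooth\<close>, which allow induction instead of
  coinduction up to sums and products.\<close>

primrec Ck :: "nat \<Rightarrow> ('a::euclidean_space \<Rightarrow> real) \<Rightarrow> bool" where
  "Ck 0 f \<longleftrightarrow> True"
| "Ck (Suc k) f \<longleftrightarrow>
     (\<forall>x. f differentiable (at x)) \<and> (\<forall>v. Ck k (\<lambda>x. frechet_derivative f (at x) v))"

lemma smooth_iff_Ck: "smooth f \<longleftrightarrow> (\<forall>k. Ck k f)"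
proof
  assume "smooth f"
  moreover have "Ck k f" if "smooth f" for k and f :: "'a \<Rightarrow> real"
    using that
  proof (induction k arbitrary: f)
    case (Suc k)
    from Suc.prems show ?case
      by (cases rule: smooth.cases) (auto intro: Suc.IH)
  qed simp
  ultimately show "\<forall>k. Ck k f" by blast
next
  assume "\<forall>k. Ck k f"
  then show "smooth f"
  proof (coinduction arbitrary: f rule: smooth.coinduct)
    case (smooth f)
    then have *: "Ck (Suc k) f" for k by blast
    from *[of 0] have "\<And>x. f differentiable (at x)" by simp
    moreover have "Ck k (\<lambda>x. frechet_derivative f (at x) v)" for k v
      using *[of k] by simp
    ultimately show ?case by auto
  qed
qed

lemma Ck_SucI:
  assumes "\<And>x. (f has_derivative f' x) (at x)" "\<And>v. Ck k (\<lambda>x. f' x v)"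
  shows "Ck (Suc k) f"
proof -
  have "frechet_derivative f (at x) = f' x" for x
    using frechet_derivative_at[OF assms(1)] by simp
  then show ?thesis using assms by (auto simp: differentiable_def)
qed

lemma Ck_Suc_derivative:
  "Ck (Suc k) f \<Longrightarrow> (f has_derivative frechet_derivative f (at x)) (at x)"
  using frechet_derivative_works by (metis Ck.simps(2))

text \<open>The product and chain rules keep undifferentiated factors, which have to be read at the
  order one lower.\<close>

lemma Ck_SucD: "Ck (Suc k) f \<Longrightarrow> Ck k f"
proof (induction k arbitrary: f)
  case (Suc k)
  from Suc.prems have "f differentiable (at x)" for x by simp
  moreover have "Ck k (\<lambda>x. frechet_derivative f (at x) v)" for v
    by (rule Suc.IH) (use Suc.prems in simp)
  ultimately show ?case by simp
qed simp

lemma Ck_const: "Ck k (\<lambda>x. c)"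
proof (induction k arbitrary: c)
  case (Suc k)
  show ?case by (rule Ck_SucI[where f'="\<lambda>x v. 0"]) (auto intro: Suc)
qed simp

lemma Ck_add: "Ck k f \<Longrightarrow> Ck k g \<Longrightarrow> Ck k (\<lambda>x. f x + g x)"
proof (induction k arbitrary: f g)
  case (Suc k)
  show ?case
  proof (rule Ck_SucI)
    show "((\<lambda>x. f x + g x) has_derivative
      (\<lambda>v. frechet_derivative f (at x) v + frechet_derivative g (at x) v)) (at x)" for x
      using Suc.prems by (intro has_derivative_add Ck_Suc_derivative)
    show "Ck k (\<lambda>x. frechet_derivative f (at x) v + frechet_derivative g (at x) v)" for v
      by (rule Suc.IH) (use Suc.prems in simp_all)
  qed
qed simp

lemma Ck_mult: "Ck k f \<Longrightarrow> Ck k g \<Longrightarrow> Ck k (\<lambda>x. f x * g x)"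
proof (induction k arbitrary: f g)
  case (Suc k)
  show ?case
  proof (rule Ck_SucI)
    show "((\<lambda>x. f x * g x) has_derivative
      (\<lambda>v. f x * frechet_derivative g (at x) v + frechet_derivative f (at x) v * g x)) (at x)" for x
      using Suc.prems by (intro has_derivative_mult Ck_Suc_derivative)
    show "Ck k (\<lambda>x. f x * frechet_derivative g (at x) v + frechet_derivative f (at x) v * g x)" for v
      by (intro Ck_add Suc.IH Ck_SucD[OF Suc.prems(1)] Ck_SucD[OF Suc.prems(2)])
         (use Suc.prems in simp_all)
  qed
qed simp

lemma Ck_compose_linear:
  fixes L :: "'a::euclidean_space \<Rightarrow> 'b::euclidean_space"
  assumes L: "bounded_linear L"
  shows "Ck k f \<Longrightarrow> Ck k (\<lambda>x. f (L x))"
proof (induction k arbitrary: f)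
  case (Suc k)
  show ?case
  proof (rule Ck_SucI)
    show "((\<lambda>x. f (L x)) has_derivative
      (\<lambda>v. frechet_derivative f (at (L x)) (L v))) (at x)" for x
      using has_derivative_compose[OF bounded_linear_imp_has_derivative[OF L] Ck_Suc_derivative[OF Suc.prems]]
      by simp
    show "Ck k (\<lambda>x. frechet_derivative f (at (L x)) (L v))" for v
      by (rule Suc.IH) (use Suc.prems in simp)
  qed
qed simp

lemma Ck_compose_real:
  fixes f :: "'a::euclidean_space \<Rightarrow> real" and h :: "real \<Rightarrow> real"
  shows "Ck k h \<Longrightarrow> Ck k f \<Longrightarrow> Ck k (\<lambda>x. h (f x))"
proof (induction k arbitrary: h)
  case (Suc k)
  \<comment> \<open>A linear map on the reals is multiplication by its value at 1. This writes the
    chain rule as a product whose first factor is again a composition with \<open>f\<close>, so that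
    the induction hypothesis applies to the derivative of \<open>h\<close>.\<close>
  have eq: "frechet_derivative h (at y) r = r * frechet_derivative h (at y) 1" for y r
    using linear_cmul[OF has_derivative_linear[OF Ck_Suc_derivative[OF Suc.prems(1)]], of y r 1] by simp
  show ?case
  proof (rule Ck_SucI)
    show "((\<lambda>x. h (f x)) has_derivative
      (\<lambda>v. frechet_derivative h (at (f x)) (frechet_derivative f (at x) v))) (at x)" for x
      using has_derivative_compose[OF Ck_Suc_derivative[OF Suc.prems(2)] Ck_Suc_derivative[OF Suc.prems(1)]]
      by simp
    show "Ck k (\<lambda>x. frechet_derivative h (at (f x)) (frechet_derivative f (at x) v))" for v
    proof -
      have "Ck k (\<lambda>y. frechet_derivative h (at y) 1)" using Suc.prems(1) by simp
      then have "Ck k (\<lambda>x. frechet_derivative h (at (f x)) 1)"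
        using Ck_SucD[OF Suc.prems(2)] by (rule Suc.IH)
      moreover have "Ck k (\<lambda>x. frechet_derivative f (at x) v)" using Suc.prems(2) by simp
      ultimately show ?thesis
        unfolding eq[of "f _" "frechet_derivative f (at _) v"] by (intro Ck_mult)
    qed
  qed
qed simp

lemma Ck_Suc_realI:
  assumes "\<And>x::real. (f has_real_derivative f' x) (at x)" "Ck k f'"
  shows "Ck (Suc k) f"
proof (rule Ck_SucI)
  show "(f has_derivative (\<lambda>v. f' x * v)) (at x)" for x
    using assms(1) by (simp add: has_field_derivative_def)
  show "Ck k (\<lambda>x. f' x * v)" for v
    using assms(2) by (intro Ck_mult Ck_const)
qed

lemma Ck_linear:
  assumes "bounded_linear (f :: 'a::euclidean_space \<Rightarrow> real)" shows "Ck k f"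
proof (cases k)
  case (Suc m)
  show ?thesis unfolding Suc
    by (rule Ck_SucI[where f'="\<lambda>x. f"])
       (rule bounded_linear_imp_has_derivative[OF assms] Ck_const)+
qed simp

section \<open>Closure properties of smooth functions\<close>

lemma smooth_const: "smooth (\<lambda>x. c)"
  and smooth_add: "smooth f \<Longrightarrow> smooth g \<Longrightarrow> smooth (\<lambda>x. f x + g x)"
  and smooth_mult: "smooth f \<Longrightarrow> smooth g \<Longrightarrow> smooth (\<lambda>x. f x * g x)"
  for f :: "'a::euclidean_space \<Rightarrow> real"
  by (simp_all add: smooth_iff_Ck Ck_const Ck_add Ck_mult)

lemma smooth_compose_linear:
  "bounded_linear L \<Longrightarrow> smooth f \<Longrightarrow> smooth (\<lambda>x. f (L x))"
  for L :: "'a::euclidean_space \<Rightarrow> 'b::euclidean_space"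
  by (simp add: smooth_iff_Ck Ck_compose_linear)

lemma smooth_compose_real:
  "smooth h \<Longrightarrow> smooth f \<Longrightarrow> smooth (\<lambda>x. h (f x))" for h :: "real \<Rightarrow> real"
  by (simp add: smooth_iff_Ck Ck_compose_real)

lemma smooth_linear: "bounded_linear f \<Longrightarrow> smooth f"
  by (simp add: smooth_iff_Ck Ck_linear)

lemma smooth_realI:
  assumes "\<And>x::real. (f has_real_derivative f' x) (at x)" "smooth f'"
  shows "smooth f"
  unfolding smooth_iff_Ck
proof
  fix k show "Ck k f" 
    using Ck_Suc_realI[OF assms(1)] assms(2) Ck_SucD[of k f] by (simp add: smooth_iff_Ck)
qed

lemma smooth_diff: "smooth f \<Longrightarrow> smooth g \<Longrightarrow> smooth (\<lambda>x. f x - g x)"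
  for f :: "'a::euclidean_space \<Rightarrow> real"
  using smooth_add[OF _ smooth_mult[OF smooth_const[of "-1"]], of f g] by simp

lemma smooth_sum: "(\<And>i. i \<in> I \<Longrightarrow> smooth (f i)) \<Longrightarrow> smooth (\<lambda>x. \<Sum>i\<in>I. f i x)"
  by (induction I rule: infinite_finite_induct) (auto intro: smooth_const smooth_add)

lemma smooth_has_derivative:
  "smooth f \<Longrightarrow> (f has_derivative frechet_derivative f (at x)) (at x)"
  using Ck_Suc_derivative smooth_iff_Ck by blast

lemma smooth_frechet_derivative: "smooth f \<Longrightarrow> smooth (\<lambda>x. frechet_derivative f (at x) v)"
  by (metis Ck.simps(2) smooth_iff_Ck)

lemma smooth_continuous_on: "smooth f \<Longrightarrow> continuous_on A f"
  by (meson continuous_at_imp_continuous_on has_derivative_continuous smooth_has_derivative)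

lemma smooth_borel_measurable: "smooth f \<Longrightarrow> f \<in> borel_measurable borel"
  by (intro borel_measurable_continuous_onI smooth_continuous_on)

lemma smooth_dist_square: "smooth (\<lambda>y::'a::euclidean_space. (norm (y - x))\<^sup>2)"
proof -
  have "(\<lambda>y. (norm (y - x))\<^sup>2) = (\<lambda>y. (\<Sum>i\<in>Basis. (y \<bullet> i - x \<bullet> i) * (y \<bullet> i - x \<bullet> i)))"
    by (subst power2_norm_eq_inner, subst euclidean_inner) (simp add: inner_diff_left)
  then show ?thesis
    by (simp only:) (intro smooth_sum smooth_mult smooth_diff smooth_const smooth_linear
        bounded_linear_inner_left)
qed

text \<open>The flat function \<open>exp (- 1 / x)\<close>, continued by zero to the left. The
  powers of \<open>inverse x\<close> make the family closed under differentiation up to linear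
  combinations, so that one induction over all \<open>m\<close> at once gives smoothness.\<close>

definition exp_inv :: "nat \<Rightarrow> real \<Rightarrow> real" where
  "exp_inv m x = (if x \<le> 0 then 0 else exp (- inverse x) * inverse x ^ m)"

lemma exp_inv_has_derivative:
  "(exp_inv m has_real_derivative exp_inv (m + 2) x - real m * exp_inv (m + 1) x) (at x)"
proof -
  consider "x < 0" | "x = 0" | "x > 0" by linarith
  then show ?thesis
  proof cases
    case 1
    have "((\<lambda>_. 0) has_real_derivative 0) (at x)" by simp
    moreover have "\<forall>\<^sub>F y in nhds x. exp_inv m y = 0"
      using eventually_nhds_in_open[of "{..<0}" x] 1
      by (auto elim!: eventually_mono simp: exp_inv_def)
    ultimately show ?thesis
      using 1 by (subst DERIV_cong_ev[OF refl _ refl, where g="\<lambda>_. 0"]) (auto simp: exp_inv_def)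
  next
    case 3
    have ev: "\<forall>\<^sub>F y in nhds x. exp_inv m y = exp (- inverse y) * inverse y ^ m"
      using eventually_nhds_in_open[of "{0<..}" x] 3
      by (auto elim!: eventually_mono simp: exp_inv_def)
    have "((\<lambda>y. exp (- inverse y) * inverse y ^ m) has_real_derivative
        exp_inv (m + 2) x - real m * exp_inv (m + 1) x) (at x)"
    proof -
      \<comment> \<open>For \<open>m = 0\<close> the exponent \<open>m - 1\<close> is truncated, but
        the factor \<open>real m\<close> annihilates both sides.\<close>
      have "real m * inverse x ^ (m - 1) * (inverse x * inverse x) = real m * inverse x ^ (m + 1)"
        by (cases m) simp_all
      then show ?thesis
        using 3 by (auto intro!: derivative_eq_intros simp: exp_inv_def algebra_simps power2_eq_square)
    qed
    then show ?thesis
      by (subst DERIV_cong_ev[OF refl ev refl])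
  next
    case 2
    \<comment> \<open>With \<open>inverse y\<close> in place of \<open>y\<close> this is the decay
      of the right-hand difference quotient at 0; the left-hand one is identically zero.\<close>
    have "((\<lambda>y::real. y ^ (m + 1) / exp y) \<longlongrightarrow> 0) at_top"
      by (rule tendsto_power_div_exp_0)
    then have "((\<lambda>y::real. inverse y ^ (m + 1) / exp (inverse y)) \<longlongrightarrow> 0) (at_right 0)"
      using filterlim_inverse_at_top_right by (rule filterlim_compose)
    then have r: "((\<lambda>y. exp_inv m y / y) \<longlongrightarrow> 0) (at_right 0)"
      by (rule Lim_transform_eventually)
         (auto simp: exp_inv_def exp_minus field_simps eventually_at_right_less
           intro!: eventually_mono[OF eventually_at_right_less[of 0]])
    have l: "((\<lambda>y. exp_inv m y / y) \<longlongrightarrow> 0) (at_left 0)"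
      by (rule Lim_transform_eventually[OF tendsto_const])
         (auto simp: exp_inv_def eventually_at_filter)
    from r l have "((\<lambda>y. exp_inv m y / y) \<longlongrightarrow> 0) (at 0)"
      by (simp add: filterlim_at_split)
    then show ?thesis
      using 2 by (simp add: has_field_derivative_iff exp_inv_def)
  qed
qed

lemma smooth_exp_inv: "smooth (exp_inv m)"
  unfolding smooth_iff_Ck
proof
  fix k show "Ck k (exp_inv m)"
  proof (induction k arbitrary: m)
    case (Suc k)
    have "Ck k (\<lambda>x. exp_inv (m + 2) x + (- real m) * exp_inv (m + 1) x)"
      by (intro Ck_add Ck_mult Ck_const Suc)
    then show ?case
      using exp_inv_has_derivative by (intro Ck_Suc_realI) auto
  qed simp
qed

text \<open>A primitive of the bump \<open>\<rho>\<close>, which is positive exactly between -1 and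
  1, is shifted and divided by its total increment \<open>d\<close>. Outside that interval the
  primitive is constant by the mean value theorem.\<close>

lemma smooth_step_exists:
  obtains \<Phi> :: "real \<Rightarrow> real" where "smooth \<Phi>" "\<And>x. 0 \<le> \<Phi> x" "\<And>x. \<Phi> x \<le> 1"
    "\<And>x. x \<le> -1 \<Longrightarrow> \<Phi> x = 0" "\<And>x. x \<ge> 1 \<Longrightarrow> \<Phi> x = 1"
proof -
  define \<rho> where "\<rho> x = exp_inv 0 (1 + x) * exp_inv 0 (1 - x)" for x
  have sm: "smooth \<rho>"
    unfolding \<rho>_def
    by (intro smooth_mult smooth_compose_real[OF smooth_exp_inv] smooth_add smooth_diff
        smooth_const smooth_linear bounded_linear_ident)
  obtain F where F: "\<And>x. (F has_real_derivative \<rho> x) (at x)"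
  proof -
    have "isCont \<rho> x" for x
      using smooth_continuous_on[OF sm, of UNIV] by (simp add: continuous_on_eq_continuous_at)
    then have "\<exists>F. \<forall>x. (F has_vector_derivative \<rho> x) (at x)"
      using einterval_antiderivative[of "-\<infinity>" "\<infinity>" \<rho>] by simp
    then show thesis
      using that by (auto simp: has_real_derivative_iff_has_vector_derivative)
  qed
  have pos: "\<rho> x \<ge> 0" for x by (simp add: \<rho>_def exp_inv_def)
  have spos: "\<rho> x > 0" if "-1 < x" "x < 1" for x using that by (simp add: \<rho>_def exp_inv_def)
  have mono: "F x \<le> F y" if "x \<le> y" for x y
    using DERIV_nonneg_imp_nondecreasing[OF that] F pos by blast
  have l: "F x = F (-1)" if "x \<le> -1" for x
  proof (cases "x = -1")
    case False
    then have "x < -1" using that by simp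
    from MVT2[OF this F] obtain z where "x < z" "z < -1" "F (-1) - F x = (-1 - x) * \<rho> z" by auto
    then show ?thesis by (simp add: \<rho>_def exp_inv_def)
  qed simp
  have r: "F x = F 1" if "x \<ge> 1" for x
  proof (cases "x = 1")
    case False
    then have "1 < x" using that by simp
    from MVT2[OF this F] obtain z where "1 < z" "z < x" "F x - F 1 = (x - 1) * \<rho> z" by auto
    then show ?thesis by (simp add: \<rho>_def exp_inv_def)
  qed simp
  from MVT2[of "-1" 1, OF _ F] obtain z where z: "-1 < z" "z < 1" "F 1 - F (-1) = 2 * \<rho> z" by auto
  define d where "d = F 1 - F (-1)"
  have d: "d > 0" using z spos[of z] by (simp add: d_def)
  define \<Phi> where "\<Phi> x = (F x + - F (-1)) * inverse d" for x
  have "smooth F" by (rule smooth_realI[OF F sm])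
  then have "smooth \<Phi>" unfolding \<Phi>_def by (intro smooth_mult smooth_add smooth_const)
  moreover have "0 \<le> \<Phi> x" "\<Phi> x \<le> 1" for x
  proof -
    have "F (-1) \<le> F x" "F x \<le> F 1" using mono l r by (metis linear)+
    then show "0 \<le> \<Phi> x" "\<Phi> x \<le> 1" using d by (auto simp: \<Phi>_def d_def field_simps)
  qed
  moreover have "\<Phi> x = 0" if "x \<le> -1" for x using l[OF that] by (simp add: \<Phi>_def)
  moreover have "\<Phi> x = 1" if "x \<ge> 1" for x using r[OF that] d by (simp add: \<Phi>_def d_def)
  ultimately show thesis by (rule that)
qed

text \<open>Finitely many balls whose closures lie in \<open>U\<close> cover \<open>K\<close>; the
  sum \<open>S\<close> of one bump per ball is positive on \<open>K\<close> and vanishes off the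
  balls. By compactness \<open>S\<close> has a positive lower bound \<open>m\<close> on
  \<open>K\<close>, and a smooth step flattens all values from \<open>m\<close> upwards to
  1.\<close>

lemma test_function_cutoff:
  fixes K :: "'a::euclidean_space set"
  assumes "compact K" "open U" "K \<subseteq> U"
  obtains \<zeta> where "test_function U \<zeta>" "\<And>x. 0 \<le> \<zeta> x" "\<And>x. \<zeta> x \<le> 1" "\<And>x. x \<in> K \<Longrightarrow> \<zeta> x = 1"
proof -
  have "\<exists>r>0. cball x r \<subseteq> U" if "x \<in> K" for x
    using assms that open_contains_cball by blast
  then obtain r where r: "\<And>x. x \<in> K \<Longrightarrow> r x > 0 \<and> cball x (r x) \<subseteq> U" by metis
  have "K \<subseteq> (\<Union>x\<in>K. ball x (r x))" using r by force
  then obtain I where I: "I \<subseteq> K" "finite I" "K \<subseteq> (\<Union>x\<in>I. ball x (r x))"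
    using compactE_image[OF assms(1), of K "\<lambda>x. ball x (r x)"] by blast
  define S where "S y = (\<Sum>x\<in>I. exp_inv 0 ((r x)\<^sup>2 - (norm (y - x))\<^sup>2))" for y
  have smS: "smooth S"
    unfolding S_def
    by (intro smooth_sum smooth_compose_real[OF smooth_exp_inv] smooth_diff
        smooth_const smooth_dist_square)
  have nn: "exp_inv 0 y \<ge> 0" for y by (simp add: exp_inv_def)
  have in_ball: "exp_inv 0 ((r x)\<^sup>2 - (norm (y - x))\<^sup>2) \<noteq> 0 \<longleftrightarrow> y \<in> ball x (r x)" if "x \<in> I" for x y
  proof -
    have "(norm (y - x))\<^sup>2 < (r x)\<^sup>2 \<longleftrightarrow> norm (y - x) < r x"
      using r[of x] that I power_strict_mono[of "norm (y - x)" "r x" 2]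
        power2_less_imp_less[of "norm (y - x)" "r x"] by fastforce
    then show ?thesis by (auto simp: exp_inv_def dist_norm norm_minus_commute)
  qed
  have Spos: "S y > 0" if "y \<in> K" for y
  proof -
    obtain x where "x \<in> I" "y \<in> ball x (r x)" using I(3) \<open>y \<in> K\<close> by blast
    then have "exp_inv 0 ((r x)\<^sup>2 - (norm (y - x))\<^sup>2) > 0"
      using in_ball[of x y] nn[of "(r x)\<^sup>2 - (norm (y - x))\<^sup>2"] by simp
    then show ?thesis unfolding S_def using \<open>x \<in> I\<close> I(2) nn by (intro sum_pos2[of I x]) auto
  qed
  have supp: "S y = 0" if "y \<notin> (\<Union>x\<in>I. cball x (r x))" for y
    unfolding S_def
  proof (intro sum.neutral ballI)
    fix x assume "x \<in> I"
    then have "y \<notin> ball x (r x)" using that by auto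
    then show "exp_inv 0 ((r x)\<^sup>2 - (norm (y - x))\<^sup>2) = 0" using in_ball[OF \<open>x \<in> I\<close>] by blast
  qed
  obtain m where m: "m > 0" "\<And>y. y \<in> K \<Longrightarrow> S y \<ge> m"
  proof (cases "K = {}")
    case False
    then obtain x where "x \<in> K" "\<And>y. y \<in> K \<Longrightarrow> S x \<le> S y"
      using continuous_attains_inf[OF assms(1) _ smooth_continuous_on[OF smS]] by blast
    then show thesis using that[of "S x"] Spos by auto
  qed (use that[of 1] in auto)
  obtain \<Phi> :: "real \<Rightarrow> real" where \<Phi>: "smooth \<Phi>" "\<And>x. 0 \<le> \<Phi> x" "\<And>x. \<Phi> x \<le> 1"
    "\<And>x. x \<le> -1 \<Longrightarrow> \<Phi> x = 0" "\<And>x. x \<ge> 1 \<Longrightarrow> \<Phi> x = 1" by (rule smooth_step_exists) (rule that)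
  \<comment> \<open>The rescaling sends \<open>S y = 0\<close> to \<open>-1\<close>, where the step
    is 0, and every value \<open>S y \<ge> m\<close> to at least 1.\<close>
  define \<zeta> where "\<zeta> y = \<Phi> ((2 / m) * S y - 1)" for y
  have sm: "smooth \<zeta>" unfolding \<zeta>_def
    by (intro smooth_compose_real[OF \<Phi>(1)] smooth_diff smooth_mult smooth_const smS)
  have cp: "compact (\<Union>x\<in>I. cball x (r x))" using I by (intro compact_UN) auto
  have "{x. \<zeta> x \<noteq> 0} \<subseteq> (\<Union>x\<in>I. cball x (r x))"
    using supp \<Phi>(4) by (fastforce simp: \<zeta>_def)
  then have cl: "closure {x. \<zeta> x \<noteq> 0} \<subseteq> (\<Union>x\<in>I. cball x (r x))"
    using compact_imp_closed[OF cp] by (rule closure_minimal)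
  have "compact (closure {x. \<zeta> x \<noteq> 0})"
    using cl cp compact_imp_bounded bounded_subset by (metis closed_closure compact_eq_bounded_closed)
  moreover have "closure {x. \<zeta> x \<noteq> 0} \<subseteq> U" using cl r I by blast
  ultimately have "test_function U \<zeta>" using sm by (simp add: test_function_def)
  moreover have "\<zeta> x = 1" if "x \<in> K" for x
    unfolding \<zeta>_def by (rule \<Phi>(5)) (use m that in \<open>auto simp: field_simps\<close>)
  ultimately show thesis using that \<Phi> by (auto simp: \<zeta>_def)
qed

section \<open>Square-integrable functions\<close>

lemma Lspace2_iff:
  "f \<in> Lspace 2 M \<longleftrightarrow> f \<in> borel_measurable M \<and> integrable M (\<lambda>x. (norm (f x))\<^sup>2)"
  by (simp add: Lspace_def powr_numeral)

lemma Lspace2_measurable: "f \<in> Lspace 2 M \<Longrightarrow> f \<in> borel_measurable M"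
  by (simp add: Lspace2_iff)

lemma Lnorm2_eq: "Lnorm 2 M f = sqrt (LINT x|M. (norm (f x))\<^sup>2)"
  by (simp add: Lnorm_def powr_numeral powr_half_sqrt integral_nonneg_AE)

lemma Lnorm2_square: "(Lnorm 2 M f)\<^sup>2 = (LINT x|M. (norm (f x))\<^sup>2)"
  by (simp add: Lnorm2_eq integral_nonneg_AE)

lemma Lnorm_nonneg: "0 \<le> Lnorm q M f"
  by (simp add: Lnorm_def)

lemma Lnorm2_cong_AE:
  assumes "AE x in M. f x = g x" "f \<in> borel_measurable M" "g \<in> borel_measurable M"
  shows "Lnorm 2 M f = Lnorm 2 M g"
proof -
  have "(LINT x|M. (norm (f x))\<^sup>2) = (LINT x|M. (norm (g x))\<^sup>2)"
    using assms by (intro integral_cong_AE) auto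
  then show ?thesis by (simp add: Lnorm2_eq)
qed

lemma Lspace2_inner_integrable:
  assumes "f \<in> Lspace 2 M" "g \<in> Lspace 2 M"
  shows "integrable M (\<lambda>x. f x \<bullet> g x)"
proof (rule Bochner_Integration.integrable_bound)
  show "integrable M (\<lambda>x. (norm (f x))\<^sup>2 + (norm (g x))\<^sup>2)"
    using assms by (auto simp: Lspace2_iff)
  have "\<bar>f x \<bullet> g x\<bar> \<le> (norm (f x))\<^sup>2 + (norm (g x))\<^sup>2" for x
  proof -
    have "\<bar>f x \<bullet> g x\<bar> \<le> norm (f x) * norm (g x)" by (rule Cauchy_Schwarz_ineq2)
    also have "\<dots> \<le> (norm (f x))\<^sup>2 + (norm (g x))\<^sup>2"
    proof -
      have "0 \<le> norm (f x) * norm (g x)" by simp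
      then show ?thesis using sum_squares_bound[of "norm (f x)" "norm (g x)"] by linarith
    qed
    finally show ?thesis .
  qed
  then show "AE x in M. norm (f x \<bullet> g x) \<le> norm ((norm (f x))\<^sup>2 + (norm (g x))\<^sup>2)" by simp
  show "(\<lambda>x. f x \<bullet> g x) \<in> borel_measurable M"
    using assms by (auto simp: Lspace2_iff)
qed

lemma Lspace2_mult_integrable:
  fixes f g :: "'a \<Rightarrow> real"
  shows "f \<in> Lspace 2 M \<Longrightarrow> g \<in> Lspace 2 M \<Longrightarrow> integrable M (\<lambda>x. f x * g x)"
  using Lspace2_inner_integrable[of f M g] by simp

lemma Lspace2_scaleR: "f \<in> Lspace 2 M \<Longrightarrow> (\<lambda>x. c *\<^sub>R f x) \<in> Lspace 2 M"
  by (auto simp: Lspace2_iff power_mult_distrib)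

lemma Lspace2_add:
  assumes "f \<in> Lspace 2 M" "g \<in> Lspace 2 M"
  shows "(\<lambda>x. f x + g x) \<in> Lspace 2 M"
proof -
  have "integrable M (\<lambda>x. (norm (f x))\<^sup>2 + 2 * (f x \<bullet> g x) + (norm (g x))\<^sup>2)"
    using assms Lspace2_inner_integrable[OF assms] by (auto simp: Lspace2_iff)
  moreover have "(norm (f x + g x))\<^sup>2 = (norm (f x))\<^sup>2 + 2 * (f x \<bullet> g x) + (norm (g x))\<^sup>2" for x
    by (simp add: power2_norm_eq_inner inner_add inner_commute algebra_simps)
  moreover have "(\<lambda>x. f x + g x) \<in> borel_measurable M"
    using assms by (intro borel_measurable_add) (simp_all add: Lspace2_iff)
  ultimately show ?thesis by (simp add: Lspace2_iff)
qed

lemma Lspace2_diff: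
  assumes "f \<in> Lspace 2 M" "g \<in> Lspace 2 M"
  shows "(\<lambda>x. f x - g x) \<in> Lspace 2 M"
  using Lspace2_add[OF assms(1) Lspace2_scaleR[OF assms(2), of "-1"]] by simp

lemma Lspace2_norm: "f \<in> Lspace 2 M \<Longrightarrow> (\<lambda>x. norm (f x)) \<in> Lspace 2 M"
  by (auto simp: Lspace2_iff)

lemma Lspace2_bounded:
  assumes "finite_measure M" "f \<in> borel_measurable M" "AE x in M. norm (f x) \<le> B"
  shows "f \<in> Lspace 2 M"
proof -
  interpret finite_measure M by fact
  have "integrable M (\<lambda>x. (norm (f x))\<^sup>2)"
  proof (rule integrable_const_bound)
    show "AE x in M. norm ((norm (f x))\<^sup>2) \<le> B\<^sup>2"
      using assms(3) by eventually_elim (simp add: power_mono)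
  qed (use assms in measurable)
  then show ?thesis using assms by (simp add: Lspace2_iff)
qed

lemma Lspace2_integrable:
  assumes "finite_measure M" "f \<in> Lspace 2 M"
  shows "integrable M f"
proof (rule Bochner_Integration.integrable_bound)
  interpret finite_measure M by fact
  show "integrable M (\<lambda>x. 1 + (norm (f x))\<^sup>2)"
    using assms by (simp add: Lspace2_iff)
  have "norm (f x) \<le> 1 + (norm (f x))\<^sup>2" for x
    using sum_squares_bound[of "norm (f x)" 1] norm_ge_zero[of "f x"]
    unfolding mult_1_right power_one by linarith
  then show "AE x in M. norm (f x) \<le> norm (1 + (norm (f x))\<^sup>2)" by simp
qed (use assms in \<open>simp add: Lspace2_iff\<close>)

lemma Lnorm2_add_square:
  assumes "f \<in> Lspace 2 M" "g \<in> Lspace 2 M"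
  shows "(Lnorm 2 M (\<lambda>x. f x + g x))\<^sup>2 =
    (Lnorm 2 M f)\<^sup>2 + 2 * (LINT x|M. f x \<bullet> g x) + (Lnorm 2 M g)\<^sup>2"
proof -
  have "(norm (f x + g x))\<^sup>2 = (norm (f x))\<^sup>2 + 2 * (f x \<bullet> g x) + (norm (g x))\<^sup>2" for x
    by (simp add: power2_norm_eq_inner inner_add inner_commute algebra_simps)
  then show ?thesis
    using assms Lspace2_inner_integrable[OF assms] by (simp add: Lnorm2_square Lspace2_iff)
qed

lemma Lnorm2_scaleR: "Lnorm 2 M (\<lambda>x. c *\<^sub>R f x) = \<bar>c\<bar> * Lnorm 2 M f"
  by (simp add: Lnorm2_eq power_mult_distrib real_sqrt_mult)

text \<open>The squared norm of \<open>f + r g\<close> is a nonnegative quadratic polynomial in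
  \<open>r\<close>. For \<open>b \<noteq> 0\<close> it is evaluated at its minimum
  \<open>r = - c / b\<^sup>2\<close>; for \<open>b = 0\<close> it is affine, and an affine function
  bounded below is constant.\<close>

lemma Lspace2_Cauchy_Schwarz:
  assumes "f \<in> Lspace 2 M" "g \<in> Lspace 2 M"
  shows "\<bar>LINT x|M. f x \<bullet> g x\<bar> \<le> Lnorm 2 M f * Lnorm 2 M g"
proof -
  define a b c where "a = Lnorm 2 M f" and "b = Lnorm 2 M g" and "c = (LINT x|M. f x \<bullet> g x)"
  have ab: "a \<ge> 0" "b \<ge> 0" by (simp_all add: a_def b_def Lnorm_nonneg)
  have q: "0 \<le> a\<^sup>2 + 2 * r * c + r\<^sup>2 * b\<^sup>2" for r
  proof -
    have "0 \<le> (Lnorm 2 M (\<lambda>x. f x + r *\<^sub>R g x))\<^sup>2" by simp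
    also have "\<dots> = a\<^sup>2 + 2 * r * c + r\<^sup>2 * b\<^sup>2"
      using Lnorm2_add_square[OF assms(1) Lspace2_scaleR[OF assms(2), of r]]
      by (simp add: Lnorm2_scaleR power_mult_distrib a_def b_def c_def)
    finally show ?thesis .
  qed
  have "c\<^sup>2 \<le> (a * b)\<^sup>2"
  proof (cases "b = 0")
    case True
    have "c = 0"
    proof (rule ccontr)
      assume "c \<noteq> 0"
      then show False using q[of "- (a\<^sup>2 + 1) / (2 * c)"] True by (simp add: field_simps)
    qed
    then show ?thesis by simp
  next
    case False
    then have "0 \<le> (a\<^sup>2 + 2 * (- c / b\<^sup>2) * c + (- c / b\<^sup>2)\<^sup>2 * b\<^sup>2) * b\<^sup>2"
      using q[of "- c / b\<^sup>2"] by (intro mult_nonneg_nonneg) auto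
    also have "\<dots> = (a * b)\<^sup>2 - c\<^sup>2"
      using False by (simp add: field_simps power2_eq_square)
    finally show ?thesis by simp
  qed
  then show ?thesis
    using ab by (simp add: a_def[symmetric] b_def[symmetric] c_def[symmetric] abs_le_square_iff[symmetric])
qed

lemma Lspace2_Cauchy_Schwarz_mult:
  fixes f g :: "'a \<Rightarrow> real"
  assumes "f \<in> Lspace 2 M" "g \<in> Lspace 2 M"
  shows "\<bar>LINT x|M. f x * g x\<bar> \<le> Lnorm 2 M f * Lnorm 2 M g"
  using Lspace2_Cauchy_Schwarz[OF assms] by simp

lemma Lnorm2_triangle:
  assumes "f \<in> Lspace 2 M" "g \<in> Lspace 2 M"
  shows "Lnorm 2 M (\<lambda>x. f x + g x) \<le> Lnorm 2 M f + Lnorm 2 M g"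
proof (rule power2_le_imp_le)
  show "(Lnorm 2 M (\<lambda>x. f x + g x))\<^sup>2 \<le> (Lnorm 2 M f + Lnorm 2 M g)\<^sup>2"
    using Lspace2_Cauchy_Schwarz[OF assms] by (simp add: Lnorm2_add_square[OF assms] power2_sum)
qed (simp add: Lnorm_nonneg)

lemma Lnorm2_minus: "Lnorm 2 M (\<lambda>x. - f x) = Lnorm 2 M f"
  by (simp add: Lnorm2_eq)

lemma Lnorm2_commute: "Lnorm 2 M (\<lambda>x. f x - g x) = Lnorm 2 M (\<lambda>x. g x - f x)"
  by (simp add: Lnorm2_eq norm_minus_commute)

lemma Lnorm2_triangle_diff:
  assumes "f \<in> Lspace 2 M" "g \<in> Lspace 2 M"
  shows "Lnorm 2 M (\<lambda>x. f x - g x) \<le> Lnorm 2 M f + Lnorm 2 M g"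
  using Lnorm2_triangle[OF assms(1) Lspace2_scaleR[OF assms(2), of "-1"]]
  by (simp add: Lnorm2_minus)

lemma Lnorm2_triangle_rev:
  assumes "f \<in> Lspace 2 M" "g \<in> Lspace 2 M"
  shows "\<bar>Lnorm 2 M f - Lnorm 2 M g\<bar> \<le> Lnorm 2 M (\<lambda>x. f x - g x)"
  using Lnorm2_triangle[OF Lspace2_diff[OF assms] assms(2)]
    Lnorm2_triangle[OF Lspace2_diff[OF assms(2,1)] assms(1)] Lnorm2_commute[of M f g]
  by simp

lemma Lnorm2_eq_0_imp_AE:
  assumes "f \<in> Lspace 2 M" "Lnorm 2 M f = 0"
  shows "AE x in M. f x = 0"
proof -
  have "(LINT x|M. (norm (f x))\<^sup>2) = 0" using assms(2) Lnorm2_square[of M f] by simp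
  then show ?thesis
    using assms(1) by (subst (asm) integral_nonneg_eq_0_iff_AE) (auto simp: Lspace2_iff)
qed

lemma Lnorm2_tendsto:
  assumes "\<And>k. f k \<in> Lspace 2 M" "g \<in> Lspace 2 M"
    and "((\<lambda>k. Lnorm 2 M (\<lambda>x. f k x - g x)) \<longlongrightarrow> 0) F"
  shows "((\<lambda>k. Lnorm 2 M (f k)) \<longlongrightarrow> Lnorm 2 M g) F"
proof (rule LIM_zero_cancel, rule tendsto_rabs_zero_cancel, rule tendsto_sandwich[OF _ _ tendsto_const assms(3)])
  show "\<forall>\<^sub>F k in F. \<bar>Lnorm 2 M (f k) - Lnorm 2 M g\<bar> \<le> Lnorm 2 M (\<lambda>x. f k x - g x)"
    using Lnorm2_triangle_rev[OF assms(1,2)] by (intro always_eventually) blast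
qed simp

lemma Lspace2_inner_tendsto:
  assumes "\<And>k. f k \<in> Lspace 2 M" "g \<in> Lspace 2 M" "h \<in> Lspace 2 M"
    and "((\<lambda>k. Lnorm 2 M (\<lambda>x. f k x - g x)) \<longlongrightarrow> 0) F"
  shows "((\<lambda>k. LINT x|M. h x \<bullet> f k x) \<longlongrightarrow> (LINT x|M. h x \<bullet> g x)) F"
proof (rule LIM_zero_cancel, rule tendsto_rabs_zero_cancel, rule tendsto_sandwich[OF _ _ tendsto_const])
  show "((\<lambda>k. Lnorm 2 M h * Lnorm 2 M (\<lambda>x. f k x - g x)) \<longlongrightarrow> 0) F"
    using tendsto_mult_right_zero[OF assms(4)] by simp
  have "\<bar>(LINT x|M. h x \<bullet> f k x) - (LINT x|M. h x \<bullet> g x)\<bar> \<le> Lnorm 2 M h * Lnorm 2 M (\<lambda>x. f k x - g x)" for k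
    using Lspace2_Cauchy_Schwarz[OF assms(3) Lspace2_diff[OF assms(1,2)], of k]
      Lspace2_inner_integrable[OF assms(3,2)] Lspace2_inner_integrable[OF assms(3,1)]
    by (simp add: inner_diff_right)
  then show "\<forall>\<^sub>F k in F. \<bar>(LINT x|M. h x \<bullet> f k x) - (LINT x|M. h x \<bullet> g x)\<bar>
      \<le> Lnorm 2 M h * Lnorm 2 M (\<lambda>x. f k x - g x)" by (intro always_eventually) blast
qed simp

section \<open>Weak gradients\<close>

lemma test_function_smooth: "test_function U f \<Longrightarrow> smooth f"
  by (simp add: test_function_def)

lemma test_function_eq_0: "test_function U f \<Longrightarrow> x \<notin> U \<Longrightarrow> f x = 0"
  unfolding test_function_def using closure_subset[of "{x. f x \<noteq> 0}"] by blast

lemma test_function_mono: "test_function U f \<Longrightarrow> U \<subseteq> V \<Longrightarrow> test_function V f"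
  unfolding test_function_def by blast

lemma test_function_support:
  assumes "test_function U f" "smooth g" "\<And>x. x \<notin> closure {x. f x \<noteq> 0} \<Longrightarrow> g x = 0"
  shows "test_function U g"
proof -
  have "{x. g x \<noteq> 0} \<subseteq> closure {x. f x \<noteq> 0}" using assms(3) by blast
  then have sub: "closure {x. g x \<noteq> 0} \<subseteq> closure {x. f x \<noteq> 0}"
    by (simp add: closure_minimal)
  moreover have "compact (closure {x. g x \<noteq> 0})"
    using assms(1) sub bounded_subset[OF compact_imp_bounded sub]
    by (simp add: test_function_def compact_eq_bounded_closed)
  moreover have "closure {x. f x \<noteq> 0} \<subseteq> U" using assms(1) by (simp add: test_function_def)
  ultimately show ?thesis unfolding test_function_def using assms(2) by (meson order_trans)
qed

lemma test_function_mult: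
  assumes "smooth f" "test_function U g"
  shows "test_function U (\<lambda>x. f x * g x)"
  using assms(2)
proof (rule test_function_support)
  show "smooth (\<lambda>x. f x * g x)" using assms by (intro smooth_mult) (auto simp: test_function_def)
  show "f x * g x = 0" if "x \<notin> closure {x. g x \<noteq> 0}" for x
    using that closure_subset[of "{x. g x \<noteq> 0}"] by auto
qed

lemma test_function_frechet_derivative:
  assumes "test_function U f"
  shows "test_function U (\<lambda>x. frechet_derivative f (at x) v)"
  using assms
proof (rule test_function_support)
  show "smooth (\<lambda>x. frechet_derivative f (at x) v)"
    using assms by (intro smooth_frechet_derivative) (auto simp: test_function_def)
  show "frechet_derivative f (at x) v = 0" if x: "x \<notin> closure {x. f x \<noteq> 0}" for x
  proof -
    have "(f has_derivative (\<lambda>_. 0)) (at x)"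
    proof (rule has_derivative_transform_within_open[OF has_derivative_const])
      show "x \<in> - closure {x. f x \<noteq> 0}" using x by simp
      show "0 = f y" if "y \<in> - closure {x. f x \<noteq> 0}" for y
        using that closure_subset[of "{x. f x \<noteq> 0}"] by auto
    qed (rule open_Compl[OF closed_closure])
    from fun_cong[OF frechet_derivative_at[OF this], of v] show ?thesis by simp
  qed
qed

lemma test_function_bounded:
  assumes "test_function U f" obtains B where "\<And>x. \<bar>f x\<bar> \<le> B"
proof -
  have "compact (f ` closure {x. f x \<noteq> 0})"
    using assms by (intro compact_continuous_image smooth_continuous_on) (auto simp: test_function_def)
  then obtain B where B: "\<bar>y\<bar> \<le> B" if "y \<in> f ` closure {x. f x \<noteq> 0}" for y
    using compact_imp_bounded[of "f ` closure {x. f x \<noteq> 0}"] unfolding bounded_real by blast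
  have "\<bar>f x\<bar> \<le> max B 0" for x
  proof (cases "f x = 0")
    case False
    then have "x \<in> closure {x. f x \<noteq> 0}" using closure_subset[of "{x. f x \<noteq> 0}"] by blast
    then show ?thesis using B[OF imageI] by (simp add: le_max_iff_disj)
  qed simp
  then show thesis using that by blast
qed

lemma test_function_borel_measurable: "test_function U f \<Longrightarrow> f \<in> borel_measurable borel"
  by (simp add: smooth_borel_measurable test_function_def)

lemma test_function_integrable:
  assumes "test_function U f" shows "integrable lborel f"
proof -
  obtain B where B: "\<And>x. \<bar>f x\<bar> \<le> B" using test_function_bounded[OF assms] by blast
  let ?K = "closure {x. f x \<noteq> 0}"
  have K: "compact ?K" using assms by (simp add: test_function_def)
  show ?thesis
  proof (rule Bochner_Integration.integrable_bound)
    show "integrable lborel (\<lambda>x. B * indicator ?K x :: real)"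
      using K by (auto intro!: integrable_mult_right integrable_real_indicator
          emeasure_bounded_finite compact_imp_bounded)
    have "norm (f x) \<le> norm (B * indicator ?K x)" for x
      using B[of x] closure_subset[of "{x. f x \<noteq> 0}"] by (cases "f x = 0") (auto simp: indicator_def)
    then show "AE x in lborel. norm (f x) \<le> norm (B * indicator ?K x)" by simp
  qed (use test_function_borel_measurable[OF assms] in simp)
qed

lemma integral_lborel_translation:
  fixes g :: "'a::euclidean_space \<Rightarrow> real"
  assumes "g \<in> borel_measurable borel"
  shows "(LINT x|lborel. g (c + x)) = (LINT x|lborel. g x)"
proof -
  have "(LINT x|lborel. g x) = (LINT x|distr lborel borel ((+) c). g x)"
    by (simp add: lborel_distr_plus)
  also have "\<dots> = (LINT x|lborel. g (c + x))"
    using assms by (intro integral_distr) auto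
  finally show ?thesis by simp
qed

lemma smooth_line_derivative:
  assumes "smooth g"
  shows "((\<lambda>t. g (x + t *\<^sub>R v)) has_real_derivative frechet_derivative g (at (x + t *\<^sub>R v)) v) (at t)"
proof -
  have l: "((\<lambda>t. x + t *\<^sub>R v) has_derivative (\<lambda>s. s *\<^sub>R v)) (at t)"
    by (auto intro!: derivative_eq_intros)
  have "((\<lambda>t. g (x + t *\<^sub>R v)) has_derivative
      (\<lambda>s. frechet_derivative g (at (x + t *\<^sub>R v)) (s *\<^sub>R v))) (at t)"
    using has_derivative_compose[OF l smooth_has_derivative[OF assms]] by simp
  moreover have "frechet_derivative g (at y) (s *\<^sub>R v) = frechet_derivative g (at y) v * s" for y s
    using linear_cmul[OF has_derivative_linear[OF smooth_has_derivative[OF assms]]] by (simp add: mult.commute)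
  ultimately show ?thesis by (simp add: has_field_derivative_def)
qed

text \<open>The difference quotients have integral zero by translation invariance.\<close>

lemma integral_frechet_derivative_test_function:
  assumes "test_function U g"
  shows "(LINT x|lborel. frechet_derivative g (at x) v) = 0"
proof -
  let ?D = "\<lambda>x. frechet_derivative g (at x) v"
  have sm: "smooth g" using assms by (simp add: test_function_def)
  have "bounded (closure {x. g x \<noteq> 0})"
    using assms by (intro compact_imp_bounded) (simp add: test_function_def)
  then obtain R where "closure {x. g x \<noteq> 0} \<subseteq> ball 0 R"
    using bounded_subset_ballD[of _ 0] by blast
  then have R: "closure {x. g x \<noteq> 0} \<subseteq> cball 0 R" by auto
  have gR: "g x = 0" if "norm x > R" for x
    using R that closure_subset[of "{x. g x \<noteq> 0}"] by fastforce
  obtain B where B: "\<And>x. \<bar>?D x\<bar> \<le> B"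
    using test_function_bounded[OF test_function_frechet_derivative[OF assms]] by metis
  define h where "h n = inverse (real (Suc n))" for n
  have h: "h n > 0" "h n \<le> 1" for n by (auto simp: h_def field_simps)
  define q where "q n x = (g (h n *\<^sub>R v + x) - g x) / h n" for n x
  have gm: "g \<in> borel_measurable borel" using assms by (rule test_function_borel_measurable)
  have gi: "integrable lborel g" using assms by (rule test_function_integrable)
  have lim: "(\<lambda>n. q n x) \<longlonglongrightarrow> ?D x" for x
  proof -
    have "((\<lambda>t. (g (x + t *\<^sub>R v) - g x) / t) \<longlongrightarrow> ?D x) (at 0)"
      using smooth_line_derivative[OF sm, of x v 0] by (simp add: has_field_derivative_iff)
    moreover have "h \<longlonglongrightarrow> 0"
      unfolding h_def by (rule LIMSEQ_inverse_real_of_nat)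
    then have "filterlim h (at 0) sequentially"
      unfolding filterlim_at using h(1) by (simp add: less_imp_neq[THEN not_sym])
    ultimately have "(\<lambda>n. (g (x + h n *\<^sub>R v) - g x) / h n) \<longlonglongrightarrow> ?D x"
      by (rule filterlim_compose)
    then show ?thesis by (simp add: q_def add.commute)
  qed
  \<comment> \<open>The shift has norm at most \<open>norm v\<close>, so outside the enlarged ball
    both values of \<open>g\<close> vanish. Inside it the mean value theorem turns the quotient into
    a value of the derivative.\<close>
  have bound: "norm (q n x) \<le> B * indicator (cball 0 (R + norm v)) x" for n x
  proof (cases "norm x \<le> R + norm v")
    case True
    have "\<exists>t>0. t < h n \<and> g (x + h n *\<^sub>R v) - g (x + 0 *\<^sub>R v) = (h n - 0) * ?D (x + t *\<^sub>R v)"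
      by (rule MVT2[OF h(1) smooth_line_derivative[OF sm]])
    then obtain t where "g (x + h n *\<^sub>R v) - g (x + 0 *\<^sub>R v) = (h n - 0) * ?D (x + t *\<^sub>R v)"
      by blast
    then have "q n x = ?D (x + t *\<^sub>R v)" using h(1)[of n] by (simp add: q_def add.commute)
    then show ?thesis using B True by simp
  next
    case False
    have "norm (h n *\<^sub>R v) \<le> norm v" using h[of n] by (simp add: mult_left_le_one_le)
    then have "norm (h n *\<^sub>R v + x) > R"
      using False norm_diff_ineq[of x "h n *\<^sub>R v"] by (simp add: add.commute)
    moreover have "norm x > R" using False norm_ge_zero[of v] by linarith
    ultimately show ?thesis using False by (simp add: q_def gR)
  qed
  have q0: "(LINT x|lborel. q n x) = 0" for n
  proof -
    have "integrable lborel (\<lambda>x. g (h n *\<^sub>R v + x))"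
    proof -
      have "integrable (distr lborel borel ((+) (h n *\<^sub>R v))) g" using gi by (simp add: lborel_distr_plus)
      then show ?thesis using gm by (subst (asm) integrable_distr_eq) auto
    qed
    then have "(LINT x|lborel. q n x) = ((LINT x|lborel. g (h n *\<^sub>R v + x)) - (LINT x|lborel. g x)) / h n"
      using gi by (simp add: q_def)
    then show ?thesis by (simp add: integral_lborel_translation[OF gm])
  qed
  have "(\<lambda>n. LINT x|lborel. q n x) \<longlonglongrightarrow> (LINT x|lborel. ?D x)"
  proof (rule integral_dominated_convergence)
    show "integrable lborel (\<lambda>x. B * indicator (cball 0 (R + norm v)) x :: real)"
      by (auto intro!: integrable_mult_right integrable_real_indicator emeasure_bounded_finite)
    show "?D \<in> borel_measurable lborel"
      using test_function_borel_measurable[OF test_function_frechet_derivative[OF assms]] by simp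
    show "q n \<in> borel_measurable lborel" for n
      unfolding q_def using gm by (intro borel_measurable_divide borel_measurable_diff) auto
  qed (use lim bound in auto)
  then show ?thesis unfolding q0 by (simp add: LIMSEQ_const_iff)
qed

section \<open>Classical gradients and finite measures with bounded support\<close>

definition grad :: "('a::euclidean_space \<Rightarrow> real) \<Rightarrow> 'a \<Rightarrow> 'a" where
  "grad v x = (\<Sum>i\<in>Basis. frechet_derivative v (at x) i *\<^sub>R i)"

lemma grad_inner_Basis: "i \<in> Basis \<Longrightarrow> grad v x \<bullet> i = frechet_derivative v (at x) i"
  by (simp add: grad_def)

lemma frechet_derivative_eq_grad:
  assumes "smooth v" shows "frechet_derivative v (at x) h = grad v x \<bullet> h"
proof -
  have l: "linear (frechet_derivative v (at x))"
    by (rule has_derivative_linear[OF smooth_has_derivative[OF assms]])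
  have "frechet_derivative v (at x) h = frechet_derivative v (at x) (\<Sum>i\<in>Basis. (h \<bullet> i) *\<^sub>R i)"
    by (simp add: euclidean_representation)
  also have "\<dots> = (\<Sum>i\<in>Basis. (h \<bullet> i) * frechet_derivative v (at x) i)"
    by (simp add: linear_sum[OF l] linear_cmul[OF l])
  also have "\<dots> = grad v x \<bullet> h"
    unfolding grad_def inner_sum_left
    by (intro sum.cong refl) (simp add: inner_commute mult.commute)
  finally show ?thesis .
qed

lemma continuous_on_grad: "smooth v \<Longrightarrow> continuous_on A (grad v)"
  unfolding grad_def
  by (intro continuous_on_sum continuous_on_scaleR continuous_on_const smooth_continuous_on
      smooth_frechet_derivative)

text \<open>Common frame for Lebesgue measure on \<open>\<Omega>\<close>, Lebesgue measure on a time
  interval and the surface measure: continuous functions are square-integrable in all three.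
  Measurability of the identity is asked for, rather than a Borel sigma-algebra on the whole space,
  because restricted spaces have a smaller carrier.\<close>

locale bounded_borel_measure = finite_measure M for M :: "'a::euclidean_space measure" +
  assumes id_measurable: "(\<lambda>x. x) \<in> borel_measurable M"
    and bounded_support: "\<exists>B. bounded B \<and> (AE x in M. x \<in> B)"
begin

lemma borel_measurable: "f \<in> borel_measurable borel \<Longrightarrow> f \<in> borel_measurable M"
  by (rule measurable_compose[OF id_measurable])

lemma continuous_Lspace2:
  fixes f :: "'a \<Rightarrow> 'b::euclidean_space"
  assumes "continuous_on UNIV f"
  shows "f \<in> Lspace 2 M"
proof -
  obtain B where B: "bounded B" "AE x in M. x \<in> B" using bounded_support by blast
  have "compact (f ` closure B)"
    using B(1) assms by (intro compact_continuous_image) (auto intro: continuous_on_subset)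
  then obtain C where C: "\<And>y. y \<in> f ` closure B \<Longrightarrow> norm y \<le> C"
    using compact_imp_bounded[of "f ` closure B"] unfolding bounded_iff by blast
  show ?thesis
  proof (rule Lspace2_bounded)
    show "f \<in> borel_measurable M"
      using assms by (intro borel_measurable borel_measurable_continuous_onI)
    show "AE x in M. norm (f x) \<le> C"
      using B(2) by eventually_elim (use C closure_subset[of B] in blast)
  qed unfold_locales
qed

lemma smooth_Lspace2: "smooth f \<Longrightarrow> f \<in> Lspace 2 M"
  by (intro continuous_Lspace2 smooth_continuous_on)

lemma test_function_Lspace2: "test_function U f \<Longrightarrow> f \<in> Lspace 2 M"
  by (intro smooth_Lspace2 test_function_smooth)

end

lemma finite_measure_leb_on:
  assumes "open \<Omega>" "bounded \<Omega>" shows "finite_measure (leb_on \<Omega>)"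
proof (rule finite_measureI)
  have "emeasure (leb_on \<Omega>) (space (leb_on \<Omega>)) = emeasure lborel \<Omega>"
    using assms by (simp add: space_restrict_space emeasure_restrict_space)
  then show "emeasure (leb_on \<Omega>) (space (leb_on \<Omega>)) \<noteq> \<infinity>"
    using emeasure_bounded_finite[OF assms(2)] by simp
qed

lemma bounded_borel_measure_leb_on:
  assumes "open \<Omega>" "bounded \<Omega>" shows "bounded_borel_measure (leb_on \<Omega>)"
proof -
  interpret finite_measure "leb_on \<Omega>" by (rule finite_measure_leb_on[OF assms])
  show ?thesis
  proof
    show "(\<lambda>x. x) \<in> borel_measurable (leb_on \<Omega>)" by (intro measurable_restrict_space1) simp
    have "AE x in leb_on \<Omega>. x \<in> \<Omega>" by (rule AE_I2) (simp add: space_restrict_space)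
    then show "\<exists>B. bounded B \<and> (AE x in leb_on \<Omega>. x \<in> B)" using assms by blast
  qed
qed

lemma integral_leb_on_eq:
  fixes f :: "'a::euclidean_space \<Rightarrow> real"
  assumes "open \<Omega>" "\<And>x. x \<notin> \<Omega> \<Longrightarrow> f x = 0"
  shows "(LINT x|leb_on \<Omega>. f x) = (LINT x|lborel. f x)"
proof -
  have "(LINT x|leb_on \<Omega>. f x) = (LINT x|lborel. indicator \<Omega> x *\<^sub>R f x)"
    using assms(1) by (intro integral_restrict_space) auto
  also have "(\<lambda>x. indicator \<Omega> x *\<^sub>R f x) = f" by (rule ext) (use assms(2) in \<open>auto simp: indicator_def\<close>)
  finally show ?thesis .
qed

text \<open>The product \<open>v x * \<phi> x\<close> is a test function, so the integral of its
  partial derivatives vanishes; the product rule then is integration by parts.\<close>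

lemma has_weak_grad_grad:
  assumes "open \<Omega>" "smooth v" shows "has_weak_grad \<Omega> v (grad v)"
  unfolding has_weak_grad_def
proof (intro allI impI ballI)
  fix \<phi> i assume \<phi>: "test_function \<Omega> \<phi>" and i: "(i::'a) \<in> Basis"
  have t: "test_function \<Omega> (\<lambda>x. v x * frechet_derivative \<phi> (at x) i)"
    "test_function \<Omega> (\<lambda>x. frechet_derivative v (at x) i * \<phi> x)"
    using assms \<phi> by (auto intro!: test_function_mult test_function_frechet_derivative smooth_frechet_derivative)
  have "((\<lambda>x. v x * \<phi> x) has_derivative
      (\<lambda>h. v x * frechet_derivative \<phi> (at x) h + frechet_derivative v (at x) h * \<phi> x)) (at x)" for x
    using assms \<phi> by (intro has_derivative_mult smooth_has_derivative) (auto simp: test_function_def)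
  from fun_cong[OF frechet_derivative_at[OF this], of _ i]
  have "frechet_derivative (\<lambda>x. v x * \<phi> x) (at x) i =
      v x * frechet_derivative \<phi> (at x) i + frechet_derivative v (at x) i * \<phi> x" for x
    by simp
  with integral_frechet_derivative_test_function[OF test_function_mult[OF assms(2) \<phi>], of i]
  have "(LINT x|lborel. v x * frechet_derivative \<phi> (at x) i) + (LINT x|lborel. frechet_derivative v (at x) i * \<phi> x) = 0"
    using t by (simp add: test_function_integrable)
  then show "(LINT x|leb_on \<Omega>. v x * frechet_derivative \<phi> (at x) i) = - (LINT x|leb_on \<Omega>. grad v x \<bullet> i * \<phi> x)"
    using integral_leb_on_eq[OF assms(1) test_function_eq_0[OF t(1)]]
      integral_leb_on_eq[OF assms(1) test_function_eq_0[OF t(2)]] i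
    by (simp add: grad_inner_Basis)
qed

text \<open>Cutoffs that equal 1 on the members of a compact exhaustion of \<open>U\<close>: a point
  of \<open>U\<close> lies in all but finitely many members, and off \<open>U\<close> every cutoff
  vanishes.\<close>

lemma test_functions_converge_to_indicator:
  fixes U :: "'a::euclidean_space set"
  assumes "open U"
  obtains \<zeta> :: "nat \<Rightarrow> 'a \<Rightarrow> real" where "\<And>k. test_function U (\<zeta> k)" "\<And>k x. 0 \<le> \<zeta> k x"
    "\<And>k x. \<zeta> k x \<le> 1" "\<And>x. (\<lambda>k. \<zeta> k x) \<longlonglongrightarrow> indicator U x"
proof -
  obtain C where C: "\<And>n::nat. compact (C n)" "\<And>n. C n \<subseteq> U" "\<And>n. C n \<subseteq> interior (C (Suc n))"
    "\<Union>(range C) = U" "\<And>K. \<lbrakk>compact K; K \<subseteq> U\<rbrakk> \<Longrightarrow> \<exists>N. \<forall>n\<ge>N. K \<subseteq> C n"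
    by (rule open_Union_compact_subsets[OF assms]) (rule that)
  have "\<exists>\<zeta>. test_function U \<zeta> \<and> (\<forall>x. 0 \<le> \<zeta> x \<and> \<zeta> x \<le> 1) \<and> (\<forall>x\<in>C n. \<zeta> x = 1)" for n
    by (rule test_function_cutoff[OF C(1) assms C(2)[of n]]) blast
  then have "\<forall>n. \<exists>\<zeta>. test_function U \<zeta> \<and> (\<forall>x. 0 \<le> \<zeta> x \<and> \<zeta> x \<le> 1) \<and> (\<forall>x\<in>C n. \<zeta> x = 1)"
    by blast
  from choice[OF this] obtain \<zeta> where
    "\<forall>n. test_function U (\<zeta> n) \<and> (\<forall>x. 0 \<le> \<zeta> n x \<and> \<zeta> n x \<le> 1) \<and> (\<forall>x\<in>C n. \<zeta> n x = 1)" ..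
  then have \<zeta>: "test_function U (\<zeta> n)" "0 \<le> \<zeta> n x" "\<zeta> n x \<le> 1" "x \<in> C n \<Longrightarrow> \<zeta> n x = 1" for n x
    by blast+
  have "(\<lambda>k. \<zeta> k x) \<longlonglongrightarrow> indicator U x" for x
  proof (cases "x \<in> U")
    case True
    then obtain N where "\<forall>n\<ge>N. x \<in> C n" using C(5)[of "{x}"] by auto
    then have "\<forall>\<^sub>F k in sequentially. indicator U x = \<zeta> k x"
      using True \<zeta>(4) by (auto simp: eventually_sequentially intro!: exI[of _ N])
    then show ?thesis by (rule Lim_transform_eventually[OF tendsto_const])
  next
    case False
    then show ?thesis using test_function_eq_0[OF \<zeta>(1)] by simp
  qed
  then show thesis by (rule that[of \<zeta>, OF \<zeta>(1) \<zeta>(2) \<zeta>(3)])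
qed

text \<open>The fundamental lemma of the calculus of variations. Cutoffs converging to the indicator
  of an open set show, by dominated convergence, that the integral of \<open>F\<close> over every
  open set is zero.\<close>

lemma AE_eq_0_if_orthogonal_to_test_functions:
  fixes f :: "'a::euclidean_space \<Rightarrow> real"
  assumes "open \<Omega>" "integrable (leb_on \<Omega>) f"
    and orth: "\<And>\<phi>. test_function \<Omega> \<phi> \<Longrightarrow> (LINT x|leb_on \<Omega>. f x * \<phi> x) = 0"
  shows "AE x in leb_on \<Omega>. f x = 0"
proof -
  define F where "F x = indicator \<Omega> x * f x" for x
  have F: "integrable lborel F"
    using assms(1,2) by (simp add: F_def[abs_def] integrable_restrict_space)
  have sF: "set_integrable lborel A F" if "A \<in> sets borel" for A
    unfolding set_integrable_def using that F by (intro integrable_mult_indicator) simp_all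
  have op: "(LINT x:A|lborel. F x) = 0" if "open A" for A
  proof -
    obtain \<zeta> :: "nat \<Rightarrow> 'a \<Rightarrow> real" where \<zeta>: "\<And>k. test_function (A \<inter> \<Omega>) (\<zeta> k)" "\<And>k x. 0 \<le> \<zeta> k x"
      "\<And>k x. \<zeta> k x \<le> 1" "\<And>x. (\<lambda>k. \<zeta> k x) \<longlonglongrightarrow> indicator (A \<inter> \<Omega>) x"
      by (rule test_functions_converge_to_indicator[OF open_Int[OF \<open>open A\<close> assms(1)]]) (rule that)
    have "(\<lambda>k. LINT x|lborel. F x * \<zeta> k x) \<longlonglongrightarrow> (LINT x|lborel. F x * indicator (A \<inter> \<Omega>) x)"
    proof (rule integral_dominated_convergence)
      show "integrable lborel (\<lambda>x. norm (F x))" using F by simp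
      show "(\<lambda>x. F x * indicator (A \<inter> \<Omega>) x) \<in> borel_measurable lborel"
        using F \<open>open A\<close> assms(1) by (intro borel_measurable_times borel_measurable_indicator) auto
      show "(\<lambda>x. F x * \<zeta> k x) \<in> borel_measurable lborel" for k
        using F test_function_borel_measurable[OF \<zeta>(1)] by (intro borel_measurable_times) auto
      show "AE x in lborel. (\<lambda>k. F x * \<zeta> k x) \<longlonglongrightarrow> F x * indicator (A \<inter> \<Omega>) x"
        by (intro AE_I2 tendsto_mult tendsto_const \<zeta>(4))
      show "AE x in lborel. norm (F x * \<zeta> k x) \<le> norm (F x)" for k
        using \<zeta>(2,3) by (intro AE_I2) (simp add: abs_mult mult_left_le)
    qed
    moreover have "(LINT x|lborel. F x * \<zeta> k x) = 0" for k
    proof -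
      have "(LINT x|leb_on \<Omega>. f x * \<zeta> k x) = 0"
        by (intro orth test_function_mono[OF \<zeta>(1)]) simp
      then show ?thesis
        using assms(1) by (simp add: integral_restrict_space F_def mult.assoc)
    qed
    ultimately have "(LINT x|lborel. F x * indicator (A \<inter> \<Omega>) x) = 0"
      by (simp add: LIMSEQ_const_iff)
    also have "(\<lambda>x. F x * indicator (A \<inter> \<Omega>) x) = (\<lambda>x. indicator A x *\<^sub>R F x)"
      by (auto simp: F_def indicator_def)
    finally show ?thesis by (simp add: set_lebesgue_integral_def)
  qed
  have borel: "sets borel = sigma_sets UNIV {S::'a set. open S}"
    by (simp add: borel_def)
  \<comment> \<open>Open sets are stable under intersection, and the sets over which
    \<open>F\<close> integrates to zero are closed under complements and disjoint countable unions,
    so Dynkin's argument reaches all Borel sets.\<close>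
  have all: "(LINT x:A|lborel. F x) = 0" if "A \<in> sets borel" for A
  proof -
    have "Int_stable {S::'a set. open S}" "{S::'a set. open S} \<subseteq> Pow UNIV" "A \<in> sigma_sets UNIV {S. open S}"
      using that unfolding borel by (auto simp: Int_stable_def)
    then show ?thesis
    proof (induction rule: sigma_sets_induct_disjoint)
      case (basic A)
      then show ?case using op by simp
    next
      case (compl A)
      then have A: "A \<in> sets borel" unfolding borel by blast
      have "(LINT x:UNIV|lborel. F x) = (LINT x:A|lborel. F x) + (LINT x:UNIV - A|lborel. F x)"
        using set_integral_Un[of A "UNIV - A" lborel F] sF A by simp
      then show ?case using compl op[of UNIV] by simp
    next
      case (union A)
      then have A: "A i \<in> sets borel" for i unfolding borel by blast
      have "(LINT x:(\<Union>i. A i)|lborel. F x) = (\<Sum>i. LINT x:A i|lborel. F x)"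
      proof (rule lebesgue_integral_countable_add)
        show "A i \<inter> A j = {}" if "i \<noteq> j" for i j
          using union(1) that unfolding disjoint_family_on_def by blast
        show "set_integrable lborel (\<Union>i. A i) F" using A by (intro sF sets.countable_UN) auto
      qed (use A in simp)
      then show ?case using union by simp
    qed (simp add: set_lebesgue_integral_def)
  qed
  have "AE x in lborel. F x = 0"
    by (rule density_unique_real[OF F, of "\<lambda>_. 0", simplified]) (use all in \<open>simp add: set_lebesgue_integral_def\<close>)
  then show ?thesis
    using assms(1) by (subst AE_restrict_space_iff) (auto simp: F_def)
qed

section \<open>Uniqueness of weak gradients and the \<open>H\<^sup>1\<close> norm\<close>

lemma weak_grad_unique:
  assumes "open \<Omega>" "bounded \<Omega>" "G \<in> Lspace 2 (leb_on \<Omega>)" "G' \<in> Lspace 2 (leb_on \<Omega>)"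
    and "has_weak_grad \<Omega> w G" "has_weak_grad \<Omega> w G'"
  shows "AE x in leb_on \<Omega>. G x = G' x"
proof -
  interpret bounded_borel_measure "leb_on \<Omega>" by (rule bounded_borel_measure_leb_on[OF assms(1,2)])
  have "AE x in leb_on \<Omega>. (G x - G' x) \<bullet> i = 0" if i: "i \<in> Basis" for i
  proof (rule AE_eq_0_if_orthogonal_to_test_functions[OF assms(1)])
    have i2: "(\<lambda>_. i) \<in> Lspace 2 (leb_on \<Omega>)"
      by (rule continuous_Lspace2) simp
    show "integrable (leb_on \<Omega>) (\<lambda>x. (G x - G' x) \<bullet> i)"
      by (intro Lspace2_inner_integrable Lspace2_diff assms i2)
    fix \<phi> assume \<phi>: "test_function \<Omega> \<phi>"
    then have \<phi>2: "(\<lambda>x. \<phi> x *\<^sub>R i) \<in> Lspace 2 (leb_on \<Omega>)"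
      by (intro continuous_Lspace2 continuous_intros smooth_continuous_on test_function_smooth)
    note E = assms(5,6)[unfolded has_weak_grad_def, rule_format, OF \<phi> i]
    from trans[OF E(1)[symmetric] E(2)]
    have "(LINT x|leb_on \<Omega>. G x \<bullet> i * \<phi> x) = (LINT x|leb_on \<Omega>. G' x \<bullet> i * \<phi> x)"
      by simp
    then show "(LINT x|leb_on \<Omega>. (G x - G' x) \<bullet> i * \<phi> x) = 0"
      using Lspace2_inner_integrable[OF assms(3) \<phi>2] Lspace2_inner_integrable[OF assms(4) \<phi>2]
      by (simp add: inner_diff_left right_diff_distrib mult.commute)
  qed
  then have "AE x in leb_on \<Omega>. \<forall>i\<in>Basis. (G x - G' x) \<bullet> i = 0"
    by (intro AE_finite_allI) auto
  then show ?thesis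
    by eventually_elim (rule euclidean_eqI, simp add: inner_diff_left)
qed

lemma
  assumes "w \<in> H1 \<Omega>"
  shows weak_grad_Lspace2: "weak_grad \<Omega> w \<in> Lspace 2 (leb_on \<Omega>)"
    and has_weak_grad_weak_grad: "has_weak_grad \<Omega> w (weak_grad \<Omega> w)"
proof -
  obtain G where "G \<in> Lspace 2 (leb_on \<Omega>)" "has_weak_grad \<Omega> w G"
    using assms unfolding H1_def by blast
  then have "weak_grad \<Omega> w \<in> Lspace 2 (leb_on \<Omega>) \<and> has_weak_grad \<Omega> w (weak_grad \<Omega> w)"
    unfolding weak_grad_def by (rule someI[of "\<lambda>G. G \<in> Lspace 2 (leb_on \<Omega>) \<and> has_weak_grad \<Omega> w G", OF conjI])
  then show "weak_grad \<Omega> w \<in> Lspace 2 (leb_on \<Omega>)" "has_weak_grad \<Omega> w (weak_grad \<Omega> w)" by auto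
qed

lemma H1_Lspace2: "w \<in> H1 \<Omega> \<Longrightarrow> w \<in> Lspace 2 (leb_on \<Omega>)"
  by (simp add: H1_def)

text \<open>\<open>weak_grad\<close> is an arbitrary choice, so every concrete computation goes
  through an explicit weak gradient, which agrees with the chosen one almost everywhere.\<close>

lemma H1_weak_gradI:
  assumes "open \<Omega>" "bounded \<Omega>" "w \<in> Lspace 2 (leb_on \<Omega>)" "G \<in> Lspace 2 (leb_on \<Omega>)" "has_weak_grad \<Omega> w G"
  shows "w \<in> H1 \<Omega>" "AE x in leb_on \<Omega>. weak_grad \<Omega> w x = G x"
    "Lnorm 2 (leb_on \<Omega>) (weak_grad \<Omega> w) = Lnorm 2 (leb_on \<Omega>) G"
proof -
  show H: "w \<in> H1 \<Omega>" unfolding H1_def using assms(3) bexI[of "has_weak_grad \<Omega> w" G, OF assms(5,4)] by simp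
  show eq: "AE x in leb_on \<Omega>. weak_grad \<Omega> w x = G x"
    by (rule weak_grad_unique[OF assms(1,2) weak_grad_Lspace2[OF H] assms(4) has_weak_grad_weak_grad[OF H] assms(5)])
  show "Lnorm 2 (leb_on \<Omega>) (weak_grad \<Omega> w) = Lnorm 2 (leb_on \<Omega>) G"
    using eq weak_grad_Lspace2[OF H] assms(4) by (intro Lnorm2_cong_AE) (auto simp: Lspace2_measurable)
qed

lemma H1_smooth:
  assumes "open \<Omega>" "bounded \<Omega>" "smooth v"
  shows "v \<in> H1 \<Omega>" "AE x in leb_on \<Omega>. weak_grad \<Omega> v x = grad v x"
    "Lnorm 2 (leb_on \<Omega>) (weak_grad \<Omega> v) = Lnorm 2 (leb_on \<Omega>) (grad v)"
proof -
  interpret bounded_borel_measure "leb_on \<Omega>" by (rule bounded_borel_measure_leb_on[OF assms(1,2)])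
  note I = H1_weak_gradI[OF assms(1,2) smooth_Lspace2[OF assms(3)]
      continuous_Lspace2[OF continuous_on_grad[OF assms(3)]] has_weak_grad_grad[OF assms(1,3)]]
  show "v \<in> H1 \<Omega>" "AE x in leb_on \<Omega>. weak_grad \<Omega> v x = grad v x"
    "Lnorm 2 (leb_on \<Omega>) (weak_grad \<Omega> v) = Lnorm 2 (leb_on \<Omega>) (grad v)" by (rule I)+
qed

lemma has_weak_grad_diff:
  assumes "open \<Omega>" "bounded \<Omega>" "w \<in> H1 \<Omega>" "w' \<in> H1 \<Omega>"
  shows "has_weak_grad \<Omega> (\<lambda>x. w x - w' x) (\<lambda>x. weak_grad \<Omega> w x - weak_grad \<Omega> w' x)"
  unfolding has_weak_grad_def
proof (intro allI impI ballI)
  interpret bounded_borel_measure "leb_on \<Omega>" by (rule bounded_borel_measure_leb_on[OF assms(1,2)])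
  fix \<phi> i assume \<phi>: "test_function \<Omega> \<phi>" and i: "(i::'a) \<in> Basis"
  have \<phi>2: "(\<lambda>x. \<phi> x *\<^sub>R i) \<in> Lspace 2 (leb_on \<Omega>)"
    using \<phi> by (intro continuous_Lspace2 continuous_intros smooth_continuous_on test_function_smooth)
  have \<phi>3: "(\<lambda>x. frechet_derivative \<phi> (at x) i) \<in> Lspace 2 (leb_on \<Omega>)"
    using \<phi> by (intro test_function_Lspace2 test_function_frechet_derivative)
  have "integrable (leb_on \<Omega>) (\<lambda>x. weak_grad \<Omega> w x \<bullet> i * \<phi> x)"
    "integrable (leb_on \<Omega>) (\<lambda>x. weak_grad \<Omega> w' x \<bullet> i * \<phi> x)"
    using Lspace2_inner_integrable[OF weak_grad_Lspace2 \<phi>2] assms by (auto simp: mult.commute)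
  moreover have "integrable (leb_on \<Omega>) (\<lambda>x. w x * frechet_derivative \<phi> (at x) i)"
    "integrable (leb_on \<Omega>) (\<lambda>x. w' x * frechet_derivative \<phi> (at x) i)"
    using assms by (auto intro!: Lspace2_mult_integrable \<phi>3 H1_Lspace2)
  ultimately show "(LINT x|leb_on \<Omega>. (w x - w' x) * frechet_derivative \<phi> (at x) i) =
      - (LINT x|leb_on \<Omega>. (weak_grad \<Omega> w x - weak_grad \<Omega> w' x) \<bullet> i * \<phi> x)"
    using has_weak_grad_weak_grad[OF assms(3)] has_weak_grad_weak_grad[OF assms(4)] \<phi> i
    by (simp add: left_diff_distrib inner_diff_left has_weak_grad_def)
qed

lemma H1_diff:
  assumes "open \<Omega>" "bounded \<Omega>" "w \<in> H1 \<Omega>" "w' \<in> H1 \<Omega>"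
  shows "(\<lambda>x. w x - w' x) \<in> H1 \<Omega>"
    "AE x in leb_on \<Omega>. weak_grad \<Omega> (\<lambda>x. w x - w' x) x = weak_grad \<Omega> w x - weak_grad \<Omega> w' x"
    "Lnorm 2 (leb_on \<Omega>) (weak_grad \<Omega> (\<lambda>x. w x - w' x)) =
      Lnorm 2 (leb_on \<Omega>) (\<lambda>x. weak_grad \<Omega> w x - weak_grad \<Omega> w' x)"
proof -
  note I = H1_weak_gradI[OF assms(1,2) Lspace2_diff[OF H1_Lspace2[OF assms(3)] H1_Lspace2[OF assms(4)]]
      Lspace2_diff[OF weak_grad_Lspace2[OF assms(3)] weak_grad_Lspace2[OF assms(4)]] has_weak_grad_diff[OF assms]]
  show "(\<lambda>x. w x - w' x) \<in> H1 \<Omega>"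
    "AE x in leb_on \<Omega>. weak_grad \<Omega> (\<lambda>x. w x - w' x) x = weak_grad \<Omega> w x - weak_grad \<Omega> w' x"
    "Lnorm 2 (leb_on \<Omega>) (weak_grad \<Omega> (\<lambda>x. w x - w' x)) =
      Lnorm 2 (leb_on \<Omega>) (\<lambda>x. weak_grad \<Omega> w x - weak_grad \<Omega> w' x)"
    by (rule I)+
qed

lemma Lnorm2_le_H1norm: "Lnorm 2 (leb_on \<Omega>) w \<le> H1norm \<Omega> w"
  "Lnorm 2 (leb_on \<Omega>) (weak_grad \<Omega> w) \<le> H1norm \<Omega> w"
  by (auto simp: H1norm_def intro!: real_le_rsqrt)

lemma H1norm_le: "H1norm \<Omega> w \<le> Lnorm 2 (leb_on \<Omega>) w + Lnorm 2 (leb_on \<Omega>) (weak_grad \<Omega> w)"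
  unfolding H1norm_def by (intro sqrt_sum_squares_le_sum Lnorm_nonneg)

text \<open>The factor 2 comes from bounding each of the two parts by the full norm. It is harmless,
  since the estimate only serves to show boundedness and convergence to zero.\<close>

lemma H1norm_triangle_diff:
  assumes "open \<Omega>" "bounded \<Omega>" "w \<in> H1 \<Omega>" "w' \<in> H1 \<Omega>"
  shows "H1norm \<Omega> (\<lambda>x. w x - w' x) \<le> 2 * (H1norm \<Omega> w + H1norm \<Omega> w')"
proof -
  have "H1norm \<Omega> (\<lambda>x. w x - w' x) \<le>
      Lnorm 2 (leb_on \<Omega>) (\<lambda>x. w x - w' x) + Lnorm 2 (leb_on \<Omega>) (weak_grad \<Omega> (\<lambda>x. w x - w' x))"
    by (rule H1norm_le)
  also have "\<dots> \<le> (Lnorm 2 (leb_on \<Omega>) w + Lnorm 2 (leb_on \<Omega>) w') +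
      (Lnorm 2 (leb_on \<Omega>) (weak_grad \<Omega> w) + Lnorm 2 (leb_on \<Omega>) (weak_grad \<Omega> w'))"
    unfolding H1_diff(3)[OF assms]
    using assms by (intro add_mono Lnorm2_triangle_diff H1_Lspace2 weak_grad_Lspace2)
  also have "\<dots> \<le> (H1norm \<Omega> w + H1norm \<Omega> w') + (H1norm \<Omega> w + H1norm \<Omega> w')"
    by (intro add_mono Lnorm2_le_H1norm)
  finally show ?thesis by simp
qed

section \<open>The trace inequality on a boundary chart\<close>

text \<open>After the substitution \<open>s \<rightarrow> s + x \<bullet> b\<close> this is Tonelli's theorem together with translation
  invariance along \<open>b\<close>, so no orthonormal coordinates are needed.\<close>

lemma nn_integral_slab:
  fixes b :: "'a::euclidean_space" and F :: "'a \<Rightarrow> ennreal"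
  assumes b: "norm b = 1" and F[measurable]: "F \<in> borel_measurable borel"
  shows "(\<integral>\<^sup>+x\<in>{x. 0 \<le> x \<bullet> b \<and> x \<bullet> b \<le> 1}. (\<integral>\<^sup>+s. F (x + (s - x \<bullet> b) *\<^sub>R b) \<partial>lborel) \<partial>lborel) =
    (\<integral>\<^sup>+x. F x \<partial>lborel)"
proof -
  let ?S = "{x::'a. 0 \<le> x \<bullet> b \<and> x \<bullet> b \<le> 1}"
  have S[measurable]: "?S \<in> sets borel" by measurable
  have bb: "b \<bullet> b = 1" using b by (simp add: norm_eq_1)
  have inner: "(\<integral>\<^sup>+s. F (x + (s - x \<bullet> b) *\<^sub>R b) \<partial>lborel) = (\<integral>\<^sup>+s. F (x + s *\<^sub>R b) \<partial>lborel)" for x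
    using nn_integral_real_affine[of "\<lambda>s. F (x + (s - x \<bullet> b) *\<^sub>R b)" 1 "x \<bullet> b"] by simp
  have "(\<integral>\<^sup>+x\<in>?S. (\<integral>\<^sup>+s. F (x + (s - x \<bullet> b) *\<^sub>R b) \<partial>lborel) \<partial>lborel) =
      (\<integral>\<^sup>+x. (\<integral>\<^sup>+s. F (x + s *\<^sub>R b) * indicator ?S x \<partial>lborel) \<partial>lborel)"
    unfolding inner by (intro nn_integral_cong nn_integral_multc[symmetric]) measurable
  also have "\<dots> = (\<integral>\<^sup>+s. (\<integral>\<^sup>+x. F (x + s *\<^sub>R b) * indicator ?S x \<partial>lborel) \<partial>lborel)"
    by (rule lborel_pair.Fubini'[symmetric]) measurable
  also have "\<dots> = (\<integral>\<^sup>+s. (\<integral>\<^sup>+y. F y * indicator ?S (y - s *\<^sub>R b) \<partial>lborel) \<partial>lborel)"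
  proof (rule nn_integral_cong)
    fix s :: real
    have "(\<integral>\<^sup>+y. F y * indicator ?S (y - s *\<^sub>R b) \<partial>lborel) =
        (\<integral>\<^sup>+y. F y * indicator ?S (y - s *\<^sub>R b) \<partial>distr lborel borel ((+) (s *\<^sub>R b)))"
      by (simp add: lborel_distr_plus)
    also have "\<dots> = (\<integral>\<^sup>+x. F (s *\<^sub>R b + x) * indicator ?S ((s *\<^sub>R b + x) - s *\<^sub>R b) \<partial>lborel)"
      by (rule nn_integral_distr) measurable
    finally show "(\<integral>\<^sup>+x. F (x + s *\<^sub>R b) * indicator ?S x \<partial>lborel) =
        (\<integral>\<^sup>+y. F y * indicator ?S (y - s *\<^sub>R b) \<partial>lborel)"
      by (simp add: add.commute)
  qed
  also have "\<dots> = (\<integral>\<^sup>+y. (\<integral>\<^sup>+s. F y * indicator ?S (y - s *\<^sub>R b) \<partial>lborel) \<partial>lborel)"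
    by (rule lborel_pair.Fubini') measurable
  also have "\<dots> = (\<integral>\<^sup>+y. F y \<partial>lborel)"
  proof (rule nn_integral_cong)
    fix y :: 'a
    have "indicator ?S (y - s *\<^sub>R b) = (indicator {y \<bullet> b - 1..y \<bullet> b} s :: ennreal)" for s
      using bb by (auto simp: indicator_def inner_diff_left)
    then have "(\<integral>\<^sup>+s. F y * indicator ?S (y - s *\<^sub>R b) \<partial>lborel) =
        (\<integral>\<^sup>+s. F y * indicator {y \<bullet> b - 1..y \<bullet> b} s \<partial>lborel)" by simp
    also have "\<dots> = F y * emeasure lborel {y \<bullet> b - 1..y \<bullet> b}" by (rule nn_integral_cmult_indicator) simp
    also have "\<dots> = F y" by simp
    finally show "(\<integral>\<^sup>+s. F y * indicator ?S (y - s *\<^sub>R b) \<partial>lborel) = F y" .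
  qed
  finally show ?thesis .
qed

section \<open>Geometry of a boundary chart and integration over its graph\<close>

lemma C1_chartD:
  assumes "C1_chart \<Omega> V b \<gamma> D"
  shows "open V" "norm b = 1" "\<gamma> (x + s *\<^sub>R b) = \<gamma> x" "(\<gamma> has_derivative (\<lambda>h. D x \<bullet> h)) (at x)"
    "continuous_on UNIV D" "\<Omega> \<inter> V = {x \<in> V. \<gamma> x < x \<bullet> b}" "b \<bullet> b = 1"
  using assms by (auto simp: C1_chart_def norm_eq_1)

lemma C1_chart_continuous: "C1_chart \<Omega> V b \<gamma> D \<Longrightarrow> continuous_on UNIV \<gamma>"
  by (intro continuous_at_imp_continuous_on ballI has_derivative_continuous[OF C1_chartD(4)])

text \<open>Translation along \<open>b\<close> does not change \<open>\<gamma>\<close>, so both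
  vectors represent the derivative of the same function at \<open>x\<close>.\<close>

lemma C1_chart_D_invariant:
  assumes "C1_chart \<Omega> V b \<gamma> D" shows "D (x + s *\<^sub>R b) = D x"
proof -
  have "((\<lambda>y. y + s *\<^sub>R b) has_derivative (\<lambda>h. h)) (at x)"
    by (auto intro!: derivative_eq_intros)
  from has_derivative_compose[OF this C1_chartD(4)[OF assms]]
  have "(\<gamma> has_derivative (\<lambda>h. D (x + s *\<^sub>R b) \<bullet> h)) (at x)"
    by (simp add: C1_chartD(3)[OF assms])
  from has_derivative_unique[OF this C1_chartD(4)[OF assms]]
  have "D (x + s *\<^sub>R b) \<bullet> h = D x \<bullet> h" for h by (rule fun_cong)
  then show ?thesis by (rule euclidean_eqI)
qed

text \<open>A boundary point of the open set is not in it and so is not above the graph; strictly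
  below the graph it would have a neighbourhood that misses \<open>\<Omega>\<close>.\<close>

lemma C1_chart_frontier:
  assumes ch: "C1_chart \<Omega> V b \<gamma> D" and "open \<Omega>" "x \<in> frontier \<Omega>" "x \<in> V"
  shows "\<gamma> x = x \<bullet> b"
proof (rule antisym)
  have "x \<notin> \<Omega>" using assms(2,3) by (simp add: frontier_def interior_open)
  then have "x \<notin> {x \<in> V. \<gamma> x < x \<bullet> b}" unfolding C1_chartD(6)[OF ch, symmetric] by simp
  then show "x \<bullet> b \<le> \<gamma> x" using assms(4) by simp
  show "\<gamma> x \<le> x \<bullet> b"
  proof (rule ccontr)
    assume "\<not> \<gamma> x \<le> x \<bullet> b"
    moreover have "open {y. y \<bullet> b < \<gamma> y}"
      by (intro open_Collect_less continuous_intros C1_chart_continuous[OF ch])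
    then have "open (V \<inter> {y. y \<bullet> b < \<gamma> y})" using C1_chartD(1)[OF ch] by blast
    moreover have "x \<in> closure \<Omega>" using assms(3) by (simp add: frontier_def)
    ultimately have "\<Omega> \<inter> (V \<inter> {y. y \<bullet> b < \<gamma> y}) \<noteq> {}"
      using open_Int_closure_eq_empty[of "V \<inter> {y. y \<bullet> b < \<gamma> y}" \<Omega>] assms(4) by auto
    then obtain y where "y \<in> \<Omega> \<inter> V" "y \<bullet> b < \<gamma> y" by blast
    then show False unfolding C1_chartD(6)[OF ch] by simp
  qed
qed

abbreviation graph_point :: "'a::euclidean_space \<Rightarrow> ('a \<Rightarrow> real) \<Rightarrow> 'a \<Rightarrow> 'a" where
  "graph_point b \<gamma> x \<equiv> x + (\<gamma> x - x \<bullet> b) *\<^sub>R b"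

lemma surface_measureD:
  assumes "surface_measure \<Omega> \<sigma>" "C1_chart \<Omega> V b \<gamma> D" "A \<in> sets borel" "A \<subseteq> frontier \<Omega> \<inter> V"
  shows "emeasure \<sigma> A = (\<integral>\<^sup>+x\<in>{x. 0 \<le> x \<bullet> b \<and> x \<bullet> b \<le> 1}.
    indicator A (graph_point b \<gamma> x) * ennreal (sqrt (1 + (norm (D x))\<^sup>2)) \<partial>lborel)"
proof -
  have "\<forall>V b \<gamma> D A. C1_chart \<Omega> V b \<gamma> D \<longrightarrow> A \<in> sets borel \<longrightarrow> A \<subseteq> frontier \<Omega> \<inter> V \<longrightarrow>
      emeasure \<sigma> A = (\<integral>\<^sup>+x\<in>{x. 0 \<le> x \<bullet> b \<and> x \<bullet> b \<le> 1}.
        indicator A (graph_point b \<gamma> x) * ennreal (sqrt (1 + (norm (D x))\<^sup>2)) \<partial>lborel)"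
    using assms(1) unfolding surface_measure_def by (elim conjE)
  from this[rule_format, OF assms(2-4)] show ?thesis .
qed

text \<open>The surface measure is prescribed on sets only. The measure \<open>N\<close>, the image
  of the weighted Lebesgue measure on the slab under the graph map, agrees with
  \<open>\<sigma>\<close> on all Borel subsets of \<open>A\<close>; equality of the two restricted
  measures gives equality of all integrals.\<close>

lemma nn_integral_surface_measure:
  fixes f :: "'a::euclidean_space \<Rightarrow> ennreal"
  assumes ch: "C1_chart \<Omega> V b \<gamma> D" and \<sigma>: "surface_measure \<Omega> \<sigma>"
    and A[measurable]: "A \<in> sets borel" and sub: "A \<subseteq> frontier \<Omega> \<inter> V"
    and f[measurable]: "f \<in> borel_measurable borel"
  shows "(\<integral>\<^sup>+x\<in>A. f x \<partial>\<sigma>) = (\<integral>\<^sup>+x\<in>{x. 0 \<le> x \<bullet> b \<and> x \<bullet> b \<le> 1}.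
    indicator A (graph_point b \<gamma> x) * f (graph_point b \<gamma> x) * ennreal (sqrt (1 + (norm (D x))\<^sup>2)) \<partial>lborel)"
proof -
  let ?S = "{x::'a. 0 \<le> x \<bullet> b \<and> x \<bullet> b \<le> 1}"
  let ?J = "\<lambda>x. ennreal (sqrt (1 + (norm (D x))\<^sup>2))"
  have sets[measurable_cong]: "sets \<sigma> = sets borel" using \<sigma> by (simp add: surface_measure_def)
  have [measurable]: "\<gamma> \<in> borel_measurable borel" "D \<in> borel_measurable borel"
    using C1_chart_continuous[OF ch] C1_chartD(5)[OF ch] by (auto intro: borel_measurable_continuous_onI)
  define N where "N = distr (density lborel (\<lambda>x. indicator ?S x * ?J x)) borel (graph_point b \<gamma>)"
  have setsN[measurable_cong]: "sets N = sets borel" by (simp add: N_def)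
  have N: "(\<integral>\<^sup>+y. g y \<partial>N) = (\<integral>\<^sup>+x\<in>?S. g (graph_point b \<gamma> x) * ?J x \<partial>lborel)"
    if [measurable]: "g \<in> borel_measurable borel" for g
    unfolding N_def by (subst nn_integral_distr, simp_all, subst nn_integral_density)
      (auto intro!: nn_integral_cong simp: mult_ac)
  have "density \<sigma> (indicator A) = density N (indicator A)"
  proof (rule measure_eqI)
    fix A' assume "A' \<in> sets (density \<sigma> (indicator A))"
    then have A'[measurable]: "A' \<in> sets borel" using sets by simp
    have "emeasure (density \<sigma> (indicator A)) A' = emeasure \<sigma> (A \<inter> A')"
      by (subst emeasure_density) (auto simp: indicator_inter_arith[symmetric] sets)
    also have "\<dots> = (\<integral>\<^sup>+x\<in>?S. indicator (A \<inter> A') (graph_point b \<gamma> x) * ?J x \<partial>lborel)"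
      by (rule surface_measureD[OF \<sigma> ch]) (use sub in auto)
    also have "\<dots> = (\<integral>\<^sup>+y. indicator (A \<inter> A') y \<partial>N)" by (rule N[symmetric]) measurable
    also have "\<dots> = emeasure (density N (indicator A)) A'"
    proof -
      have "(indicator (A \<inter> A') :: 'a \<Rightarrow> ennreal) = (\<lambda>y. indicator A y * indicator A' y)"
        by (rule ext) (rule indicator_inter_arith)
      then show ?thesis
        by (subst emeasure_density) (simp_all add: setsN)
    qed
    finally show "emeasure (density \<sigma> (indicator A)) A' = emeasure (density N (indicator A)) A'" .
  qed (simp add: sets setsN)
  then have "(\<integral>\<^sup>+x. f x \<partial>density \<sigma> (indicator A)) = (\<integral>\<^sup>+x. f x \<partial>density N (indicator A))" by simp
  then have "(\<integral>\<^sup>+x. indicator A x * f x \<partial>\<sigma>) = (\<integral>\<^sup>+x. indicator A x * f x \<partial>N)"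
    by (subst (asm) (1 2) nn_integral_density) auto
  then show ?thesis by (simp add: N mult.commute)
qed

text \<open>Integrate the derivative of \<open>(1 - s / h) * (v (y + s b))\<^sup>2\<close> over \<open>0 \<le> s \<le> h\<close>.\<close>

lemma square_le_segment_integral:
  fixes v :: "'a::euclidean_space \<Rightarrow> real"
  assumes sm: "smooth v" and "norm b = 1" and h: "h > 0"
  shows "ennreal ((v y)\<^sup>2) \<le> (\<integral>\<^sup>+s\<in>{0<..h}.
    ennreal ((v (y + s *\<^sub>R b))\<^sup>2 / h + 2 * \<bar>v (y + s *\<^sub>R b)\<bar> * norm (grad v (y + s *\<^sub>R b))) \<partial>lborel)"
proof -
  define w where "w s = v (y + s *\<^sub>R b)" for s
  define w' where "w' s = frechet_derivative v (at (y + s *\<^sub>R b)) b" for s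
  define G where "G s = (w s)\<^sup>2 / h + 2 * \<bar>w s\<bar> * norm (grad v (y + s *\<^sub>R b))" for s
  define \<phi>' where "\<phi>' s = (w s)\<^sup>2 / h - (1 - s / h) * (2 * w s * w' s)" for s
  have dw: "(w has_real_derivative w' s) (at s)" for s
    unfolding w_def w'_def by (rule smooth_line_derivative[OF sm])
  have d: "((\<lambda>s. - (1 - s / h) * (w s)\<^sup>2) has_real_derivative \<phi>' s) (at s)" for s
    unfolding \<phi>'_def using h dw[of s]
    by (auto intro!: derivative_eq_intros simp: field_simps power2_eq_square)
  have cont: "continuous_on UNIV (\<lambda>s. y + s *\<^sub>R b)" by (intro continuous_intros)
  have cw: "continuous_on UNIV w" unfolding w_def
    using continuous_on_compose2[OF smooth_continuous_on[OF sm, of UNIV] cont] by simp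
  have cw': "continuous_on UNIV w'" unfolding w'_def
    using continuous_on_compose2[OF smooth_continuous_on[OF smooth_frechet_derivative[OF sm], of UNIV] cont] by simp
  have cg: "continuous_on UNIV (\<lambda>s. grad v (y + s *\<^sub>R b))"
    using continuous_on_compose2[OF continuous_on_grad[OF sm, of UNIV] cont] by simp
  have cG: "continuous_on UNIV G" unfolding G_def by (intro continuous_intros cw cg) (use h in auto)
  have c\<phi>: "continuous_on UNIV \<phi>'" unfolding \<phi>'_def by (intro continuous_intros cw cw') (use h in auto)
  have le: "\<phi>' s \<le> G s" if "s \<in> {0..h}" for s
  proof -
    have "\<bar>w' s\<bar> \<le> norm (grad v (y + s *\<^sub>R b))"
      unfolding w'_def frechet_derivative_eq_grad[OF sm]
      using Cauchy_Schwarz_ineq2[of "grad v (y + s *\<^sub>R b)" b] assms(2) by simp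
    moreover have "\<bar>1 - s / h\<bar> \<le> 1" using that h by (simp add: field_simps)
    ultimately have "\<bar>1 - s / h\<bar> * (2 * \<bar>w s\<bar> * \<bar>w' s\<bar>) \<le> 1 * (2 * \<bar>w s\<bar> * norm (grad v (y + s *\<^sub>R b)))"
      by (intro mult_mono) auto
    then show ?thesis unfolding \<phi>'_def G_def
      using abs_le_D2[of "(1 - s / h) * (2 * w s * w' s)"] by (simp add: abs_mult)
  qed
  have iG: "integrable lborel (\<lambda>s. G s * indicator {0..h} s)"
    using borel_integrable_atLeastAtMost[of 0 h G] cG
    by (simp add: continuous_on_eq_continuous_at indicator_def if_distrib cong: if_cong)
  have i\<phi>: "integrable lborel (\<lambda>s. \<phi>' s * indicator {0..h} s)"
    using borel_integrable_atLeastAtMost[of 0 h \<phi>'] c\<phi>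
    by (simp add: continuous_on_eq_continuous_at indicator_def if_distrib cong: if_cong)
  \<comment> \<open>The antiderivative vanishes at \<open>s = h\<close> and equals
    \<open>- (v y)\<^sup>2\<close> at \<open>s = 0\<close>.\<close>
  have "(v y)\<^sup>2 = (\<integral>s. \<phi>' s * indicator {0..h} s \<partial>lborel)"
    using integral_FTC_Icc_real[of 0 h "\<lambda>s. - (1 - s / h) * (w s)\<^sup>2" \<phi>'] d c\<phi> h
    by (simp add: continuous_on_eq_continuous_at w_def)
  also have "\<dots> \<le> (\<integral>s. G s * indicator {0..h} s \<partial>lborel)"
    using le by (intro integral_mono i\<phi> iG) (auto simp: indicator_def)
  finally have "ennreal ((v y)\<^sup>2) \<le> ennreal (\<integral>s. G s * indicator {0..h} s \<partial>lborel)"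
    by (rule ennreal_leI)
  also have "\<dots> = (\<integral>\<^sup>+s. ennreal (G s * indicator {0..h} s) \<partial>lborel)"
    using h by (intro nn_integral_eq_integral[symmetric] iG) (auto simp: G_def indicator_def)
  \<comment> \<open>Dropping the endpoint 0 leaves only points strictly above the graph when
    \<open>y\<close> lies on it; these are the ones that belong to the domain.\<close>
  also have "\<dots> = (\<integral>\<^sup>+s\<in>{0<..h}. ennreal (G s) \<partial>lborel)"
    using AE_lborel_singleton[of 0]
    by (intro nn_integral_cong_AE, eventually_elim) (auto simp: indicator_def)
  finally show ?thesis by (simp add: G_def w_def)
qed

text \<open>Over each graph point the square of \<open>v\<close> is bounded by an integral along a
  vertical segment that stays in the chart and above the graph, hence in \<open>\<Omega>\<close>.
  Integrating over the slab, the slab formula merges the two integrations into a volume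
  integral.\<close>

lemma local_trace_inequality:
  fixes v :: "'a::euclidean_space \<Rightarrow> real"
  assumes ch: "C1_chart \<Omega> V b \<gamma> D" and \<sigma>: "surface_measure \<Omega> \<sigma>" and "open \<Omega>"
    and A[measurable]: "A \<in> sets borel" and sub: "A \<subseteq> frontier \<Omega> \<inter> V"
    and h: "h > 0" "\<And>y s. y \<in> A \<Longrightarrow> 0 \<le> s \<Longrightarrow> s \<le> h \<Longrightarrow> y + s *\<^sub>R b \<in> V"
    and M: "\<And>y. y \<in> A \<Longrightarrow> norm (D y) \<le> M" and sm: "smooth v"
  shows "(\<integral>\<^sup>+x\<in>A. ennreal ((v x)\<^sup>2) \<partial>\<sigma>) \<le> ennreal (sqrt (1 + M\<^sup>2)) *
    (\<integral>\<^sup>+x\<in>\<Omega>. ennreal ((v x)\<^sup>2 / h + 2 * \<bar>v x\<bar> * norm (grad v x)) \<partial>lborel)"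
proof -
  let ?S = "{x::'a. 0 \<le> x \<bullet> b \<and> x \<bullet> b \<le> 1}"
  let ?\<pi> = "graph_point b \<gamma>"
  define G where "G z = ennreal ((v z)\<^sup>2 / h + 2 * \<bar>v z\<bar> * norm (grad v z))" for z
  \<comment> \<open>\<open>F\<close> keeps the points at height at most \<open>h\<close> above a
    graph point in \<open>A\<close>. Its first factor is constant along \<open>b\<close>, so it can
    be moved in and out of the segment integral.\<close>
  define F where "F z = indicator A (?\<pi> z) * (indicator {0<..h} (z \<bullet> b - \<gamma> z) * G z)" for z
  note bb = C1_chartD(7)[OF ch] and inv = C1_chartD(3)[OF ch]
  have [measurable]: "\<gamma> \<in> borel_measurable borel" "D \<in> borel_measurable borel" "v \<in> borel_measurable borel"
      "grad v \<in> borel_measurable borel"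
    using C1_chart_continuous[OF ch] C1_chartD(5)[OF ch] smooth_continuous_on[OF sm] continuous_on_grad[OF sm]
    by (auto intro!: borel_measurable_continuous_onI)
  have Gm[measurable]: "G \<in> borel_measurable borel" unfolding G_def by measurable
  have Fm[measurable]: "F \<in> borel_measurable borel" unfolding F_def by measurable
  have \<pi>inv: "?\<pi> (x + s *\<^sub>R b) = ?\<pi> x" for x s
    by (simp add: inv inner_add_left bb algebra_simps)
  have pt: "indicator A (?\<pi> x) * ennreal ((v (?\<pi> x))\<^sup>2) \<le> (\<integral>\<^sup>+s. F (x + (s - x \<bullet> b) *\<^sub>R b) \<partial>lborel)" for x
  proof -
    have "indicator A (?\<pi> x) * ennreal ((v (?\<pi> x))\<^sup>2) \<le>
        indicator A (?\<pi> x) * (\<integral>\<^sup>+s. G (?\<pi> x + s *\<^sub>R b) * indicator {0<..h} s \<partial>lborel)"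
      unfolding G_def by (intro mult_left_mono square_le_segment_integral sm h C1_chartD(2)[OF ch]) simp
    also have "\<dots> = (\<integral>\<^sup>+s. indicator A (?\<pi> x) * (indicator {0<..h} s * G (?\<pi> x + s *\<^sub>R b)) \<partial>lborel)"
      by (subst nn_integral_cmult[symmetric]) (auto simp: mult_ac)
    also have "\<dots> = (\<integral>\<^sup>+s. indicator A (?\<pi> x) * (indicator {0<..h} (s - \<gamma> x) * G (?\<pi> x + (s - \<gamma> x) *\<^sub>R b)) \<partial>lborel)"
      using nn_integral_real_affine[of "\<lambda>s. indicator A (?\<pi> x) * (indicator {0<..h} (s - \<gamma> x) * G (?\<pi> x + (s - \<gamma> x) *\<^sub>R b))" 1 "\<gamma> x"]
      by simp
    also have "\<dots> = (\<integral>\<^sup>+s. F (x + (s - x \<bullet> b) *\<^sub>R b) \<partial>lborel)"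
    proof (rule nn_integral_cong)
      fix s
      have "?\<pi> x + (s - \<gamma> x) *\<^sub>R b = x + (s - x \<bullet> b) *\<^sub>R b" by (simp add: algebra_simps)
      moreover have "(x + (s - x \<bullet> b) *\<^sub>R b) \<bullet> b - \<gamma> (x + (s - x \<bullet> b) *\<^sub>R b) = s - \<gamma> x"
        by (simp add: inv inner_add_left bb)
      ultimately show "indicator A (?\<pi> x) * (indicator {0<..h} (s - \<gamma> x) * G (?\<pi> x + (s - \<gamma> x) *\<^sub>R b)) =
          F (x + (s - x \<bullet> b) *\<^sub>R b)"
        by (simp only: F_def \<pi>inv)
    qed
    finally show ?thesis .
  qed
  have "(\<integral>\<^sup>+x\<in>A. ennreal ((v x)\<^sup>2) \<partial>\<sigma>) = (\<integral>\<^sup>+x\<in>?S. indicator A (?\<pi> x) * ennreal ((v (?\<pi> x))\<^sup>2) *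
      ennreal (sqrt (1 + (norm (D x))\<^sup>2)) \<partial>lborel)"
    by (rule nn_integral_surface_measure[OF ch \<sigma> A sub]) measurable
  also have "\<dots> \<le> (\<integral>\<^sup>+x. ennreal (sqrt (1 + M\<^sup>2)) * ((\<integral>\<^sup>+s. F (x + (s - x \<bullet> b) *\<^sub>R b) \<partial>lborel) * indicator ?S x) \<partial>lborel)"
  proof (rule nn_integral_mono)
    fix x
    show "indicator A (?\<pi> x) * ennreal ((v (?\<pi> x))\<^sup>2) * ennreal (sqrt (1 + (norm (D x))\<^sup>2)) * indicator ?S x \<le>
        ennreal (sqrt (1 + M\<^sup>2)) * ((\<integral>\<^sup>+s. F (x + (s - x \<bullet> b) *\<^sub>R b) \<partial>lborel) * indicator ?S x)"
    proof (cases "?\<pi> x \<in> A")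
      case True
      have "norm (D x) \<le> M" using M[OF True] by (simp add: C1_chart_D_invariant[OF ch])
      then have "ennreal (sqrt (1 + (norm (D x))\<^sup>2)) \<le> ennreal (sqrt (1 + M\<^sup>2))"
        by (intro ennreal_leI) (simp add: power_mono)
      then have "(indicator A (?\<pi> x) * ennreal ((v (?\<pi> x))\<^sup>2)) * ennreal (sqrt (1 + (norm (D x))\<^sup>2)) \<le>
          (\<integral>\<^sup>+s. F (x + (s - x \<bullet> b) *\<^sub>R b) \<partial>lborel) * ennreal (sqrt (1 + M\<^sup>2))"
        using pt by (intro mult_mono) auto
      then show ?thesis by (auto simp: indicator_def mult_ac)
    qed simp
  qed
  also have "\<dots> = ennreal (sqrt (1 + M\<^sup>2)) * (\<integral>\<^sup>+x\<in>?S. (\<integral>\<^sup>+s. F (x + (s - x \<bullet> b) *\<^sub>R b) \<partial>lborel) \<partial>lborel)"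
    by (rule nn_integral_cmult) measurable
  also have "(\<integral>\<^sup>+x\<in>?S. (\<integral>\<^sup>+s. F (x + (s - x \<bullet> b) *\<^sub>R b) \<partial>lborel) \<partial>lborel) = (\<integral>\<^sup>+x. F x \<partial>lborel)"
    by (rule nn_integral_slab[OF C1_chartD(2)[OF ch] Fm])
  also have "\<dots> \<le> (\<integral>\<^sup>+x\<in>\<Omega>. G x \<partial>lborel)"
  proof (rule nn_integral_mono)
    fix z
    have "z \<in> \<Omega>" if "?\<pi> z \<in> A" "z \<bullet> b - \<gamma> z \<in> {0<..h}"
    proof -
      have z: "?\<pi> z + (z \<bullet> b - \<gamma> z) *\<^sub>R b = z" by (simp add: algebra_simps)
      have "z \<in> V" using h(2)[OF that(1), of "z \<bullet> b - \<gamma> z"] that(2) z by simp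
      then have "z \<in> \<Omega> \<inter> V" unfolding C1_chartD(6)[OF ch] using that(2) by simp
      then show ?thesis by simp
    qed
    then show "F z \<le> G z * indicator \<Omega> z" by (auto simp: F_def indicator_def)
  qed
  finally show ?thesis unfolding G_def by (simp add: mult_left_mono)
qed

section \<open>Traces\<close>

locale C1_domain =
  fixes \<Omega> :: "'a::euclidean_space set" and \<sigma> :: "'a measure"
  assumes open_domain: "open \<Omega>" and bounded_domain: "bounded \<Omega>"
    and C1: "C1_boundary \<Omega>" and surface: "surface_measure \<Omega> \<sigma>"
begin

sublocale leb: bounded_borel_measure "leb_on \<Omega>"
  by (rule bounded_borel_measure_leb_on[OF open_domain bounded_domain])

lemma sets_surface: "sets \<sigma> = sets borel"
  using surface by (simp add: surface_measure_def)

lemma frontier_borel: "frontier \<Omega> \<in> sets borel"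
  by (rule borel_closed[OF frontier_closed])

lemma AE_frontier: "AE x in \<sigma>. x \<in> frontier \<Omega>"
proof (rule AE_I')
  have "- frontier \<Omega> \<in> sets borel" using frontier_borel by auto
  then show "- frontier \<Omega> \<in> null_sets \<sigma>"
    using surface by (auto simp: surface_measure_def null_sets_def)
qed auto

lemma compact_frontier: "compact (frontier \<Omega>)"
  using bounded_domain bounded_closure bounded_subset[of "closure \<Omega>" "frontier \<Omega>"]
  by (auto simp: compact_eq_bounded_closed frontier_def)

lemma surface_piece:
  assumes x0: "x\<^sub>0 \<in> frontier \<Omega>"
  shows "\<exists>r>0. \<exists>C\<ge>0. emeasure \<sigma> (frontier \<Omega> \<inter> ball x\<^sub>0 r) < \<infinity> \<and>
    (\<forall>v. smooth v \<longrightarrow> (\<integral>\<^sup>+x\<in>frontier \<Omega> \<inter> ball x\<^sub>0 r. ennreal ((v x)\<^sup>2) \<partial>\<sigma>) \<le>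
       ennreal C * (\<integral>\<^sup>+x\<in>\<Omega>. ennreal ((v x)\<^sup>2 + \<bar>v x\<bar> * norm (grad v x)) \<partial>lborel))"
proof -
  obtain V b \<gamma> D where V: "x\<^sub>0 \<in> V" and ch: "C1_chart \<Omega> V b \<gamma> D"
    using C1 x0 unfolding C1_boundary_def by blast
  note b1 = C1_chartD(2)[OF ch]
  obtain \<rho> where \<rho>: "\<rho> > 0" "cball x\<^sub>0 \<rho> \<subseteq> V"
    using C1_chartD(1)[OF ch] V open_contains_cball by blast
  \<comment> \<open>Half the radius: a segment of length at most \<open>r\<close> that starts in the
    ball of radius \<open>r\<close> stays in the chart.\<close>
  define r where "r = \<rho> / 2"
  have r: "r > 0" "r \<le> \<rho>" using \<rho> by (auto simp: r_def)
  define A where "A = frontier \<Omega> \<inter> ball x\<^sub>0 r"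
  have A: "A \<in> sets borel" unfolding A_def using frontier_borel by auto
  have rV: "ball x\<^sub>0 r \<subseteq> V" using \<rho>(2) r(2) by (auto simp: subset_iff)
  have sub: "A \<subseteq> frontier \<Omega> \<inter> V" unfolding A_def using rV by blast
  have seg: "y + s *\<^sub>R b \<in> V" if "y \<in> A" "0 \<le> s" "s \<le> r" for y s
  proof -
    have "norm (y + s *\<^sub>R b - x\<^sub>0) \<le> norm (y - x\<^sub>0) + norm (s *\<^sub>R b)"
      using norm_triangle_ineq[of "y - x\<^sub>0" "s *\<^sub>R b"] by (simp add: algebra_simps)
    also have "\<dots> \<le> \<rho>"
      using that b1 unfolding A_def r_def by (simp add: dist_norm norm_minus_commute)
    finally show ?thesis using \<rho>(2) by (auto simp: dist_norm norm_minus_commute subset_iff)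
  qed
  have "compact (D ` cball x\<^sub>0 r)"
    by (intro compact_continuous_image continuous_on_subset[OF C1_chartD(5)[OF ch]]) auto
  then obtain M where "\<And>y. y \<in> D ` cball x\<^sub>0 r \<Longrightarrow> norm y \<le> M"
    using compact_imp_bounded[of "D ` cball x\<^sub>0 r"] unfolding bounded_iff by blast
  then have M: "norm (D y) \<le> M" if "y \<in> A" for y
    using that by (simp add: A_def)
  \<comment> \<open>Dominates the coefficients \<open>1 / r\<close> and 2 of the two terms in the
    local trace inequality.\<close>
  define m where "m = max (1 / r) 2"
  define C where "C = sqrt (1 + M\<^sup>2) * m"
  have m: "m \<ge> 0" "1 / r \<le> m" "2 \<le> m" using r by (auto simp: m_def)
  have C0: "C \<ge> 0" using m by (simp add: C_def)
  have ineq: "(\<integral>\<^sup>+x\<in>A. ennreal ((v x)\<^sup>2) \<partial>\<sigma>) \<le>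
      ennreal C * (\<integral>\<^sup>+x\<in>\<Omega>. ennreal ((v x)\<^sup>2 + \<bar>v x\<bar> * norm (grad v x)) \<partial>lborel)" if sm: "smooth v" for v
  proof -
    have [measurable]: "v \<in> borel_measurable borel" "grad v \<in> borel_measurable borel" "\<Omega> \<in> sets borel"
      using smooth_continuous_on[OF sm] continuous_on_grad[OF sm] open_domain
      by (auto intro!: borel_measurable_continuous_onI)
    have "(\<integral>\<^sup>+x\<in>\<Omega>. ennreal ((v x)\<^sup>2 / r + 2 * \<bar>v x\<bar> * norm (grad v x)) \<partial>lborel) \<le>
        (\<integral>\<^sup>+x. ennreal m * (ennreal ((v x)\<^sup>2 + \<bar>v x\<bar> * norm (grad v x)) * indicator \<Omega> x) \<partial>lborel)"
    proof (rule nn_integral_mono)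
      fix x
      have "(1 / r) * (v x)\<^sup>2 + 2 * (\<bar>v x\<bar> * norm (grad v x)) \<le> m * (v x)\<^sup>2 + m * (\<bar>v x\<bar> * norm (grad v x))"
        using m by (intro add_mono mult_right_mono) auto
      then have "(v x)\<^sup>2 / r + 2 * \<bar>v x\<bar> * norm (grad v x) \<le> m * ((v x)\<^sup>2 + \<bar>v x\<bar> * norm (grad v x))"
        by (simp add: distrib_left mult.assoc)
      from ennreal_leI[OF this]
      have "ennreal ((v x)\<^sup>2 / r + 2 * \<bar>v x\<bar> * norm (grad v x)) \<le>
          ennreal m * ennreal ((v x)\<^sup>2 + \<bar>v x\<bar> * norm (grad v x))"
        using m(1) by (subst ennreal_mult[symmetric]) simp_all
      then show "ennreal ((v x)\<^sup>2 / r + 2 * \<bar>v x\<bar> * norm (grad v x)) * indicator \<Omega> x \<le>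
          ennreal m * (ennreal ((v x)\<^sup>2 + \<bar>v x\<bar> * norm (grad v x)) * indicator \<Omega> x)"
        by (simp add: indicator_def)
    qed
    also have "\<dots> = ennreal m * (\<integral>\<^sup>+x\<in>\<Omega>. ennreal ((v x)\<^sup>2 + \<bar>v x\<bar> * norm (grad v x)) \<partial>lborel)"
      by (rule nn_integral_cmult) measurable
    finally have le: "(\<integral>\<^sup>+x\<in>\<Omega>. ennreal ((v x)\<^sup>2 / r + 2 * \<bar>v x\<bar> * norm (grad v x)) \<partial>lborel) \<le>
        ennreal m * (\<integral>\<^sup>+x\<in>\<Omega>. ennreal ((v x)\<^sup>2 + \<bar>v x\<bar> * norm (grad v x)) \<partial>lborel)" .
    have "(\<integral>\<^sup>+x\<in>A. ennreal ((v x)\<^sup>2) \<partial>\<sigma>) \<le> ennreal (sqrt (1 + M\<^sup>2)) *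
        (\<integral>\<^sup>+x\<in>\<Omega>. ennreal ((v x)\<^sup>2 / r + 2 * \<bar>v x\<bar> * norm (grad v x)) \<partial>lborel)"
      by (rule local_trace_inequality[OF ch surface open_domain A sub r(1) seg M sm])
    also have "\<dots> \<le> ennreal (sqrt (1 + M\<^sup>2)) *
        (ennreal m * (\<integral>\<^sup>+x\<in>\<Omega>. ennreal ((v x)\<^sup>2 + \<bar>v x\<bar> * norm (grad v x)) \<partial>lborel))"
      by (rule mult_left_mono[OF le]) simp
    also have "\<dots> = ennreal C * (\<integral>\<^sup>+x\<in>\<Omega>. ennreal ((v x)\<^sup>2 + \<bar>v x\<bar> * norm (grad v x)) \<partial>lborel)"
      unfolding C_def using m by (simp add: ennreal_mult mult.assoc)
    finally show ?thesis .
  qed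
  have fin: "emeasure \<sigma> A < \<infinity>"
  proof -
    \<comment> \<open>A slab point \<open>x\<close> satisfies
      \<open>\<bar>x \<bullet> b\<bar> \<le> 1\<close>. If its graph point \<open>y\<close> is in
      \<open>A\<close>, then \<open>norm y \<le> norm x\<^sub>0 + r\<close>, and
      \<open>\<gamma> x = y \<bullet> b\<close> is bounded by \<open>norm y\<close>; so
      \<open>norm x\<close> is at most \<open>2 * norm y + 1\<close>.\<close>
    define R where "R = 2 * (norm x\<^sub>0 + r) + 1"
    have "emeasure \<sigma> A = (\<integral>\<^sup>+x\<in>{x. 0 \<le> x \<bullet> b \<and> x \<bullet> b \<le> 1}.
        indicator A (graph_point b \<gamma> x) * ennreal (sqrt (1 + (norm (D x))\<^sup>2)) \<partial>lborel)"
      by (rule surface_measureD[OF surface ch A sub])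
    also have "\<dots> \<le> (\<integral>\<^sup>+x. ennreal (sqrt (1 + M\<^sup>2)) * indicator (cball 0 R :: 'a set) x \<partial>lborel)"
    proof (rule nn_integral_mono)
      fix x :: 'a
      show "indicator A (graph_point b \<gamma> x) * ennreal (sqrt (1 + (norm (D x))\<^sup>2)) *
          indicator {x. 0 \<le> x \<bullet> b \<and> x \<bullet> b \<le> 1} x \<le> ennreal (sqrt (1 + M\<^sup>2)) * indicator (cball 0 R) x"
      proof (cases "graph_point b \<gamma> x \<in> A \<and> 0 \<le> x \<bullet> b \<and> x \<bullet> b \<le> 1")
        case True
        let ?y = "graph_point b \<gamma> x"
        have yA: "?y \<in> A" using True by blast
        have "norm (D x) \<le> M" using M[OF yA] by (simp add: C1_chart_D_invariant[OF ch])
        then have J: "ennreal (sqrt (1 + (norm (D x))\<^sup>2)) \<le> ennreal (sqrt (1 + M\<^sup>2))"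
          by (intro ennreal_leI) (simp add: power_mono)
        have ny: "norm ?y \<le> norm x\<^sub>0 + r"
        proof -
          have "dist x\<^sub>0 ?y < r" using yA by (simp add: A_def)
          then show ?thesis using norm_triangle_sub[of ?y x\<^sub>0] by (simp add: dist_norm norm_minus_commute)
        qed
        have "\<gamma> ?y = ?y \<bullet> b"
          using C1_chart_frontier[OF ch open_domain] yA sub by blast
        then have "\<gamma> x = ?y \<bullet> b" by (simp add: C1_chartD(3)[OF ch])
        then have g: "\<bar>\<gamma> x\<bar> \<le> norm ?y" using Cauchy_Schwarz_ineq2[of ?y b] b1 by simp
        have "x = ?y - (\<gamma> x - x \<bullet> b) *\<^sub>R b" by simp
        then have "norm x \<le> norm ?y + norm ((\<gamma> x - x \<bullet> b) *\<^sub>R b)"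
          using norm_triangle_ineq4[of ?y "(\<gamma> x - x \<bullet> b) *\<^sub>R b"] by simp
        also have "norm ((\<gamma> x - x \<bullet> b) *\<^sub>R b) = \<bar>\<gamma> x - x \<bullet> b\<bar>" using b1 by simp
        also have "\<bar>\<gamma> x - x \<bullet> b\<bar> \<le> \<bar>\<gamma> x\<bar> + 1"
          using True abs_triangle_ineq4[of "\<gamma> x" "x \<bullet> b"] by simp
        finally have "norm x \<le> norm ?y + (\<bar>\<gamma> x\<bar> + 1)" by simp
        also have "\<dots> \<le> R" using g ny unfolding R_def by simp
        finally have "norm x \<le> R" .
        then show ?thesis using J True by simp
      qed (auto simp: indicator_def)
    qed
    also have "\<dots> = ennreal (sqrt (1 + M\<^sup>2)) * emeasure lborel (cball 0 R :: 'a set)"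
      by (rule nn_integral_cmult_indicator) simp
    also have "\<dots> < \<infinity>"
      using emeasure_bounded_finite[of "cball 0 R :: 'a set"] by (simp add: ennreal_mult_less_top)
    finally show ?thesis .
  qed
  show ?thesis
    by (rule exI[of _ r], intro conjI r(1), rule exI[of _ C])
       (use C0 fin ineq in \<open>simp add: A_def\<close>)
qed

lemma surface_cover:
  obtains I r C where "finite I" "frontier \<Omega> \<subseteq> (\<Union>x\<in>I. ball x (r x))"
    "\<And>x. x \<in> I \<Longrightarrow> C x \<ge> (0::real)"
    "\<And>x. x \<in> I \<Longrightarrow> emeasure \<sigma> (frontier \<Omega> \<inter> ball x (r x)) < \<infinity>"
    "\<And>x v. x \<in> I \<Longrightarrow> smooth v \<Longrightarrow> (\<integral>\<^sup>+y\<in>frontier \<Omega> \<inter> ball x (r x). ennreal ((v y)\<^sup>2) \<partial>\<sigma>) \<le>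
       ennreal (C x) * (\<integral>\<^sup>+y\<in>\<Omega>. ennreal ((v y)\<^sup>2 + \<bar>v y\<bar> * norm (grad v y)) \<partial>lborel)"
proof -
  let ?P = "\<lambda>x r C. r > 0 \<and> C \<ge> 0 \<and> emeasure \<sigma> (frontier \<Omega> \<inter> ball x r) < \<infinity> \<and>
    (\<forall>v. smooth v \<longrightarrow> (\<integral>\<^sup>+y\<in>frontier \<Omega> \<inter> ball x r. ennreal ((v y)\<^sup>2) \<partial>\<sigma>) \<le>
       ennreal C * (\<integral>\<^sup>+y\<in>\<Omega>. ennreal ((v y)\<^sup>2 + \<bar>v y\<bar> * norm (grad v y)) \<partial>lborel))"
  have "\<forall>x\<in>frontier \<Omega>. \<exists>p. ?P x (fst p) (snd p)"
    using surface_piece by fastforce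
  from bchoice[OF this] obtain f where f: "\<forall>x\<in>frontier \<Omega>. ?P x (fst (f x)) (snd (f x))" ..
  have "frontier \<Omega> \<subseteq> (\<Union>x\<in>frontier \<Omega>. ball x (fst (f x)))" using f by force
  then obtain I where "I \<subseteq> frontier \<Omega>" "finite I" "frontier \<Omega> \<subseteq> (\<Union>x\<in>I. ball x (fst (f x)))"
    using compactE_image[OF compact_frontier, of "frontier \<Omega>" "\<lambda>x. ball x (fst (f x))"] by blast
  with f show thesis
    by (intro that[of I "\<lambda>x. fst (f x)" "\<lambda>x. snd (f x)"]) (auto simp: subset_iff)
qed

text \<open>The defining formula for \<open>\<sigma>\<close> is local, so finiteness is collected
  from a finite cover of the compact boundary by pieces of finite measure.\<close>

sublocale surf: bounded_borel_measure \<sigma>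
proof -
  obtain I r C where I: "finite I" "frontier \<Omega> \<subseteq> (\<Union>x\<in>I. ball x (r x))"
    "\<And>x. x \<in> I \<Longrightarrow> emeasure \<sigma> (frontier \<Omega> \<inter> ball x (r x)) < \<infinity>"
    by (rule surface_cover) (rule that)
  have sp: "space \<sigma> = UNIV" using sets_eq_imp_space_eq[OF sets_surface] by simp
  have "emeasure \<sigma> (space \<sigma>) = emeasure \<sigma> (frontier \<Omega>)"
    using AE_frontier frontier_borel by (intro emeasure_eq_AE) (auto simp: sets_surface sp)
  also have "frontier \<Omega> = (\<Union>x\<in>I. frontier \<Omega> \<inter> ball x (r x))" using I(2) by auto
  also have "emeasure \<sigma> \<dots> \<le> (\<Sum>x\<in>I. emeasure \<sigma> (frontier \<Omega> \<inter> ball x (r x)))"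
    using I(1) frontier_borel by (intro emeasure_subadditive_finite) (auto simp: sets_surface)
  also have "\<dots> < \<infinity>" using I by (simp add: less_top)
  finally have "finite_measure \<sigma>" by (intro finite_measureI) simp
  then interpret finite_measure \<sigma> .
  show "bounded_borel_measure \<sigma>"
  proof
    show "(\<lambda>x. x) \<in> borel_measurable \<sigma>"
      by (simp cong: measurable_cong_sets[OF sets_surface])
    show "\<exists>B. bounded B \<and> (AE x in \<sigma>. x \<in> B)"
      using AE_frontier compact_imp_bounded[OF compact_frontier] by blast
  qed
qed

text \<open>The local inequalities are summed over the finite cover. Applying Cauchy--Schwarz to the
  mixed term only at the end preserves a factor \<open>Lnorm 2 (leb_on \<Omega>) v\<close> in every
  term on the right.\<close>

lemma smooth_trace_inequality:
  "\<exists>C\<ge>0. \<forall>v. smooth v \<longrightarrow> (Lnorm 2 \<sigma> v)\<^sup>2 \<le>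
     C * ((Lnorm 2 (leb_on \<Omega>) v)\<^sup>2 + Lnorm 2 (leb_on \<Omega>) v * Lnorm 2 (leb_on \<Omega>) (grad v))"
proof -
  obtain I r C where I: "finite I" "frontier \<Omega> \<subseteq> (\<Union>x\<in>I. ball x (r x))"
    "\<And>x. x \<in> I \<Longrightarrow> C x \<ge> (0::real)"
    "\<And>x. x \<in> I \<Longrightarrow> emeasure \<sigma> (frontier \<Omega> \<inter> ball x (r x)) < \<infinity>"
    "\<And>x v. x \<in> I \<Longrightarrow> smooth v \<Longrightarrow> (\<integral>\<^sup>+y\<in>frontier \<Omega> \<inter> ball x (r x). ennreal ((v y)\<^sup>2) \<partial>\<sigma>) \<le>
       ennreal (C x) * (\<integral>\<^sup>+y\<in>\<Omega>. ennreal ((v y)\<^sup>2 + \<bar>v y\<bar> * norm (grad v y)) \<partial>lborel)"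
    by (rule surface_cover) (rule that)
  define K where "K = (\<Sum>x\<in>I. C x)"
  have K: "K \<ge> 0" unfolding K_def by (intro sum_nonneg I)
  have "(Lnorm 2 \<sigma> v)\<^sup>2 \<le>
     K * ((Lnorm 2 (leb_on \<Omega>) v)\<^sup>2 + Lnorm 2 (leb_on \<Omega>) v * Lnorm 2 (leb_on \<Omega>) (grad v))" if sm: "smooth v" for v
  proof -
    have v2: "v \<in> Lspace 2 \<sigma>" "v \<in> Lspace 2 (leb_on \<Omega>)"
      using sm by (rule surf.smooth_Lspace2 leb.smooth_Lspace2)+
    have g2: "grad v \<in> Lspace 2 (leb_on \<Omega>)" by (intro leb.continuous_Lspace2 continuous_on_grad sm)
    have [measurable]: "(\<lambda>y. ennreal ((v y)\<^sup>2) * indicator (frontier \<Omega> \<inter> ball x (r x)) y) \<in> borel_measurable \<sigma>" for x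
    proof -
      have [measurable]: "frontier \<Omega> \<inter> ball x (r x) \<in> sets borel" "v \<in> borel_measurable borel"
        using smooth_borel_measurable[OF sm] frontier_borel by auto
      show ?thesis by (intro surf.borel_measurable) measurable
    qed
    have "ennreal ((Lnorm 2 \<sigma> v)\<^sup>2) = (\<integral>\<^sup>+y. ennreal ((v y)\<^sup>2) \<partial>\<sigma>)"
      using v2 by (subst nn_integral_eq_integral) (auto simp: Lnorm2_square Lspace2_iff)
    also have "\<dots> \<le> (\<integral>\<^sup>+y. (\<Sum>x\<in>I. ennreal ((v y)\<^sup>2) * indicator (frontier \<Omega> \<inter> ball x (r x)) y) \<partial>\<sigma>)"
    proof (rule nn_integral_mono_AE)
      show "AE y in \<sigma>. ennreal ((v y)\<^sup>2) \<le> (\<Sum>x\<in>I. ennreal ((v y)\<^sup>2) * indicator (frontier \<Omega> \<inter> ball x (r x)) y)"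
        using AE_frontier
      proof eventually_elim
        case (elim y)
        then obtain x where x: "x \<in> I" "y \<in> ball x (r x)" using I(2) by blast
        have "ennreal ((v y)\<^sup>2) = ennreal ((v y)\<^sup>2) * indicator (frontier \<Omega> \<inter> ball x (r x)) y"
          using elim x by simp
        also have "\<dots> \<le> (\<Sum>x\<in>I. ennreal ((v y)\<^sup>2) * indicator (frontier \<Omega> \<inter> ball x (r x)) y)"
          by (rule member_le_sum[OF x(1) _ I(1)]) simp
        finally show ?case .
      qed
    qed
    also have "\<dots> = (\<Sum>x\<in>I. \<integral>\<^sup>+y\<in>frontier \<Omega> \<inter> ball x (r x). ennreal ((v y)\<^sup>2) \<partial>\<sigma>)"
      by (rule nn_integral_sum) measurable
    also have "\<dots> \<le> (\<Sum>x\<in>I. ennreal (C x) * (\<integral>\<^sup>+y\<in>\<Omega>. ennreal ((v y)\<^sup>2 + \<bar>v y\<bar> * norm (grad v y)) \<partial>lborel))"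
      by (intro sum_mono I(5) sm)
    also have "\<dots> = ennreal K * (\<integral>\<^sup>+y\<in>\<Omega>. ennreal ((v y)\<^sup>2 + \<bar>v y\<bar> * norm (grad v y)) \<partial>lborel)"
      unfolding K_def using I(3) by (simp add: sum_distrib_right[symmetric])
    also have "(\<integral>\<^sup>+y\<in>\<Omega>. ennreal ((v y)\<^sup>2 + \<bar>v y\<bar> * norm (grad v y)) \<partial>lborel) =
        (\<integral>\<^sup>+y. ennreal ((v y)\<^sup>2 + \<bar>v y\<bar> * norm (grad v y)) \<partial>leb_on \<Omega>)"
      using open_domain by (subst nn_integral_restrict_space) auto
    also have "\<dots> = ennreal (LINT y|leb_on \<Omega>. (v y)\<^sup>2 + \<bar>v y\<bar> * norm (grad v y))"
      using v2 g2 Lspace2_mult_integrable[OF Lspace2_norm[OF v2(2)] Lspace2_norm[OF g2]]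
      by (intro nn_integral_eq_integral) (auto simp: Lspace2_iff)
    also have "(LINT y|leb_on \<Omega>. (v y)\<^sup>2 + \<bar>v y\<bar> * norm (grad v y)) \<le>
        (Lnorm 2 (leb_on \<Omega>) v)\<^sup>2 + Lnorm 2 (leb_on \<Omega>) v * Lnorm 2 (leb_on \<Omega>) (grad v)"
    proof -
      have "(LINT y|leb_on \<Omega>. \<bar>v y\<bar> * norm (grad v y)) \<le>
          Lnorm 2 (leb_on \<Omega>) (\<lambda>y. norm (v y)) * Lnorm 2 (leb_on \<Omega>) (\<lambda>y. norm (grad v y))"
        using Lspace2_Cauchy_Schwarz_mult[OF Lspace2_norm[OF v2(2)] Lspace2_norm[OF g2]] by simp
      also have "\<dots> = Lnorm 2 (leb_on \<Omega>) v * Lnorm 2 (leb_on \<Omega>) (grad v)" by (simp add: Lnorm2_eq)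
      finally show ?thesis
        using v2 g2 Lspace2_mult_integrable[OF Lspace2_norm[OF v2(2)] Lspace2_norm[OF g2]]
        by (simp add: Lnorm2_square Lspace2_iff)
    qed
    finally have "ennreal ((Lnorm 2 \<sigma> v)\<^sup>2) \<le> ennreal K *
        ennreal ((Lnorm 2 (leb_on \<Omega>) v)\<^sup>2 + Lnorm 2 (leb_on \<Omega>) v * Lnorm 2 (leb_on \<Omega>) (grad v))"
      by (simp add: ennreal_leI mult_left_mono)
    moreover have "0 \<le> (Lnorm 2 (leb_on \<Omega>) v)\<^sup>2 + Lnorm 2 (leb_on \<Omega>) v * Lnorm 2 (leb_on \<Omega>) (grad v)"
      by (intro add_nonneg_nonneg mult_nonneg_nonneg Lnorm_nonneg zero_le_power2)
    ultimately show ?thesis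
      using K by (simp add: ennreal_mult[symmetric] del: ennreal_plus)
  qed
  then show ?thesis using K by blast
qed

lemma H1_approx_tendsto:
  assumes w: "w \<in> H1 \<Omega>" and sm: "\<And>k. smooth (v k)"
    and lim: "(\<lambda>k. H1norm \<Omega> (\<lambda>x. v k x - w x)) \<longlonglongrightarrow> 0"
  shows "(\<lambda>k. Lnorm 2 (leb_on \<Omega>) (\<lambda>x. v k x - w x)) \<longlonglongrightarrow> 0"
    and "(\<lambda>k. Lnorm 2 (leb_on \<Omega>) (v k)) \<longlonglongrightarrow> Lnorm 2 (leb_on \<Omega>) w"
    and "(\<lambda>k. Lnorm 2 (leb_on \<Omega>) (grad (v k))) \<longlonglongrightarrow> Lnorm 2 (leb_on \<Omega>) (weak_grad \<Omega> w)"
proof -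
  have z: "f \<longlonglongrightarrow> 0" if "\<And>k. 0 \<le> f k" "\<And>k. f k \<le> H1norm \<Omega> (\<lambda>x. v k x - w x)" for f :: "nat \<Rightarrow> real"
    by (rule tendsto_sandwich[OF _ _ tendsto_const lim]) (use that in auto)
  show *: "(\<lambda>k. Lnorm 2 (leb_on \<Omega>) (\<lambda>x. v k x - w x)) \<longlonglongrightarrow> 0"
    by (rule z) (rule Lnorm_nonneg Lnorm2_le_H1norm)+
  show "(\<lambda>k. Lnorm 2 (leb_on \<Omega>) (v k)) \<longlonglongrightarrow> Lnorm 2 (leb_on \<Omega>) w"
    by (rule Lnorm2_tendsto[OF leb.smooth_Lspace2[OF sm] H1_Lspace2[OF w] *])
  note Hv = H1_smooth[OF open_domain bounded_domain sm]
  have "(\<lambda>k. Lnorm 2 (leb_on \<Omega>) (\<lambda>x. weak_grad \<Omega> (v k) x - weak_grad \<Omega> w x)) \<longlonglongrightarrow> 0"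
    unfolding H1_diff(3)[OF open_domain bounded_domain Hv(1) w, symmetric]
    by (rule z) (rule Lnorm_nonneg Lnorm2_le_H1norm)+
  from Lnorm2_tendsto[OF weak_grad_Lspace2[OF Hv(1)] weak_grad_Lspace2[OF w] this]
  show "(\<lambda>k. Lnorm 2 (leb_on \<Omega>) (grad (v k))) \<longlonglongrightarrow> Lnorm 2 (leb_on \<Omega>) (weak_grad \<Omega> w)"
    unfolding Hv(3) .
qed

text \<open>All three norms converge along the approximating smooth functions. Quantifying over
  every pair of a function and a trace, and not just over the chosen trace, is what makes uniqueness
  a consequence.\<close>

lemma trace_inequality:
  "\<exists>C\<ge>0. \<forall>w g. has_trace \<Omega> \<sigma> w g \<longrightarrow> (Lnorm 2 \<sigma> g)\<^sup>2 \<le>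
     C * ((Lnorm 2 (leb_on \<Omega>) w)\<^sup>2 + Lnorm 2 (leb_on \<Omega>) w * Lnorm 2 (leb_on \<Omega>) (weak_grad \<Omega> w))"
proof -
  obtain C where C: "C \<ge> 0" "\<And>v. smooth v \<Longrightarrow> (Lnorm 2 \<sigma> v)\<^sup>2 \<le>
     C * ((Lnorm 2 (leb_on \<Omega>) v)\<^sup>2 + Lnorm 2 (leb_on \<Omega>) v * Lnorm 2 (leb_on \<Omega>) (grad v))"
    using smooth_trace_inequality by blast
  have "(Lnorm 2 \<sigma> g)\<^sup>2 \<le>
     C * ((Lnorm 2 (leb_on \<Omega>) w)\<^sup>2 + Lnorm 2 (leb_on \<Omega>) w * Lnorm 2 (leb_on \<Omega>) (weak_grad \<Omega> w))"
    if tr: "has_trace \<Omega> \<sigma> w g" for w g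
  proof -
    from tr have w: "w \<in> H1 \<Omega>" and g: "g \<in> Lspace 2 \<sigma>" by (auto simp: has_trace_def)
    from tr obtain v where v: "\<And>k. smooth (v k)" "(\<lambda>k. H1norm \<Omega> (\<lambda>x. v k x - w x)) \<longlonglongrightarrow> 0"
      "(\<lambda>k. Lnorm 2 \<sigma> (\<lambda>x. v k x - g x)) \<longlonglongrightarrow> 0" unfolding has_trace_def by blast
    note lim = H1_approx_tendsto[OF w v(1,2)]
    show ?thesis
    proof (rule LIMSEQ_le)
      show "(\<lambda>k. (Lnorm 2 \<sigma> (v k))\<^sup>2) \<longlonglongrightarrow> (Lnorm 2 \<sigma> g)\<^sup>2"
        by (rule tendsto_power[OF Lnorm2_tendsto[OF surf.smooth_Lspace2[OF v(1)] g v(3)]])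
      show "(\<lambda>k. C * ((Lnorm 2 (leb_on \<Omega>) (v k))\<^sup>2 + Lnorm 2 (leb_on \<Omega>) (v k) * Lnorm 2 (leb_on \<Omega>) (grad (v k))))
        \<longlonglongrightarrow> C * ((Lnorm 2 (leb_on \<Omega>) w)\<^sup>2 + Lnorm 2 (leb_on \<Omega>) w * Lnorm 2 (leb_on \<Omega>) (weak_grad \<Omega> w))"
        by (intro tendsto_mult tendsto_const tendsto_add tendsto_power lim(2,3))
    qed (use C(2)[OF v(1)] in blast)
  qed
  then show ?thesis using C(1) by blast
qed

section \<open>Differences and uniqueness of traces\<close>

lemma has_trace_diff:
  assumes "has_trace \<Omega> \<sigma> w g" "has_trace \<Omega> \<sigma> w' g'"
  shows "has_trace \<Omega> \<sigma> (\<lambda>x. w x - w' x) (\<lambda>x. g x - g' x)"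
proof -
  from assms have w: "w \<in> H1 \<Omega>" "w' \<in> H1 \<Omega>" and g: "g \<in> Lspace 2 \<sigma>" "g' \<in> Lspace 2 \<sigma>"
    by (auto simp: has_trace_def)
  from assms(1) obtain v where v: "\<And>k. smooth (v k)" "(\<lambda>k. H1norm \<Omega> (\<lambda>x. v k x - w x)) \<longlonglongrightarrow> 0"
    "(\<lambda>k. Lnorm 2 \<sigma> (\<lambda>x. v k x - g x)) \<longlonglongrightarrow> 0" unfolding has_trace_def by blast
  from assms(2) obtain v' where v': "\<And>k. smooth (v' k)" "(\<lambda>k. H1norm \<Omega> (\<lambda>x. v' k x - w' x)) \<longlonglongrightarrow> 0"
    "(\<lambda>k. Lnorm 2 \<sigma> (\<lambda>x. v' k x - g' x)) \<longlonglongrightarrow> 0" unfolding has_trace_def by blast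
  note sm = H1_smooth(1)[OF open_domain bounded_domain]
  note Hd = H1_diff(1)[OF open_domain bounded_domain]
  have "(\<lambda>k. H1norm \<Omega> (\<lambda>x. (v k x - w x) - (v' k x - w' x))) \<longlonglongrightarrow> 0"
  proof (rule tendsto_sandwich[OF _ _ tendsto_const])
    show "(\<lambda>k. 2 * (H1norm \<Omega> (\<lambda>x. v k x - w x) + H1norm \<Omega> (\<lambda>x. v' k x - w' x))) \<longlonglongrightarrow> 0"
      using tendsto_mult[OF tendsto_const[of 2] tendsto_add[OF v(2) v'(2)]] by simp
    show "\<forall>\<^sub>F k in sequentially. H1norm \<Omega> (\<lambda>x. (v k x - w x) - (v' k x - w' x)) \<le>
        2 * (H1norm \<Omega> (\<lambda>x. v k x - w x) + H1norm \<Omega> (\<lambda>x. v' k x - w' x))"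
      by (intro always_eventually allI H1norm_triangle_diff open_domain bounded_domain Hd sm v(1) v'(1) w)
  qed (simp add: H1norm_def)
  moreover have "(\<lambda>k. Lnorm 2 \<sigma> (\<lambda>x. (v k x - g x) - (v' k x - g' x))) \<longlonglongrightarrow> 0"
  proof (rule tendsto_sandwich[OF _ _ tendsto_const])
    show "(\<lambda>k. Lnorm 2 \<sigma> (\<lambda>x. v k x - g x) + Lnorm 2 \<sigma> (\<lambda>x. v' k x - g' x)) \<longlonglongrightarrow> 0"
      using tendsto_add[OF v(3) v'(3)] by simp
    show "\<forall>\<^sub>F k in sequentially. Lnorm 2 \<sigma> (\<lambda>x. (v k x - g x) - (v' k x - g' x)) \<le>
        Lnorm 2 \<sigma> (\<lambda>x. v k x - g x) + Lnorm 2 \<sigma> (\<lambda>x. v' k x - g' x)"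
      by (intro always_eventually allI Lnorm2_triangle_diff Lspace2_diff surf.smooth_Lspace2 v(1) v'(1) g)
  qed (simp add: Lnorm_nonneg)
  moreover have "smooth (\<lambda>x. v k x - v' k x)" for k by (intro smooth_diff v(1) v'(1))
  ultimately show ?thesis
    unfolding has_trace_def using Hd[OF w] Lspace2_diff[OF g]
    by (intro conjI exI[of _ "\<lambda>k x. v k x - v' k x"]) (simp_all add: algebra_simps)
qed

text \<open>The trace inequality is applied to the difference, whose \<open>L\<^sup>2\<close> norm
  is zero; this annihilates the right-hand side whatever the gradient is.\<close>

lemma has_trace_unique:
  assumes "has_trace \<Omega> \<sigma> w g" "has_trace \<Omega> \<sigma> w' g'" "AE x in leb_on \<Omega>. w x = w' x"
  shows "AE x in \<sigma>. g x = g' x"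
proof -
  obtain C where C: "\<And>w g. has_trace \<Omega> \<sigma> w g \<Longrightarrow> (Lnorm 2 \<sigma> g)\<^sup>2 \<le>
     C * ((Lnorm 2 (leb_on \<Omega>) w)\<^sup>2 + Lnorm 2 (leb_on \<Omega>) w * Lnorm 2 (leb_on \<Omega>) (weak_grad \<Omega> w))"
    using trace_inequality by blast
  from assms have w: "w \<in> Lspace 2 (leb_on \<Omega>)" "w' \<in> Lspace 2 (leb_on \<Omega>)" and g: "g \<in> Lspace 2 \<sigma>" "g' \<in> Lspace 2 \<sigma>"
    by (auto simp: has_trace_def H1_def)
  have "Lnorm 2 (leb_on \<Omega>) (\<lambda>x. w x - w' x) = Lnorm 2 (leb_on \<Omega>) (\<lambda>_. 0::real)"
  proof (rule Lnorm2_cong_AE)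
    show "AE x in leb_on \<Omega>. w x - w' x = 0" using assms(3) by eventually_elim simp
  qed (use Lspace2_measurable[OF w(1)] Lspace2_measurable[OF w(2)] in simp_all)
  then have "Lnorm 2 (leb_on \<Omega>) (\<lambda>x. w x - w' x) = 0" by (simp add: Lnorm2_eq)
  then have "(Lnorm 2 \<sigma> (\<lambda>x. g x - g' x))\<^sup>2 \<le> 0"
    using C[OF has_trace_diff[OF assms(1,2)]] by simp
  then have "AE x in \<sigma>. g x - g' x = 0"
    by (intro Lnorm2_eq_0_imp_AE Lspace2_diff g) simp
  then show ?thesis by eventually_elim simp
qed

lemma has_trace_boundary_trace: "has_trace \<Omega> \<sigma> w g \<Longrightarrow> has_trace \<Omega> \<sigma> w (boundary_trace \<Omega> \<sigma> w)"
  unfolding boundary_trace_def by (rule someI[where P="has_trace \<Omega> \<sigma> w"])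

lemma has_trace_Lspace2: "has_trace \<Omega> \<sigma> w g \<Longrightarrow> g \<in> Lspace 2 \<sigma>"
  by (simp add: has_trace_def)

text \<open>Membership in \<open>H1_0\<close> only says that some trace vanishes on
  \<open>\<Gamma>\<^sub>0\<close>; uniqueness transfers this to the chosen
  \<open>boundary_trace\<close>.\<close>

lemma H1_0D:
  assumes "w \<in> H1_0 \<Omega> \<sigma> \<Gamma>\<^sub>0"
  shows "w \<in> H1 \<Omega>" "has_trace \<Omega> \<sigma> w (boundary_trace \<Omega> \<sigma> w)"
    "AE x in \<sigma>. x \<in> \<Gamma>\<^sub>0 \<longrightarrow> boundary_trace \<Omega> \<sigma> w x = 0" "boundary_trace \<Omega> \<sigma> w \<in> Lspace 2 \<sigma>"
proof -
  from assms obtain g where g: "has_trace \<Omega> \<sigma> w g" "AE x in \<sigma>. x \<in> \<Gamma>\<^sub>0 \<longrightarrow> g x = 0"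
    unfolding H1_0_def by blast
  show "w \<in> H1 \<Omega>" using assms by (simp add: H1_0_def)
  show tr: "has_trace \<Omega> \<sigma> w (boundary_trace \<Omega> \<sigma> w)" by (rule has_trace_boundary_trace[OF g(1)])
  show "boundary_trace \<Omega> \<sigma> w \<in> Lspace 2 \<sigma>" by (rule has_trace_Lspace2[OF tr])
  have "AE x in \<sigma>. boundary_trace \<Omega> \<sigma> w x = g x" by (rule has_trace_unique[OF tr g(1)]) simp
  with g(2) show "AE x in \<sigma>. x \<in> \<Gamma>\<^sub>0 \<longrightarrow> boundary_trace \<Omega> \<sigma> w x = 0" by eventually_elim simp
qed

lemma H1_0_diff:
  assumes "w \<in> H1_0 \<Omega> \<sigma> \<Gamma>\<^sub>0" "w' \<in> H1_0 \<Omega> \<sigma> \<Gamma>\<^sub>0"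
  shows "(\<lambda>x. w x - w' x) \<in> H1_0 \<Omega> \<sigma> \<Gamma>\<^sub>0"
proof -
  let ?g = "\<lambda>x. boundary_trace \<Omega> \<sigma> w x - boundary_trace \<Omega> \<sigma> w' x"
  have tr: "has_trace \<Omega> \<sigma> (\<lambda>x. w x - w' x) ?g" by (rule has_trace_diff[OF H1_0D(2)[OF assms(1)] H1_0D(2)[OF assms(2)]])
  moreover have "AE x in \<sigma>. x \<in> \<Gamma>\<^sub>0 \<longrightarrow> ?g x = 0"
    using H1_0D(3)[OF assms(1)] H1_0D(3)[OF assms(2)] by eventually_elim simp
  moreover have "(\<lambda>x. w x - w' x) \<in> H1 \<Omega>" using tr by (simp add: has_trace_def)
  ultimately show ?thesis unfolding H1_0_def by blast
qed

end

section \<open>Weak time derivatives\<close>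

text \<open>The test functions are \<open>\<Phi> ((\<tau> - s) / e) - \<Phi> ((\<tau> - t) / e)\<close> with a smooth step \<open>\<Phi>\<close>. They tend to
  the indicator of \<open>{s<..t}\<close>, and their derivatives are mollifiers at \<open>s\<close> and \<open>t\<close>.\<close>

lemma weak_derivative_increment:
  fixes F G :: "real \<Rightarrow> real"
  assumes F: "continuous_on {0..T} F" and G: "integrable (leb_on {0<..<T}) G"
    and weak: "\<And>\<eta>. test_function {0<..<T} \<eta> \<Longrightarrow>
      (LINT t|leb_on {0<..<T}. F t * frechet_derivative \<eta> (at t) 1) = - (LINT t|leb_on {0<..<T}. G t * \<eta> t)"
    and st: "0 < s" "s < t" "t < T"
  shows "F t - F s = (LINT \<tau>|leb_on {0<..<T}. indicator {s<..t} \<tau> * G \<tau>)"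
proof -
  let ?N = "leb_on {0<..<T} :: real measure"
  interpret N: bounded_borel_measure ?N by (rule bounded_borel_measure_leb_on) auto
  obtain \<Phi> :: "real \<Rightarrow> real" where \<Phi>: "smooth \<Phi>" "\<And>x. 0 \<le> \<Phi> x" "\<And>x. \<Phi> x \<le> 1"
    "\<And>x. x \<le> -1 \<Longrightarrow> \<Phi> x = 0" "\<And>x. x \<ge> 1 \<Longrightarrow> \<Phi> x = 1" by (rule smooth_step_exists) (rule that)
  define \<phi> where "\<phi> x = frechet_derivative \<Phi> (at x) 1" for x
  have d\<Phi>: "(\<Phi> has_real_derivative \<phi> x) (at x)" for x
    using smooth_line_derivative[OF \<Phi>(1), of 0 1 x] by (simp add: \<phi>_def)
  have c\<phi>: "continuous_on UNIV \<phi>" unfolding \<phi>_def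
    by (intro smooth_continuous_on smooth_frechet_derivative \<Phi>)
  have \<phi>m: "\<phi> \<in> borel_measurable borel" by (rule borel_measurable_continuous_onI[OF c\<phi>])
  \<comment> \<open>The interval is larger than the transition region of \<open>\<Phi>\<close>, so
    that outside it \<open>\<Phi>\<close> is constant on a whole neighbourhood.\<close>
  have \<phi>0: "\<phi> x = 0" if "x \<notin> {-2..2}" for x
  proof -
    have "(\<Phi> has_real_derivative 0) (at x)"
    proof (cases "x < -2")
      case True
      show ?thesis
        by (rule has_field_derivative_transform_within_open[of "\<lambda>_. 0" _ _ "{..<-1}"])
           (use True \<Phi>(4) in auto)
    next
      case False
      then have "x > 2" using that by auto
      show ?thesis
        by (rule has_field_derivative_transform_within_open[of "\<lambda>_. 1" _ _ "{1<..}"])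
           (use \<open>x > 2\<close> \<Phi>(5) in auto)
    qed
    then show ?thesis by (rule DERIV_unique[OF d\<Phi>])
  qed
  have \<phi>eq: "(\<lambda>x. \<phi> x * indicator {-2..2} x) = \<phi>" 
  proof (rule ext)
    show "\<phi> x * indicator {-2..2} x = \<phi> x" for x
      using \<phi>0[of x] by (cases "x \<in> {-2..2}") simp_all
  qed
  have i\<phi>: "integrable lborel \<phi>"
  proof -
    have "integrable lborel (\<lambda>x. indicator {-2..2} x *\<^sub>R \<phi> x)"
      by (intro borel_integrable_compact continuous_on_subset[OF c\<phi>]) auto
    moreover have "(\<lambda>x. indicator {-2..2} x *\<^sub>R \<phi> x) = \<phi>" using \<phi>eq by (simp add: mult.commute)
    ultimately show ?thesis by simp
  qed
  have I\<phi>: "(LINT x|lborel. \<phi> x) = 1"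
    using integral_FTC_Icc_real[of "-2" 2 \<Phi> \<phi>] d\<Phi> c\<phi> \<Phi>(4)[of "-2"] \<Phi>(5)[of 2]
    by (simp add: \<phi>eq continuous_on_eq_continuous_at)
  obtain C where C: "\<And>x. \<bar>\<phi> x\<bar> \<le> C"
  proof -
    have "compact (\<phi> ` {-2..2})" by (intro compact_continuous_image continuous_on_subset[OF c\<phi>]) auto
    then obtain C where C: "\<And>y. y \<in> \<phi> ` {-2..2} \<Longrightarrow> \<bar>y\<bar> \<le> C"
      using compact_imp_bounded[of "\<phi> ` {-2..2}"] unfolding bounded_real by blast
    have "\<bar>\<phi> x\<bar> \<le> max C 0" for x
    proof (cases "x \<in> {-2..2}")
      case True then show ?thesis using C[OF imageI[OF True]] by simp
    qed (simp add: \<phi>0)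
    then show thesis by (rule that)
  qed
  obtain B where B: "\<And>\<tau>. \<tau> \<in> {0..T} \<Longrightarrow> \<bar>F \<tau>\<bar> \<le> B"
  proof -
    have "compact (F ` {0..T})" by (intro compact_continuous_image F) auto
    then obtain B where B: "\<And>y. y \<in> F ` {0..T} \<Longrightarrow> \<bar>y\<bar> \<le> B"
      using compact_imp_bounded[of "F ` {0..T}"] unfolding bounded_real by blast
    show thesis by (rule that[OF B[OF imageI]])
  qed
  \<comment> \<open>Extension by zero, so that the mollifier can be substituted over the whole line;
    near an interior point it agrees with \<open>F\<close>.\<close>
  define F0 where "F0 \<tau> = indicator {0<..<T} \<tau> * F \<tau>" for \<tau>
  have F0m[measurable]: "F0 \<in> borel_measurable borel"
    using borel_measurable_continuous_on_indicator[of "{0<..<T}" F] continuous_on_subset[OF F, of "{0<..<T}"]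
    by (simp add: F0_def[abs_def] subset_iff)
  have F0B: "\<bar>F0 \<tau>\<bar> \<le> B" for \<tau>
    using B[of \<tau>] B[of s] st by (auto simp: F0_def indicator_def)
  have Fm: "F \<in> borel_measurable ?N"
    using borel_measurable_restrict_space_iff[of "{0<..<T}" lborel F] F0m by (simp add: F0_def[abs_def])
  \<comment> \<open>Small enough to keep the interval from \<open>s - e n\<close> to
    \<open>t + e n\<close> inside the open time interval.\<close>
  define \<delta> where "\<delta> = min s (T - t) / 2"
  define e where "e n = \<delta> * inverse (real (Suc n))" for n
  have \<delta>: "\<delta> > 0" "\<delta> < s" "\<delta> < T - t" using st by (auto simp: \<delta>_def min_def)
  have "inverse (real (Suc n)) \<le> 1" for n by (simp add: field_simps)
  then have e: "e n > 0" "e n \<le> \<delta>" for n using \<delta>(1) by (auto simp: e_def mult_left_le)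
  have e0: "e \<longlonglongrightarrow> 0"
    unfolding e_def using tendsto_mult[OF tendsto_const[of \<delta>] LIMSEQ_inverse_real_of_nat] by simp
  \<comment> \<open>The substitution \<open>\<tau> = c + e n * r\<close> turns the integral into an
    average of values near \<open>c\<close> with weight \<open>\<phi>\<close>, whose total mass is
    1.\<close>
  have mollify: "(\<lambda>n. LINT \<tau>|?N. F \<tau> * (\<phi> ((\<tau> - c) / e n) / e n)) \<longlonglongrightarrow> F c" if c: "0 < c" "c < T" for c
  proof -
    have eq: "(LINT \<tau>|?N. F \<tau> * (\<phi> ((\<tau> - c) / e n) / e n)) = (LINT r|lborel. F0 (c + e n * r) * \<phi> r)" for n
    proof -
      have "(LINT \<tau>|?N. F \<tau> * (\<phi> ((\<tau> - c) / e n) / e n)) = (LINT \<tau>|lborel. F0 \<tau> * (\<phi> ((\<tau> - c) / e n) / e n))"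
        by (subst integral_restrict_space) (auto simp: F0_def mult.assoc)
      also have "\<dots> = \<bar>e n\<bar> *\<^sub>R (LINT r|lborel. F0 (c + e n * r) * (\<phi> ((c + e n * r - c) / e n) / e n))"
        using e(1)[of n] by (intro lborel_integral_real_affine) simp
      also have "(LINT r|lborel. F0 (c + e n * r) * (\<phi> ((c + e n * r - c) / e n) / e n)) =
          (LINT r|lborel. F0 (c + e n * r) * \<phi> r) / e n"
        using e(1)[of n] by simp
      finally show ?thesis using e(1)[of n] by simp
    qed
    have "(\<lambda>n. LINT r|lborel. F0 (c + e n * r) * \<phi> r) \<longlonglongrightarrow> (LINT r|lborel. F c * \<phi> r)"
    proof (rule integral_dominated_convergence)
      show "integrable lborel (\<lambda>r. B * norm (\<phi> r))" using i\<phi> by simp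
      show "(\<lambda>r. F c * \<phi> r) \<in> borel_measurable lborel" using \<phi>m by simp
      show "(\<lambda>r. F0 (c + e n * r) * \<phi> r) \<in> borel_measurable lborel" for n using \<phi>m by simp
      show "AE r in lborel. norm (F0 (c + e n * r) * \<phi> r) \<le> B * norm (\<phi> r)" for n
        using F0B by (intro AE_I2) (simp add: abs_mult mult_right_mono)
      show "AE r in lborel. (\<lambda>n. F0 (c + e n * r) * \<phi> r) \<longlonglongrightarrow> F c * \<phi> r"
      proof (rule AE_I2)
        fix r
        have "isCont F c" using continuous_on_interior[OF F, of c] c by simp
        have lim: "(\<lambda>n. c + e n * r) \<longlonglongrightarrow> c"
          using tendsto_add[OF tendsto_const[of c] tendsto_mult[OF e0 tendsto_const[of r]]] by simp
        then have "(\<lambda>n. F (c + e n * r)) \<longlonglongrightarrow> F c"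
          by (rule isCont_tendsto_compose[OF \<open>isCont F c\<close>])
        moreover have "\<forall>\<^sub>F n in sequentially. F (c + e n * r) = F0 (c + e n * r)"
        proof -
          have "\<forall>\<^sub>F n in sequentially. c + e n * r \<in> {0<..<T}"
            using lim by (rule topological_tendstoD) (use c in auto)
          then show ?thesis by eventually_elim (simp add: F0_def)
        qed
        ultimately have "(\<lambda>n. F0 (c + e n * r)) \<longlonglongrightarrow> F c" by (rule Lim_transform_eventually)
        then show "(\<lambda>n. F0 (c + e n * r) * \<phi> r) \<longlonglongrightarrow> F c * \<phi> r" by (intro tendsto_mult tendsto_const)
      qed
    qed
    then show ?thesis unfolding eq by (simp add: I\<phi>)
  qed
  define \<eta> where "\<eta> n \<tau> = \<Phi> ((\<tau> - s) * (1 / e n)) - \<Phi> ((\<tau> - t) * (1 / e n))" for n \<tau>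
  have \<eta>0: "\<eta> n \<tau> = 0" if "\<tau> \<notin> {s - e n..t + e n}" for n \<tau>
  proof (cases "\<tau> < s - e n")
    case True
    then have "(\<tau> - s) * (1 / e n) \<le> -1" "(\<tau> - t) * (1 / e n) \<le> -1"
      using e(1)[of n] st by (auto simp: field_simps)
    then show ?thesis by (simp add: \<eta>_def \<Phi>(4) del: times_divide_eq_right)
  next
    case False
    then have "\<tau> > t + e n" using that by auto
    then have "(\<tau> - s) * (1 / e n) \<ge> 1" "(\<tau> - t) * (1 / e n) \<ge> 1"
      using e(1)[of n] st by (auto simp: field_simps)
    then show ?thesis by (simp add: \<eta>_def \<Phi>(5) del: times_divide_eq_right)
  qed
  have sm\<eta>: "smooth (\<eta> n)" for n
    unfolding \<eta>_def
    by (intro smooth_diff smooth_compose_real[OF \<Phi>(1)] smooth_mult smooth_const smooth_linear bounded_linear_ident)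
  have test\<eta>: "test_function {0<..<T} (\<eta> n)" for n
  proof -
    have "{x. \<eta> n x \<noteq> 0} \<subseteq> {s - e n..t + e n}" using \<eta>0[of _ n] by blast
    then have "closure {x. \<eta> n x \<noteq> 0} \<subseteq> {s - e n..t + e n}"
      by (rule closure_minimal) simp
    moreover have "{s - e n..t + e n} \<subseteq> {0<..<T}" using e[of n] \<delta> by auto
    moreover have "compact (closure {x. \<eta> n x \<noteq> 0})"
      using calculation(1) bounded_subset[OF bounded_closed_interval] by (simp add: compact_eq_bounded_closed)
    ultimately show ?thesis unfolding test_function_def using sm\<eta> by blast
  qed
  have d\<eta>: "frechet_derivative (\<eta> n) (at \<tau>) 1 = \<phi> ((\<tau> - s) / e n) / e n - \<phi> ((\<tau> - t) / e n) / e n" for n \<tau>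
  proof -
    have "((\<lambda>\<tau>. \<Phi> ((\<tau> - c) * (1 / e n))) has_real_derivative \<phi> ((\<tau> - c) * (1 / e n)) * (1 / e n)) (at \<tau>)" for c
      by (rule DERIV_chain2[OF d\<Phi>]) (use e(1)[of n] in \<open>auto intro!: derivative_eq_intros\<close>)
    from DERIV_diff[OF this[of s] this[of t]]
    have "(\<eta> n has_real_derivative \<phi> ((\<tau> - s) * (1 / e n)) * (1 / e n) - \<phi> ((\<tau> - t) * (1 / e n)) * (1 / e n)) (at \<tau>)"
      unfolding \<eta>_def .
    from DERIV_unique[OF this] smooth_line_derivative[OF sm\<eta>[of n], of 0 1 \<tau>]
    show ?thesis by simp
  qed
  have int: "integrable ?N (\<lambda>\<tau>. F \<tau> * (\<phi> ((\<tau> - c) / e n) / e n))" for c n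
  proof (rule N.integrable_const_bound)
    show "AE \<tau> in ?N. norm (F \<tau> * (\<phi> ((\<tau> - c) / e n) / e n)) \<le> B * (C / e n)"
    proof (rule AE_I2)
      fix \<tau> assume "\<tau> \<in> space ?N"
      then have "\<bar>F \<tau>\<bar> \<le> B" using B[of \<tau>] by (simp add: space_restrict_space)
      moreover have "\<bar>\<phi> ((\<tau> - c) / e n) / e n\<bar> \<le> C / e n"
        using C[of "(\<tau> - c) / e n"] e(1)[of n] by (simp add: divide_right_mono)
      ultimately show "norm (F \<tau> * (\<phi> ((\<tau> - c) / e n) / e n)) \<le> B * (C / e n)"
        unfolding real_norm_def abs_mult by (intro mult_mono) auto
    qed
    have "(\<lambda>\<tau>. \<phi> ((\<tau> - c) / e n) / e n) \<in> borel_measurable ?N"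
      using \<phi>m by (intro N.borel_measurable) simp
    then show "(\<lambda>\<tau>. F \<tau> * (\<phi> ((\<tau> - c) / e n) / e n)) \<in> borel_measurable ?N"
      using Fm by (intro borel_measurable_times)
  qed
  have "(LINT \<tau>|?N. F \<tau> * (\<phi> ((\<tau> - s) / e n) / e n)) - (LINT \<tau>|?N. F \<tau> * (\<phi> ((\<tau> - t) / e n) / e n)) =
      - (LINT \<tau>|?N. G \<tau> * \<eta> n \<tau>)" for n
    using weak[OF test\<eta>[of n]] Bochner_Integration.integral_diff[OF int[of s n] int[of t n]]
    by (simp add: d\<eta> right_diff_distrib)
  moreover have "(\<lambda>n. (LINT \<tau>|?N. F \<tau> * (\<phi> ((\<tau> - s) / e n) / e n)) -
      (LINT \<tau>|?N. F \<tau> * (\<phi> ((\<tau> - t) / e n) / e n))) \<longlonglongrightarrow> F s - F t"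
    using st by (intro tendsto_diff mollify) auto
  ultimately have l1: "(\<lambda>n. - (LINT \<tau>|?N. G \<tau> * \<eta> n \<tau>)) \<longlonglongrightarrow> F s - F t" by simp
  have l2: "(\<lambda>n. LINT \<tau>|?N. G \<tau> * \<eta> n \<tau>) \<longlonglongrightarrow> (LINT \<tau>|?N. indicator {s<..t} \<tau> * G \<tau>)"
  proof (rule integral_dominated_convergence)
    show "integrable ?N (\<lambda>\<tau>. norm (G \<tau>))" using G by simp
    have Gm: "G \<in> borel_measurable ?N" using G by simp
    show "(\<lambda>\<tau>. indicator {s<..t} \<tau> * G \<tau>) \<in> borel_measurable ?N"
      by (rule borel_measurable_times[OF N.borel_measurable Gm]) simp
    show "(\<lambda>\<tau>. G \<tau> * \<eta> n \<tau>) \<in> borel_measurable ?N" for n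
      by (rule borel_measurable_times[OF Gm N.borel_measurable[OF test_function_borel_measurable[OF test\<eta>]]])
    show "AE \<tau> in ?N. norm (G \<tau> * \<eta> n \<tau>) \<le> norm (G \<tau>)" for n
    proof (rule AE_I2)
      fix \<tau>
      have "\<bar>\<eta> n \<tau>\<bar> \<le> 1"
        unfolding \<eta>_def using \<Phi>(2,3)[of "(\<tau> - s) * (1 / e n)"] \<Phi>(2,3)[of "(\<tau> - t) * (1 / e n)"] by linarith
      then show "norm (G \<tau> * \<eta> n \<tau>) \<le> norm (G \<tau>)" by (simp add: abs_mult mult_left_le)
    qed
    \<comment> \<open>At \<open>s\<close> and \<open>t\<close> themselves the test functions involve
      \<open>\<Phi> 0\<close>, which is not prescribed.\<close>
    have "AE \<tau> in lborel. \<tau> \<noteq> s \<and> \<tau> \<noteq> t"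
      using AE_lborel_singleton[of s] AE_lborel_singleton[of t] by eventually_elim simp
    then have "AE \<tau> in ?N. \<tau> \<noteq> s \<and> \<tau> \<noteq> t"
      by (subst AE_restrict_space_iff) (auto elim: eventually_mono)
    then show "AE \<tau> in ?N. (\<lambda>n. G \<tau> * \<eta> n \<tau>) \<longlonglongrightarrow> indicator {s<..t} \<tau> * G \<tau>"
    proof eventually_elim
      case (elim \<tau>)
      have step: "(\<lambda>n. \<Phi> ((\<tau> - c) * (1 / e n))) \<longlonglongrightarrow> (if c < \<tau> then 1 else 0)" if "\<tau> \<noteq> c" for c
      proof (rule Lim_transform_eventually[OF tendsto_const])
        have "\<forall>\<^sub>F n in sequentially. e n < \<bar>\<tau> - c\<bar>"
          using e0 by (rule order_tendstoD) (use that in simp)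
        then show "\<forall>\<^sub>F n in sequentially. (if c < \<tau> then 1 else 0) = \<Phi> ((\<tau> - c) * (1 / e n))"
        proof eventually_elim
          case (elim n)
          show ?case
          proof (cases "c < \<tau>")
            case True
            then have "(\<tau> - c) * (1 / e n) \<ge> 1" using elim e(1)[of n] by (simp add: field_simps)
            then show ?thesis using True \<Phi>(5) by simp
          next
            case False
            then have "(\<tau> - c) * (1 / e n) \<le> -1" using elim e(1)[of n] that by (simp add: field_simps)
            then show ?thesis using False \<Phi>(4) by simp
          qed
        qed
      qed
      have "(\<lambda>n. \<eta> n \<tau>) \<longlonglongrightarrow> (if s < \<tau> then 1 else 0) - (if t < \<tau> then 1 else 0)"
        unfolding \<eta>_def using elim by (intro tendsto_diff step) auto
      also have "(if s < \<tau> then 1 else 0) - (if t < \<tau> then 1 else 0) = (indicator {s<..t} \<tau> :: real)"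
        using st by (auto simp: indicator_def)
      finally have "(\<lambda>n. G \<tau> * \<eta> n \<tau>) \<longlonglongrightarrow> G \<tau> * indicator {s<..t} \<tau>" by (intro tendsto_mult tendsto_const)
      then show ?case by (simp add: mult.commute)
    qed
  qed
  from LIMSEQ_unique[OF l1 tendsto_minus[OF l2]] show ?thesis by simp
qed

text \<open>Tensor products reduce the distributional derivative on the space-time cylinder to a
  scalar weak derivative in time.\<close>

lemma test_function_product:
  fixes \<psi> :: "'a::euclidean_space \<Rightarrow> real"
  assumes \<eta>: "test_function I \<eta>" and \<psi>: "test_function U \<psi>"
  shows "test_function (I \<times> U) (\<lambda>(t::real, x). \<eta> t * \<psi> x)"
    and "frechet_derivative (\<lambda>(t::real, x). \<eta> t * \<psi> x) (at (t, x)) (1, 0) = frechet_derivative \<eta> (at t) 1 * \<psi> x"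
proof -
  have eq: "(\<lambda>(t::real, x). \<eta> t * \<psi> x) = (\<lambda>z. \<eta> (fst z) * \<psi> (snd z))" by auto
  have sm: "smooth (\<lambda>z::real \<times> 'a. \<eta> (fst z) * \<psi> (snd z))"
    by (rule smooth_mult[OF smooth_compose_linear[OF bounded_linear_fst test_function_smooth[OF \<eta>]]
          smooth_compose_linear[OF bounded_linear_snd test_function_smooth[OF \<psi>]]])
  have "{z. \<eta> (fst z) * \<psi> (snd z) \<noteq> 0} \<subseteq> closure {t. \<eta> t \<noteq> 0} \<times> closure {x. \<psi> x \<noteq> 0}"
    using closure_subset[of "{t. \<eta> t \<noteq> 0}"] closure_subset[of "{x. \<psi> x \<noteq> 0}"] by auto
  then have cl: "closure {z. \<eta> (fst z) * \<psi> (snd z) \<noteq> 0} \<subseteq> closure {t. \<eta> t \<noteq> 0} \<times> closure {x. \<psi> x \<noteq> 0}"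
    by (rule closure_minimal) (intro closed_Times closed_closure)
  have "compact (closure {t. \<eta> t \<noteq> 0} \<times> closure {x. \<psi> x \<noteq> 0})"
    using \<eta> \<psi> by (intro compact_Times) (auto simp: test_function_def)
  from bounded_subset[OF compact_imp_bounded[OF this] cl]
  have "compact (closure {z. \<eta> (fst z) * \<psi> (snd z) \<noteq> 0})" by (simp add: compact_eq_bounded_closed)
  moreover have "closure {z. \<eta> (fst z) * \<psi> (snd z) \<noteq> 0} \<subseteq> I \<times> U"
    using cl \<eta> \<psi> unfolding test_function_def by blast
  ultimately show "test_function (I \<times> U) (\<lambda>(t::real, x). \<eta> t * \<psi> x)"
    unfolding eq test_function_def using sm by blast
  have d: "((\<lambda>z::real \<times> 'a. \<eta> (fst z) * \<psi> (snd z)) has_derivative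
      (\<lambda>h. \<eta> t * frechet_derivative \<psi> (at x) (snd h) + frechet_derivative \<eta> (at t) (fst h) * \<psi> x)) (at (t, x))"
  proof -
    have "((\<lambda>z::real \<times> 'a. \<eta> (fst z)) has_derivative (\<lambda>h. frechet_derivative \<eta> (at (fst (t, x))) (fst h))) (at (t, x))"
      by (rule has_derivative_compose[OF bounded_linear_imp_has_derivative[OF bounded_linear_fst]
            smooth_has_derivative[OF test_function_smooth[OF \<eta>]]])
    moreover have "((\<lambda>z::real \<times> 'a. \<psi> (snd z)) has_derivative (\<lambda>h. frechet_derivative \<psi> (at (snd (t, x))) (snd h))) (at (t, x))"
      by (rule has_derivative_compose[OF bounded_linear_imp_has_derivative[OF bounded_linear_snd]
            smooth_has_derivative[OF test_function_smooth[OF \<psi>]]])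
    ultimately show ?thesis by (rule has_derivative_mult[THEN has_derivative_eq_rhs]) simp
  qed
  have "frechet_derivative \<psi> (at x) 0 = 0"
    by (rule linear_0[OF has_derivative_linear[OF smooth_has_derivative[OF test_function_smooth[OF \<psi>]]]])
  with fun_cong[OF frechet_derivative_at[OF d], of "(1, 0)"]
  show "frechet_derivative (\<lambda>(t::real, x). \<eta> t * \<psi> x) (at (t, x)) (1, 0) = frechet_derivative \<eta> (at t) 1 * \<psi> x"
    unfolding eq by simp
qed

lemma sum_indicator_grid:
  fixes g :: "nat \<Rightarrow> real"
  assumes "\<And>i. g i \<le> g (Suc i)"
  shows "(\<Sum>i<n. indicator {g i<..g (Suc i)} \<tau>) = (indicator {g 0<..g n} \<tau> :: real)"
proof (induction n)
  case (Suc n)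
  have "g 0 \<le> g n" by (rule lift_Suc_mono_le[of g, OF assms]) simp
  then show ?case using Suc assms[of n] by (auto simp: indicator_def)
qed simp

text \<open>Instantiated with \<open>u\<close> on \<open>\<Omega>\<close> and with the trace of
  \<open>u\<close> on the boundary. The approximation axiom is needed because the weak derivative
  can only be tested with test functions, whereas the chain rule pairs it with values of
  \<open>f\<close>.\<close>

locale L2_time_derivative = bounded_borel_measure M for M :: "'a::euclidean_space measure" +
  fixes T :: real and U :: "'a set" and f v :: "real \<Rightarrow> 'a \<Rightarrow> real"
  assumes f_Lspace2: "\<And>t. t \<in> {0..T} \<Longrightarrow> f t \<in> Lspace 2 M"
    and f_continuous: "\<And>t. t \<in> {0..T} \<Longrightarrow>
      ((\<lambda>s. Lnorm 2 M (\<lambda>x. f s x - f t x)) \<longlongrightarrow> 0) (at t within {0..T})"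
    and time_deriv: "has_L2_time_deriv T U M f v"
    and f_approx: "\<And>t e. t \<in> {0..T} \<Longrightarrow> 0 < e \<Longrightarrow>
      \<exists>\<psi>. test_function U \<psi> \<and> Lnorm 2 M (\<lambda>x. \<psi> x - f t x) < e"
begin

abbreviation "N \<equiv> leb_on {0<..<T} :: real measure"

sublocale N: bounded_borel_measure N
  by (rule bounded_borel_measure_leb_on) auto

sublocale P: pair_sigma_finite N M
  by unfold_locales

lemma v_Lspace2_product: "(\<lambda>(t, x). v t x) \<in> Lspace 2 (N \<Otimes>\<^sub>M M)"
  using time_deriv by (simp add: has_L2_time_deriv_def)

lemma v_measurable: "(\<lambda>(t, x). v t x) \<in> borel_measurable (N \<Otimes>\<^sub>M M)"
  by (rule Lspace2_measurable[OF v_Lspace2_product])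

lemma v_square_integrable: "integrable (N \<Otimes>\<^sub>M M) (\<lambda>z. (v (fst z) (snd z))\<^sup>2)"
  using v_Lspace2_product by (simp add: Lspace2_iff case_prod_beta)

lemma AE_v_Lspace2: "AE t in N. v t \<in> Lspace 2 M"
proof -
  have "AE t in N. integrable M (\<lambda>x. (v t x)\<^sup>2)"
    using P.AE_integrable_fst'[OF v_square_integrable] by simp
  moreover have "AE t in N. v t \<in> borel_measurable M"
    using measurable_Pair2[OF v_measurable] by (intro AE_I2) simp
  ultimately show ?thesis by eventually_elim (simp add: Lspace2_iff)
qed

lemma Lnorm_v_integrable: "integrable N (\<lambda>t. Lnorm 2 M (v t))"
proof -
  have sq: "integrable N (\<lambda>t. (Lnorm 2 M (v t))\<^sup>2)"
    using P.integrable_fst'[OF v_square_integrable] by (simp add: Lnorm2_square)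
  have m: "(\<lambda>t. Lnorm 2 M (v t)) \<in> borel_measurable N"
  proof -
    have "(\<lambda>t. sqrt ((Lnorm 2 M (v t))\<^sup>2)) \<in> borel_measurable N"
      using measurable_compose[OF borel_measurable_integrable[OF sq]
          borel_measurable_continuous_onI[OF continuous_on_real_sqrt[OF continuous_on_id]]] by simp
    then show ?thesis by (simp add: Lnorm_nonneg)
  qed
  have "(\<lambda>t. Lnorm 2 M (v t)) \<in> Lspace 2 N" using sq m by (simp add: Lspace2_iff)
  then show ?thesis by (rule Lspace2_integrable[OF N.finite_measure_axioms])
qed

lemma pairing_le:
  assumes "v t \<in> Lspace 2 M" "\<psi> \<in> Lspace 2 M"
  shows "\<bar>LINT x|M. v t x * \<psi> x\<bar> \<le> Lnorm 2 M (v t) * Lnorm 2 M \<psi>"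
  using Lspace2_Cauchy_Schwarz_mult[OF assms] .

lemma pairing_integrable:
  assumes \<psi>: "\<psi> \<in> Lspace 2 M"
  shows "integrable N (\<lambda>t. LINT x|M. v t x * \<psi> x)"
proof (rule Bochner_Integration.integrable_bound)
  show "integrable N (\<lambda>t. Lnorm 2 M (v t) * Lnorm 2 M \<psi>)"
    using Lnorm_v_integrable by simp
  have [measurable]: "\<psi> \<in> borel_measurable M" "(\<lambda>(t, x). v t x) \<in> borel_measurable (N \<Otimes>\<^sub>M M)"
    by (rule Lspace2_measurable[OF \<psi>], rule v_measurable)
  show "(\<lambda>t. LINT x|M. v t x * \<psi> x) \<in> borel_measurable N"
    by (rule borel_measurable_lebesgue_integral) measurable
  show "AE t in N. norm (LINT x|M. v t x * \<psi> x) \<le> norm (Lnorm 2 M (v t) * Lnorm 2 M \<psi>)"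
    using AE_v_Lspace2 by eventually_elim (use pairing_le[OF _ \<psi>] in \<open>simp add: abs_mult Lnorm_nonneg\<close>)
qed

lemma integrable_indicator_mult:
  assumes "integrable N h" "A \<in> sets borel"
  shows "integrable N (\<lambda>t. indicator A t * h t :: real)"
proof (rule Bochner_Integration.integrable_bound[OF assms(1)])
  have "indicator A \<in> borel_measurable N" using assms(2) by (intro N.borel_measurable) simp
  then show "(\<lambda>t. indicator A t * h t) \<in> borel_measurable N"
    using assms(1) by (intro borel_measurable_times) auto
  show "AE t in N. norm (indicator A t * h t) \<le> norm (h t)"
    by (intro AE_I2) (simp add: indicator_def)
qed

lemma f_pairing_continuous:
  assumes \<psi>: "\<psi> \<in> Lspace 2 M"
  shows "continuous_on {0..T} (\<lambda>t. LINT x|M. f t x * \<psi> x)"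
  unfolding continuous_on_def
proof
  fix t assume t: "t \<in> {0..T}"
  have "\<forall>\<^sub>F s in at t within {0..T}. norm ((LINT x|M. f s x * \<psi> x) - (LINT x|M. f t x * \<psi> x)) \<le>
      Lnorm 2 M (\<lambda>x. f s x - f t x) * Lnorm 2 M \<psi>"
    unfolding eventually_at_filter
  proof (intro always_eventually allI impI)
    fix s assume s: "s \<in> {0..T}"
    show "norm ((LINT x|M. f s x * \<psi> x) - (LINT x|M. f t x * \<psi> x)) \<le> Lnorm 2 M (\<lambda>x. f s x - f t x) * Lnorm 2 M \<psi>"
      using Lspace2_Cauchy_Schwarz_mult[OF Lspace2_diff[OF f_Lspace2[OF s] f_Lspace2[OF t]] \<psi>]
        Lspace2_mult_integrable[OF f_Lspace2[OF s] \<psi>] Lspace2_mult_integrable[OF f_Lspace2[OF t] \<psi>]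
      by (simp add: left_diff_distrib)
  qed
  moreover have "((\<lambda>s. Lnorm 2 M (\<lambda>x. f s x - f t x) * Lnorm 2 M \<psi>) \<longlongrightarrow> 0) (at t within {0..T})"
    using tendsto_mult[OF f_continuous[OF t] tendsto_const] by simp
  ultimately have "((\<lambda>s. (LINT x|M. f s x * \<psi> x) - (LINT x|M. f t x * \<psi> x)) \<longlongrightarrow> 0) (at t within {0..T})"
    by (rule Lim_null_comparison)
  then show "((\<lambda>t. LINT x|M. f t x * \<psi> x) \<longlongrightarrow> (LINT x|M. f t x * \<psi> x)) (at t within {0..T})"
    by (rule LIM_zero_cancel)
qed

text \<open>Testing with \<open>\<eta> t * \<psi> x\<close> shows that the pairing of
  \<open>v\<close> with \<open>\<psi>\<close> is the weak time derivative of the continuous pairing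
  of \<open>f\<close> with \<open>\<psi>\<close>.\<close>

lemma pairing_increment_test_function:
  assumes \<psi>: "test_function U \<psi>" and st: "0 < s" "s < t" "t < T"
  shows "(LINT x|M. f t x * \<psi> x) - (LINT x|M. f s x * \<psi> x) =
    (LINT \<tau>|N. indicator {s<..t} \<tau> * (LINT x|M. v \<tau> x * \<psi> x))"
proof (rule weak_derivative_increment[OF _ _ _ st])
  have \<psi>2: "\<psi> \<in> Lspace 2 M" by (rule test_function_Lspace2[OF \<psi>])
  show "continuous_on {0..T} (\<lambda>t. LINT x|M. f t x * \<psi> x)" by (rule f_pairing_continuous[OF \<psi>2])
  show "integrable N (\<lambda>\<tau>. LINT x|M. v \<tau> x * \<psi> x)" by (rule pairing_integrable[OF \<psi>2])
  fix \<eta> :: "real \<Rightarrow> real" assume \<eta>: "test_function {0<..<T} \<eta>"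
  have "(LINT t|N. LINT x|M. f t x * (frechet_derivative \<eta> (at t) 1 * \<psi> x)) =
      - (LINT t|N. LINT x|M. v t x * (\<eta> t * \<psi> x))"
  proof -
    have "\<forall>\<phi>. test_function ({0<..<T} \<times> U) \<phi> \<longrightarrow>
        (LINT t|N. LINT x|M. f t x * frechet_derivative \<phi> (at (t, x)) (1, 0)) =
        - (LINT t|N. LINT x|M. v t x * \<phi> (t, x))"
      using time_deriv by (simp add: has_L2_time_deriv_def)
    from this[rule_format, OF test_function_product(1)[OF \<eta> \<psi>]]
    show ?thesis by (simp add: test_function_product(2)[OF \<eta> \<psi>])
  qed
  moreover have "(LINT x|M. f t x * (c * \<psi> x)) = (LINT x|M. f t x * \<psi> x) * c" for t c
    by (simp add: mult.left_commute[of _ c] mult.commute[of _ c])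
  moreover have "(LINT x|M. v t x * (c * \<psi> x)) = (LINT x|M. v t x * \<psi> x) * c" for t c
    by (simp add: mult.left_commute[of _ c] mult.commute[of _ c])
  ultimately show "(LINT t|N. (LINT x|M. f t x * \<psi> x) * frechet_derivative \<eta> (at t) 1) =
      - (LINT t|N. (LINT x|M. v t x * \<psi> x) * \<eta> t)"
    by simp
qed

text \<open>The second argument is frozen at a time \<open>r\<close> and approximated by test
  functions. The error on the right is at most the time integral of the norm of \<open>v\<close>
  times the approximation error, so the limit can be taken.\<close>

lemma pairing_increment:
  assumes r: "r \<in> {0..T}" and st: "0 < s" "s < t" "t < T"
  shows "(LINT x|M. f t x * f r x) - (LINT x|M. f s x * f r x) =
    (LINT \<tau>|N. indicator {s<..t} \<tau> * (LINT x|M. v \<tau> x * f r x))"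
proof -
  note fr = f_Lspace2[OF r]
  have ft: "f t \<in> Lspace 2 M" "f s \<in> Lspace 2 M" using st by (auto intro: f_Lspace2)
  have "\<forall>k. \<exists>\<psi>. test_function U \<psi> \<and> Lnorm 2 M (\<lambda>x. \<psi> x - f r x) < inverse (real (Suc k))"
    by (intro allI f_approx r) simp
  from choice[OF this] obtain \<psi> where \<psi>: "\<And>k. test_function U (\<psi> k)"
    "\<And>k. Lnorm 2 M (\<lambda>x. \<psi> k x - f r x) < inverse (real (Suc k))" by blast
  have \<psi>2: "\<psi> k \<in> Lspace 2 M" for k by (rule test_function_Lspace2[OF \<psi>(1)])
  have lim: "(\<lambda>k. Lnorm 2 M (\<lambda>x. \<psi> k x - f r x)) \<longlonglongrightarrow> 0"
  proof (rule Lim_null_comparison[OF always_eventually LIMSEQ_inverse_real_of_nat], rule allI)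
    show "norm (Lnorm 2 M (\<lambda>x. \<psi> k x - f r x)) \<le> inverse (real (Suc k))" for k
      using \<psi>(2)[of k] by (simp add: Lnorm_nonneg)
  qed
  have l1: "(\<lambda>k. (LINT x|M. f t x * \<psi> k x) - (LINT x|M. f s x * \<psi> k x)) \<longlonglongrightarrow>
      (LINT x|M. f t x * f r x) - (LINT x|M. f s x * f r x)"
    using Lspace2_inner_tendsto[OF \<psi>2 fr ft(1) lim] Lspace2_inner_tendsto[OF \<psi>2 fr ft(2) lim]
    by (intro tendsto_diff) simp_all
  let ?R = "\<lambda>\<psi>. LINT \<tau>|N. indicator {s<..t} \<tau> * (LINT x|M. v \<tau> x * \<psi> x)"
  have int: "integrable N (\<lambda>\<tau>. indicator {s<..t} \<tau> * (LINT x|M. v \<tau> x * h x))" if "h \<in> Lspace 2 M" for h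
    by (rule integrable_indicator_mult[OF pairing_integrable[OF that]]) simp
  have "\<bar>?R (\<psi> k) - ?R (f r)\<bar> \<le> (LINT \<tau>|N. Lnorm 2 M (v \<tau>)) * Lnorm 2 M (\<lambda>x. \<psi> k x - f r x)" for k
  proof -
    have "\<bar>?R (\<psi> k) - ?R (f r)\<bar> = \<bar>LINT \<tau>|N. indicator {s<..t} \<tau> * (LINT x|M. v \<tau> x * \<psi> k x) -
        indicator {s<..t} \<tau> * (LINT x|M. v \<tau> x * f r x)\<bar>"
      by (subst Bochner_Integration.integral_diff[OF int[OF \<psi>2] int[OF fr]]) simp
    also have "\<dots> \<le> (LINT \<tau>|N. \<bar>indicator {s<..t} \<tau> * (LINT x|M. v \<tau> x * \<psi> k x) -
        indicator {s<..t} \<tau> * (LINT x|M. v \<tau> x * f r x)\<bar>)"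
      by (rule integral_abs_bound)
    also have "\<dots> \<le> (LINT \<tau>|N. Lnorm 2 M (v \<tau>) * Lnorm 2 M (\<lambda>x. \<psi> k x - f r x))"
    proof (rule integral_mono_AE)
      show "AE \<tau> in N. \<bar>indicator {s<..t} \<tau> * (LINT x|M. v \<tau> x * \<psi> k x) -
        indicator {s<..t} \<tau> * (LINT x|M. v \<tau> x * f r x)\<bar> \<le> Lnorm 2 M (v \<tau>) * Lnorm 2 M (\<lambda>x. \<psi> k x - f r x)"
        using AE_v_Lspace2
      proof eventually_elim
        case (elim \<tau>)
        have "(LINT x|M. v \<tau> x * \<psi> k x) - (LINT x|M. v \<tau> x * f r x) = (LINT x|M. v \<tau> x * (\<psi> k x - f r x))"
          using Lspace2_mult_integrable[OF elim \<psi>2] Lspace2_mult_integrable[OF elim fr]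
          by (simp add: right_diff_distrib)
        then have "\<bar>(LINT x|M. v \<tau> x * \<psi> k x) - (LINT x|M. v \<tau> x * f r x)\<bar> \<le>
            Lnorm 2 M (v \<tau>) * Lnorm 2 M (\<lambda>x. \<psi> k x - f r x)"
          using pairing_le[OF elim Lspace2_diff[OF \<psi>2 fr]] by simp
        moreover have "0 \<le> Lnorm 2 M (v \<tau>) * Lnorm 2 M (\<lambda>x. \<psi> k x - f r x)" by (simp add: Lnorm_nonneg)
        ultimately show ?case by (simp add: indicator_def)
      qed
    qed (use int[OF \<psi>2] int[OF fr] Lnorm_v_integrable in auto)
    also have "\<dots> = (LINT \<tau>|N. Lnorm 2 M (v \<tau>)) * Lnorm 2 M (\<lambda>x. \<psi> k x - f r x)" by simp
    finally show ?thesis .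
  qed
  then have "\<forall>\<^sub>F k in sequentially. norm (?R (\<psi> k) - ?R (f r)) \<le>
      (LINT \<tau>|N. Lnorm 2 M (v \<tau>)) * Lnorm 2 M (\<lambda>x. \<psi> k x - f r x)"
    by (intro always_eventually) simp
  moreover have "(\<lambda>k. (LINT \<tau>|N. Lnorm 2 M (v \<tau>)) * Lnorm 2 M (\<lambda>x. \<psi> k x - f r x)) \<longlonglongrightarrow> 0"
    using tendsto_mult[OF tendsto_const lim] by simp
  ultimately have "(\<lambda>k. ?R (\<psi> k) - ?R (f r)) \<longlonglongrightarrow> 0"
    by (rule Lim_null_comparison)
  then have "(\<lambda>k. ?R (\<psi> k)) \<longlonglongrightarrow> ?R (f r)"
    by (rule LIM_zero_cancel)
  then have "(\<lambda>k. (LINT x|M. f t x * \<psi> k x) - (LINT x|M. f s x * \<psi> k x)) \<longlonglongrightarrow> ?R (f r)"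
    unfolding pairing_increment_test_function[OF \<psi>(1) st] .
  from LIMSEQ_unique[OF l1 this] show ?thesis .
qed

text \<open>A Lebesgue number for the cover of the time interval by balls on which \<open>f\<close>
  stays within \<open>e / 2\<close> of its value at the centre.\<close>

lemma f_uniformly_continuous:
  assumes "e > 0"
  shows "\<exists>\<delta>>0. \<forall>a\<in>{0..T}. \<forall>b\<in>{0..T}. \<bar>a - b\<bar> < \<delta> \<longrightarrow> Lnorm 2 M (\<lambda>x. f a x - f b x) < e"
proof -
  have "\<forall>t\<in>{0..T}. \<exists>d>0. \<forall>s\<in>{0..T}. dist s t < d \<longrightarrow> Lnorm 2 M (\<lambda>x. f s x - f t x) < e / 2"
  proof
    fix t assume t: "t \<in> {0..T}"
    have "\<forall>\<^sub>F s in at t within {0..T}. Lnorm 2 M (\<lambda>x. f s x - f t x) < e / 2"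
      using f_continuous[OF t] by (rule order_tendstoD) (use assms in simp)
    then obtain d where d: "d > 0"
      "\<And>s. s \<in> {0..T} \<Longrightarrow> s \<noteq> t \<Longrightarrow> dist s t < d \<Longrightarrow> Lnorm 2 M (\<lambda>x. f s x - f t x) < e / 2"
      unfolding eventually_at by blast
    have "Lnorm 2 M (\<lambda>x. f s x - f t x) < e / 2" if "s \<in> {0..T}" "dist s t < d" for s
    proof (cases "s = t")
      case True
      then show ?thesis using assms by (simp add: Lnorm2_eq)
    qed (use d that in blast)
    then show "\<exists>d>0. \<forall>s\<in>{0..T}. dist s t < d \<longrightarrow> Lnorm 2 M (\<lambda>x. f s x - f t x) < e / 2" using d(1) by blast
  qed
  from bchoice[OF this] obtain d where d: "\<forall>t\<in>{0..T}. d t > 0 \<and>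
      (\<forall>s\<in>{0..T}. dist s t < d t \<longrightarrow> Lnorm 2 M (\<lambda>x. f s x - f t x) < e / 2)" ..
  have cov: "{0..T} \<subseteq> \<Union>((\<lambda>t. ball t (d t)) ` {0..T})" using d by force
  obtain \<delta> where \<delta>: "\<delta> > 0" "\<And>x. x \<in> {0..T} \<Longrightarrow> \<exists>G\<in>(\<lambda>t. ball t (d t)) ` {0..T}. ball x \<delta> \<subseteq> G"
    by (rule Heine_Borel_lemma[OF compact_Icc cov]) auto
  have "Lnorm 2 M (\<lambda>x. f a x - f b x) < e" if ab: "a \<in> {0..T}" "b \<in> {0..T}" "\<bar>a - b\<bar> < \<delta>" for a b
  proof -
    obtain t where t: "t \<in> {0..T}" "ball a \<delta> \<subseteq> ball t (d t)" using \<delta>(2)[OF ab(1)] by blast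
    have "a \<in> ball t (d t)" "b \<in> ball t (d t)" using t(2) ab(3) \<delta>(1) by (auto simp: subset_iff dist_real_def)
    then have "Lnorm 2 M (\<lambda>x. f a x - f t x) < e / 2" "Lnorm 2 M (\<lambda>x. f b x - f t x) < e / 2"
      using d t(1) ab by (auto simp: dist_commute)
    moreover have "Lnorm 2 M (\<lambda>x. (f a x - f t x) - (f b x - f t x)) \<le>
        Lnorm 2 M (\<lambda>x. f a x - f t x) + Lnorm 2 M (\<lambda>x. f b x - f t x)"
      using ab t(1) by (intro Lnorm2_triangle_diff Lspace2_diff f_Lspace2)
    ultimately show ?thesis by simp
  qed
  then show ?thesis using \<delta>(1) by blast
qed

text \<open>Writing the increments of the squared norm as \<open>(f t - f s, f t + f s)\<close> over a fine partition
  gives the chain rule for \<open>|f|\<^sup>2\<close> up to an error that is small in \<open>L\<^sup>1\<close>. This form avoids the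
  measurability of the pairing of \<open>v\<close> and \<open>f\<close> in time.\<close>

lemma norm_square_increment_approx:
  assumes e: "e > 0" and st: "0 < s" "s < t" "t < T"
  shows "\<exists>p. integrable N p \<and> (Lnorm 2 M (f t))\<^sup>2 - (Lnorm 2 M (f s))\<^sup>2 = (LINT \<tau>|N. p \<tau>) \<and>
    (AE \<tau> in N. \<bar>p \<tau> - 2 * (indicator {s<..t} \<tau> * (LINT x|M. v \<tau> x * f \<tau> x))\<bar> \<le> 2 * e * Lnorm 2 M (v \<tau>))"
proof -
  obtain \<delta> where \<delta>: "\<delta> > 0" "\<And>a b. a \<in> {0..T} \<Longrightarrow> b \<in> {0..T} \<Longrightarrow> \<bar>a - b\<bar> < \<delta> \<Longrightarrow>
      Lnorm 2 M (\<lambda>x. f a x - f b x) < e"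
    using f_uniformly_continuous[OF e] by blast
  obtain n :: nat where n: "(t - s) / \<delta> < real n" using reals_Archimedean2 by blast
  have n0: "n > 0" using n st \<delta>(1) by (cases n) (auto simp: field_simps)
  \<comment> \<open>The number \<open>n\<close> of cells was chosen so that the mesh size is below
    \<open>\<delta>\<close>.\<close>
  define d where "d = (t - s) / real n"
  have d: "0 < d" "d < \<delta>" "real n * d = t - s" using n n0 st \<delta>(1) by (auto simp: d_def field_simps)
  define g where "g i = s + real i * d" for i :: nat
  have gS: "g (Suc i) = g i + d" for i by (simp add: g_def algebra_simps)
  have g0n: "g 0 = s" "g n = t" using d(3) by (simp_all add: g_def)
  have gmono: "g i \<le> g j" if "i \<le> j" for i j using that d(1) by (simp add: g_def mult_right_mono)
  have gst: "s \<le> g i" "g i \<le> t" if "i \<le> n" for i using gmono[of 0 i] gmono[of i n] that g0n by auto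
  have gT: "g i \<in> {0..T}" "0 < g i" "g i < T" if "i \<le> n" for i using gst[OF that] st by auto
  define q where "q i \<tau> = (LINT x|M. v \<tau> x * f (g (Suc i)) x) + (LINT x|M. v \<tau> x * f (g i) x)" for i \<tau>
  define I where "I i \<tau> = (indicator {g i<..g (Suc i)} \<tau> :: real)" for i \<tau>
  define p where "p \<tau> = (\<Sum>i<n. I i \<tau> * q i \<tau>)" for \<tau>
  have intI: "integrable N (\<lambda>\<tau>. I i \<tau> * (LINT x|M. v \<tau> x * f (g j) x))" if "j \<le> n" for i j
    unfolding I_def by (rule integrable_indicator_mult[OF pairing_integrable[OF f_Lspace2[OF gT(1)[OF that]]]]) simp
  have intq: "integrable N (\<lambda>\<tau>. I i \<tau> * q i \<tau>)" if "i < n" for i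
    using intI[of "Suc i" i] intI[of i i] that by (simp add: q_def distrib_left)
  have intp: "integrable N p" unfolding p_def using intq by (intro Bochner_Integration.integrable_sum) auto
  have incr: "(LINT \<tau>|N. I i \<tau> * q i \<tau>) = (Lnorm 2 M (f (g (Suc i))))\<^sup>2 - (Lnorm 2 M (f (g i)))\<^sup>2" if i: "i < n" for i
  proof -
    have g: "0 < g i" "g i < g (Suc i)" "g (Suc i) < T" using gT[of i] gT[of "Suc i"] gS[of i] d(1) i by auto
    have "(LINT \<tau>|N. I i \<tau> * q i \<tau>) = (LINT \<tau>|N. I i \<tau> * (LINT x|M. v \<tau> x * f (g (Suc i)) x)) +
        (LINT \<tau>|N. I i \<tau> * (LINT x|M. v \<tau> x * f (g i) x))"
      using intI[of "Suc i" i] intI[of i i] i by (simp add: q_def distrib_left)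
    also have "\<dots> = ((LINT x|M. f (g (Suc i)) x * f (g (Suc i)) x) - (LINT x|M. f (g i) x * f (g (Suc i)) x)) +
        ((LINT x|M. f (g (Suc i)) x * f (g i) x) - (LINT x|M. f (g i) x * f (g i) x))"
      unfolding I_def using pairing_increment[OF gT(1) g, of "Suc i"] pairing_increment[OF gT(1) g, of i] i by simp
    \<comment> \<open>The mixed products cancel by symmetry of the inner product, so the sum over
      the cells telescopes.\<close>
    also have "\<dots> = (Lnorm 2 M (f (g (Suc i))))\<^sup>2 - (Lnorm 2 M (f (g i)))\<^sup>2"
      unfolding Lnorm2_square real_norm_def power2_abs by (simp add: power2_eq_square mult.commute)
    finally show ?thesis .
  qed
  have "(LINT \<tau>|N. p \<tau>) = (\<Sum>i<n. (Lnorm 2 M (f (g (Suc i))))\<^sup>2 - (Lnorm 2 M (f (g i)))\<^sup>2)"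
    unfolding p_def using intq incr by (subst Bochner_Integration.integral_sum) auto
  also have "\<dots> = (Lnorm 2 M (f t))\<^sup>2 - (Lnorm 2 M (f s))\<^sup>2"
    by (subst sum_lessThan_telescope) (simp add: g0n)
  finally have eq: "(Lnorm 2 M (f t))\<^sup>2 - (Lnorm 2 M (f s))\<^sup>2 = (LINT \<tau>|N. p \<tau>)" by simp
  have "AE \<tau> in N. \<bar>p \<tau> - 2 * (indicator {s<..t} \<tau> * (LINT x|M. v \<tau> x * f \<tau> x))\<bar> \<le> 2 * e * Lnorm 2 M (v \<tau>)"
    using AE_v_Lspace2 AE_space
  proof eventually_elim
    case (elim \<tau>)
    then have v: "v \<tau> \<in> Lspace 2 M" and \<tau>: "\<tau> \<in> {0..T}" by (auto simp: space_restrict_space)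
    let ?c = "LINT x|M. v \<tau> x * f \<tau> x" and ?L = "Lnorm 2 M (v \<tau>)"
    have sumI: "(\<Sum>i<n. I i \<tau>) = indicator {s<..t} \<tau>"
      unfolding I_def using sum_indicator_grid[where g=g and n=n and \<tau>=\<tau>] gmono g0n by simp
    have close: "\<bar>(LINT x|M. v \<tau> x * f a x) - ?c\<bar> \<le> e * ?L" if "a \<in> {0..T}" "\<bar>a - \<tau>\<bar> < \<delta>" for a
    proof -
      have "(LINT x|M. v \<tau> x * f a x) - ?c = (LINT x|M. v \<tau> x * (f a x - f \<tau> x))"
        using Lspace2_mult_integrable[OF v f_Lspace2[OF that(1)]] Lspace2_mult_integrable[OF v f_Lspace2[OF \<tau>]]
        by (simp add: right_diff_distrib)
      also have "\<bar>\<dots>\<bar> \<le> ?L * Lnorm 2 M (\<lambda>x. f a x - f \<tau> x)"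
        by (rule pairing_le[OF v Lspace2_diff[OF f_Lspace2[OF that(1)] f_Lspace2[OF \<tau>]]])
      also have "\<dots> \<le> ?L * e"
        using \<delta>(2)[OF that(1) \<tau> that(2)] by (intro mult_left_mono Lnorm_nonneg) simp
      finally show ?thesis by (simp add: mult.commute)
    qed
    \<comment> \<open>On its own cell, \<open>\<tau>\<close> is within \<open>\<delta>\<close> of
      both nodes, so each of the two pairings in \<open>q i \<tau>\<close> is off by at most
      \<open>e * ?L\<close>. On the other cells the indicator is zero.\<close>
    have bnd: "\<bar>I i \<tau> * (q i \<tau> - 2 * ?c)\<bar> \<le> I i \<tau> * (2 * e * ?L)" if i: "i < n" for i
    proof (cases "\<tau> \<in> {g i<..g (Suc i)}")
      case True
      then have ab: "\<bar>g (Suc i) - \<tau>\<bar> < \<delta>" "\<bar>g i - \<tau>\<bar> \<le> d" using d gS[of i] by auto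
      have "\<bar>g i - \<tau>\<bar> < \<delta>" using ab(2) d(2) by simp
      with ab(1) have "\<bar>q i \<tau> - 2 * ?c\<bar> \<le> 2 * e * ?L"
        unfolding q_def using close[OF gT(1), of "Suc i"] close[OF gT(1), of i] i by (simp add: abs_le_iff)
      then show ?thesis using True by (simp add: I_def)
    qed (simp add: I_def)
    have "p \<tau> - 2 * (indicator {s<..t} \<tau> * ?c) = (\<Sum>i<n. I i \<tau> * (q i \<tau> - 2 * ?c))"
      unfolding p_def sumI[symmetric]
      by (simp add: right_diff_distrib sum_subtractf sum_distrib_right sum_distrib_left mult_ac)
    also have "\<bar>\<dots>\<bar> \<le> (\<Sum>i<n. \<bar>I i \<tau> * (q i \<tau> - 2 * ?c)\<bar>)" by (rule sum_abs)
    also have "\<dots> \<le> (\<Sum>i<n. I i \<tau> * (2 * e * ?L))" using bnd by (intro sum_mono) simp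
    also have "\<dots> = indicator {s<..t} \<tau> * (2 * e * ?L)" by (simp add: sum_distrib_right[symmetric] sumI)
    also have "\<dots> \<le> 2 * e * ?L" using e Lnorm_nonneg[of 2 M "v \<tau>"] by (simp add: indicator_def)
    finally show ?case .
  qed
  with intp eq show ?thesis by blast
qed

end

section \<open>Power estimates and approximation by test functions\<close>

text \<open>\<open>w\<close> times a cutoff is a test function. The cutoffs tend to 1 almost
  everywhere, and the squared errors are dominated by the square of \<open>w\<close>.\<close>

lemma (in bounded_borel_measure) smooth_test_function_approx:
  assumes U: "open U" "AE x in M. x \<in> U" and sm: "smooth w" and e: "e > 0"
  shows "\<exists>\<psi>. test_function U \<psi> \<and> Lnorm 2 M (\<lambda>x. \<psi> x - w x) < e"
proof -
  obtain \<zeta> :: "nat \<Rightarrow> 'a \<Rightarrow> real" where \<zeta>: "\<And>k. test_function U (\<zeta> k)" "\<And>k x. 0 \<le> \<zeta> k x"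
    "\<And>k x. \<zeta> k x \<le> 1" "\<And>x. (\<lambda>k. \<zeta> k x) \<longlonglongrightarrow> indicator U x"
    by (rule test_functions_converge_to_indicator[OF U(1)]) (rule that)
  have w2: "w \<in> Lspace 2 M" by (rule smooth_Lspace2[OF sm])
  have t: "test_function U (\<lambda>x. w x * \<zeta> k x)" for k by (rule test_function_mult[OF sm \<zeta>(1)])
  have d2: "(\<lambda>x. w x * \<zeta> k x - w x) \<in> Lspace 2 M" for k
    by (rule Lspace2_diff[OF test_function_Lspace2[OF t] w2])
  have "(\<lambda>k. LINT x|M. (norm (w x * \<zeta> k x - w x))\<^sup>2) \<longlonglongrightarrow> (LINT x|M. 0)"
  proof (rule integral_dominated_convergence)
    show "integrable M (\<lambda>x. (norm (w x))\<^sup>2)" using w2 by (simp add: Lspace2_iff)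
    show "(\<lambda>x. (norm (w x * \<zeta> k x - w x))\<^sup>2) \<in> borel_measurable M" for k
      using Lspace2_measurable[OF d2] by (intro borel_measurable_power) simp
    show "AE x in M. (\<lambda>k. (norm (w x * \<zeta> k x - w x))\<^sup>2) \<longlonglongrightarrow> 0"
      using U(2)
    proof eventually_elim
      case (elim x)
      have "(\<lambda>k. (norm (w x * \<zeta> k x - w x))\<^sup>2) \<longlonglongrightarrow> (norm (w x * indicator U x - w x))\<^sup>2"
        by (rule tendsto_power[OF tendsto_norm[OF tendsto_diff[OF tendsto_mult[OF tendsto_const \<zeta>(4)] tendsto_const]]])
      then show ?case using elim by simp
    qed
    show "AE x in M. norm ((norm (w x * \<zeta> k x - w x))\<^sup>2) \<le> (norm (w x))\<^sup>2" for k
    proof (rule AE_I2)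
      fix x
      have "w x * \<zeta> k x - w x = w x * (\<zeta> k x - 1)" by (simp add: algebra_simps)
      moreover have "\<bar>\<zeta> k x - 1\<bar> \<le> 1" using \<zeta>(2)[of k x] \<zeta>(3)[of k x] by simp
      ultimately have "norm (w x * \<zeta> k x - w x) \<le> norm (w x)" by (simp add: abs_mult mult_left_le)
      then show "norm ((norm (w x * \<zeta> k x - w x))\<^sup>2) \<le> (norm (w x))\<^sup>2"
        by (simp add: power_mono abs_le_square_iff[symmetric])
    qed
  qed simp
  then have "(\<lambda>k. sqrt (LINT x|M. (norm (w x * \<zeta> k x - w x))\<^sup>2)) \<longlonglongrightarrow> 0"
    using tendsto_real_sqrt[of _ 0] by simp
  then have "\<forall>\<^sub>F k in sequentially. Lnorm 2 M (\<lambda>x. w x * \<zeta> k x - w x) < e"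
    unfolding Lnorm2_eq[symmetric] by (rule order_tendstoD) (rule e)
  then obtain k where "Lnorm 2 M (\<lambda>x. w x * \<zeta> k x - w x) < e"
    by (auto simp: eventually_sequentially)
  with t show ?thesis by blast
qed

lemma (in bounded_borel_measure) test_function_approx:
  assumes U: "open U" "AE x in M. x \<in> U" and w: "w \<in> Lspace 2 M"
    and v: "\<And>k. smooth (v k)" "(\<lambda>k. Lnorm 2 M (\<lambda>x. v k x - w x)) \<longlonglongrightarrow> 0" and e: "e > 0"
  shows "\<exists>\<psi>. test_function U \<psi> \<and> Lnorm 2 M (\<lambda>x. \<psi> x - w x) < e"
proof -
  have "\<forall>\<^sub>F k in sequentially. Lnorm 2 M (\<lambda>x. v k x - w x) < e / 2"
    using v(2) by (rule order_tendstoD) (use e in simp)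
  then obtain k where k: "Lnorm 2 M (\<lambda>x. v k x - w x) < e / 2" by (auto simp: eventually_sequentially)
  obtain \<psi> where \<psi>: "test_function U \<psi>" "Lnorm 2 M (\<lambda>x. \<psi> x - v k x) < e / 2"
    using smooth_test_function_approx[OF U v(1)[of k], of "e / 2"] e by auto
  have "Lnorm 2 M (\<lambda>x. (\<psi> x - v k x) + (v k x - w x)) \<le>
      Lnorm 2 M (\<lambda>x. \<psi> x - v k x) + Lnorm 2 M (\<lambda>x. v k x - w x)"
    by (intro Lnorm2_triangle Lspace2_diff w smooth_Lspace2 v(1) test_function_Lspace2[OF \<psi>(1)])
  then have "Lnorm 2 M (\<lambda>x. \<psi> x - w x) < e" using k \<psi>(2) by simp
  with \<psi>(1) show ?thesis by blast
qed

section \<open>The power nonlinearity and the differential inequality\<close>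

lemma Lnorm_powr:
  assumes "p > 0" shows "Lnorm p M f powr p = (LINT x|M. norm (f x) powr p)"
  using assms by (simp add: Lnorm_def powr_powr integral_nonneg_AE)

text \<open>Comparing \<open>b\<close> with \<open>\<epsilon> * a\<close> makes one of the two terms
  on the right sufficient by itself. The constants are not sharp, but only the freedom in
  \<open>\<epsilon>\<close> matters.\<close>

lemma Young_scaled:
  fixes a b :: real
  assumes "a \<ge> 0" "b \<ge> 0" "\<epsilon> > 0" "p > 1"
  shows "a powr (p - 1) * b \<le> \<epsilon> * a powr p + \<epsilon> powr (1 - p) * b powr p"
proof (cases "b \<le> \<epsilon> * a")
  case True
  have "a powr (p - 1) * b \<le> a powr (p - 1) * (\<epsilon> * a)"
    using True by (intro mult_left_mono) auto
  also have "\<dots> = \<epsilon> * (a * a powr (p - 1))" by simp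
  also have "\<dots> = \<epsilon> * a powr p" using assms by (simp add: powr_mult_base)
  finally show ?thesis by (simp add: add_increasing2)
next
  case False
  then have "a \<le> b / \<epsilon>" using assms by (simp add: field_simps)
  then have "a powr (p - 1) * b \<le> (b / \<epsilon>) powr (p - 1) * b"
    using assms by (intro mult_right_mono powr_mono2) auto
  also have "\<dots> = \<epsilon> powr (1 - p) * (b * b powr (p - 1))"
    using assms powr_minus_divide[of \<epsilon> "p - 1"] by (simp add: powr_divide)
  also have "\<dots> = \<epsilon> powr (1 - p) * b powr p" using assms by (simp add: powr_mult_base)
  finally show ?thesis using assms by (simp add: add_increasing)
qed

lemma power_pairing_bound:
  fixes w h :: "'a \<Rightarrow> real"
  assumes p: "p > 1" and w: "w \<in> Lspace p M" and h: "h \<in> Lspace p M" and \<epsilon>: "\<epsilon> > 0"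
  shows "integrable M (\<lambda>x. \<bar>w x\<bar> powr (p - 2) * w x * h x)"
    and "\<bar>LINT x|M. \<bar>w x\<bar> powr (p - 2) * w x * h x\<bar> \<le>
      \<epsilon> * Lnorm p M w powr p + \<epsilon> powr (1 - p) * Lnorm p M h powr p"
proof -
  have wi: "integrable M (\<lambda>x. \<bar>w x\<bar> powr p)" and hi: "integrable M (\<lambda>x. \<bar>h x\<bar> powr p)"
    and wm[measurable]: "w \<in> borel_measurable M" and hm[measurable]: "h \<in> borel_measurable M"
    using w h by (auto simp: Lspace_def)
  have bnd: "norm (\<bar>w x\<bar> powr (p - 2) * w x * h x) \<le> r * \<bar>w x\<bar> powr p + r powr (1 - p) * \<bar>h x\<bar> powr p"
    if "r > 0" for x r
  proof -
    have "norm (\<bar>w x\<bar> powr (p - 2) * w x * h x) = (\<bar>w x\<bar> * \<bar>w x\<bar> powr (p - 2)) * \<bar>h x\<bar>"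
      by (simp add: abs_mult)
    also have "\<dots> = \<bar>w x\<bar> powr (p - 1) * \<bar>h x\<bar>" by (simp add: powr_mult_base)
    finally show ?thesis using Young_scaled[of "\<bar>w x\<bar>" "\<bar>h x\<bar>" r p] that p by simp
  qed
  have ri: "integrable M (\<lambda>x. r * \<bar>w x\<bar> powr p + r powr (1 - p) * \<bar>h x\<bar> powr p)" for r
    using wi hi by simp
  show i: "integrable M (\<lambda>x. \<bar>w x\<bar> powr (p - 2) * w x * h x)"
  proof (rule Bochner_Integration.integrable_bound[OF ri[of \<epsilon>]])
    show "AE x in M. norm (\<bar>w x\<bar> powr (p - 2) * w x * h x) \<le>
        norm (\<epsilon> * \<bar>w x\<bar> powr p + \<epsilon> powr (1 - p) * \<bar>h x\<bar> powr p)"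
      unfolding real_norm_def[of "_ + _"] by (intro AE_I2 order_trans[OF bnd[OF \<epsilon>] abs_ge_self])
  qed measurable
  have "\<bar>LINT x|M. \<bar>w x\<bar> powr (p - 2) * w x * h x\<bar> \<le> (LINT x|M. \<bar>\<bar>w x\<bar> powr (p - 2) * w x * h x\<bar>)"
    by (rule integral_abs_bound)
  also have "\<dots> \<le> (LINT x|M. \<epsilon> * \<bar>w x\<bar> powr p + \<epsilon> powr (1 - p) * \<bar>h x\<bar> powr p)"
    using i ri bnd[OF \<epsilon>] by (intro integral_mono) auto
  also have "\<dots> = \<epsilon> * Lnorm p M w powr p + \<epsilon> powr (1 - p) * Lnorm p M h powr p"
    using wi hi p by (simp add: Lnorm_powr)
  finally show "\<bar>LINT x|M. \<bar>w x\<bar> powr (p - 2) * w x * h x\<bar> \<le>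
      \<epsilon> * Lnorm p M w powr p + \<epsilon> powr (1 - p) * Lnorm p M h powr p" .
qed

text \<open>The pairing of \<open>w\<close> with itself is the limit value, and the difference is a
  pairing with \<open>\<phi> k - w\<close>. The scaled Young bound takes the place of Hoelder's
  inequality: \<open>\<epsilon>\<close> is fixed before \<open>k\<close> tends to infinity.\<close>

lemma power_pairing_tendsto:
  fixes w :: "'a \<Rightarrow> real"
  assumes p: "p > 1" and w: "w \<in> Lspace p M" and \<phi>: "\<And>k. (\<lambda>x. \<phi> k x - w x) \<in> Lspace p M"
    and lim: "(\<lambda>k. Lnorm p M (\<lambda>x. \<phi> k x - w x) powr p) \<longlonglongrightarrow> 0"
  shows "(\<lambda>k. LINT x|M. \<bar>w x\<bar> powr (p - 2) * w x * \<phi> k x) \<longlonglongrightarrow> Lnorm p M w powr p"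
proof -
  let ?I = "\<lambda>h. LINT x|M. \<bar>w x\<bar> powr (p - 2) * w x * h x"
  note int = power_pairing_bound(1)[OF p w _ zero_less_one]
  have self: "?I w = Lnorm p M w powr p"
  proof -
    have "\<bar>w x\<bar> powr (p - 2) * w x * w x = \<bar>w x\<bar> powr p" for x
    proof -
      have "\<bar>w x\<bar> powr (p - 2) * w x * w x = \<bar>w x\<bar> * (\<bar>w x\<bar> * \<bar>w x\<bar> powr (p - 2))"
        by (simp add: power2_eq_square[symmetric])
      also have "\<dots> = \<bar>w x\<bar> powr p" by (simp add: powr_mult_base)
      finally show ?thesis .
    qed
    then show ?thesis using p by (simp add: Lnorm_powr)
  qed
  have diff: "?I (\<phi> k) - ?I w = ?I (\<lambda>x. \<phi> k x - w x)" for k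
  proof -
    have "?I (\<lambda>x. \<phi> k x - w x) + ?I w = ?I (\<phi> k)"
      using int[OF \<phi>[of k]] int[OF w]
      by (subst Bochner_Integration.integral_add[symmetric]) (simp_all add: algebra_simps)
    then show ?thesis by simp
  qed
  have "(\<lambda>k. ?I (\<lambda>x. \<phi> k x - w x)) \<longlonglongrightarrow> 0"
  proof (rule LIMSEQ_I)
    fix r :: real assume r: "r > 0"
    define W where "W = Lnorm p M w powr p"
    \<comment> \<open>Makes \<open>\<epsilon> * W\<close> less than \<open>r / 2\<close>; the added
      1 covers \<open>W = 0\<close>.\<close>
    define \<epsilon> where "\<epsilon> = r / (2 * (W + 1))"
    have W: "W \<ge> 0" by (simp add: W_def)
    then have \<epsilon>: "\<epsilon> > 0" "\<epsilon> * W < r / 2" using r by (auto simp: \<epsilon>_def field_simps)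
    have "(\<lambda>k. \<epsilon> powr (1 - p) * Lnorm p M (\<lambda>x. \<phi> k x - w x) powr p) \<longlonglongrightarrow> 0"
      using tendsto_mult[OF tendsto_const lim] by simp
    then have "\<forall>\<^sub>F k in sequentially. \<epsilon> powr (1 - p) * Lnorm p M (\<lambda>x. \<phi> k x - w x) powr p < r / 2"
      by (rule order_tendstoD) (use r in simp)
    then obtain N where N: "\<And>k. k \<ge> N \<Longrightarrow> \<epsilon> powr (1 - p) * Lnorm p M (\<lambda>x. \<phi> k x - w x) powr p < r / 2"
      unfolding eventually_sequentially by blast
    show "\<exists>N. \<forall>k\<ge>N. norm (?I (\<lambda>x. \<phi> k x - w x) - 0) < r"
    proof (intro exI[of _ N] allI impI)
      fix k assume "k \<ge> N"
      show "norm (?I (\<lambda>x. \<phi> k x - w x) - 0) < r"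
        using power_pairing_bound(2)[OF p w \<phi>[of k] \<epsilon>(1)] N[OF \<open>k \<ge> N\<close>] \<epsilon>(2)
        by (simp add: W_def)
    qed
  qed
  then show ?thesis unfolding diff[symmetric] self[symmetric] by (rule LIM_zero_cancel)
qed

text \<open>From \<open>G\<^sup>2 < P\<close> one gets
  \<open>G powr \<beta> \<le> P powr (\<beta> / 2)\<close>. As \<open>\<beta> < 2\<close>, this
  power moves to the left and leaves \<open>P powr (1 - \<beta> / 2)\<close>, and raising to
  \<open>2 / (2 - \<beta>)\<close> isolates \<open>P\<close>. If \<open>A\<close> were 0, the
  interpolation bound would force \<open>P \<le> 0\<close>.\<close>

lemma unstable_power_bound:
  fixes A G P :: real
  assumes "0 \<le> A" "0 \<le> G" "0 < S" "0 \<le> \<beta>" "\<beta> < 2" "0 < \<alpha>"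
    and K: "G\<^sup>2 < P" and GN: "P \<le> S * A powr \<alpha> * G powr \<beta>"
  shows "P \<le> S powr (2 / (2 - \<beta>)) * A\<^sup>2 powr (\<alpha> / (2 - \<beta>))" and "0 < A"
proof -
  have P: "P > 0" using K zero_le_power2[of G] by linarith
  show A: "0 < A" using GN P assms(1,6) by (cases "A = 0") auto
  have "G = sqrt (G\<^sup>2)" using assms(2) by simp
  also have "\<dots> \<le> sqrt P" using K by (intro real_sqrt_le_mono) simp
  finally have "G powr \<beta> \<le> (sqrt P) powr \<beta>" using assms by (intro powr_mono2)
  also have "\<dots> = P powr (\<beta> / 2)" using P by (simp add: powr_half_sqrt[symmetric] powr_powr)
  finally have "P \<le> S * A powr \<alpha> * P powr (\<beta> / 2)"
    using GN assms(3) by (meson mult_left_mono mult_nonneg_nonneg order_less_imp_le order_trans powr_ge_zero)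
  then have "P powr (1 - \<beta> / 2) \<le> S * A powr \<alpha>"
    using P unfolding powr_diff by (simp add: divide_le_eq mult.assoc)
  then have "(P powr (1 - \<beta> / 2)) powr (2 / (2 - \<beta>)) \<le> (S * A powr \<alpha>) powr (2 / (2 - \<beta>))"
    using assms by (intro powr_mono2) auto
  also have "(P powr (1 - \<beta> / 2)) powr (2 / (2 - \<beta>)) = P"
  proof -
    have "(1 - \<beta> / 2) * (2 / (2 - \<beta>)) = 1" using assms(5) by (simp add: field_simps)
    then show ?thesis using P by (simp add: powr_powr)
  qed
  also have "(S * A powr \<alpha>) powr (2 / (2 - \<beta>)) = S powr (2 / (2 - \<beta>)) * A powr (2 * (\<alpha> / (2 - \<beta>)))"
    using assms A by (simp add: powr_mult powr_powr mult.commute)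
  also have "A powr (2 * (\<alpha> / (2 - \<beta>))) = A\<^sup>2 powr (\<alpha> / (2 - \<beta>))"
    using A unfolding powr_powr[symmetric] by (simp add: powr_numeral)
  finally show "P \<le> S powr (2 / (2 - \<beta>)) * A\<^sup>2 powr (\<alpha> / (2 - \<beta>))" .
qed

text \<open>\<open>L\<close> need not be differentiable. Its integral majorant \<open>G\<close> is,
  it has the same value at \<open>s\<close>, and its derivative \<open>c * L powr a\<close> is at
  most \<open>c * G powr a\<close>. So \<open>G powr (1 - a)\<close> plus the linear term
  \<open>(a - 1) * c * \<tau>\<close> is nondecreasing.\<close>

lemma power_growth_comparison:
  fixes L :: "real \<Rightarrow> real"
  assumes st: "s < t" and a: "a > 1" and c: "c \<ge> 0" and cont: "continuous_on {s..t} L"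
    and pos: "\<And>\<tau>. \<tau> \<in> {s..t} \<Longrightarrow> L \<tau> > 0"
    and growth: "\<And>\<tau>. \<tau> \<in> {s<..t} \<Longrightarrow> L \<tau> - L s \<le> integral {s..\<tau>} (\<lambda>r. c * L r powr a)"
  shows "L s powr (1 - a) - L t powr (1 - a) \<le> (a - 1) * c * (t - s)"
proof -
  let ?h = "\<lambda>r. c * L r powr a"
  define G where "G \<tau> = L s + integral {s..\<tau>} ?h" for \<tau>
  have ch: "continuous_on {s..t} ?h"
    using pos by (intro continuous_intros cont) force
  have GL: "L \<tau> \<le> G \<tau>" if "\<tau> \<in> {s..t}" for \<tau>
    using growth[of \<tau>] that by (cases "\<tau> = s") (auto simp: G_def)
  have Gpos: "G \<tau> > 0" if "\<tau> \<in> {s..t}" for \<tau> using GL[OF that] pos[OF that] by linarith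
  have dG: "(G has_real_derivative ?h \<tau>) (at \<tau> within {s..t})" if "\<tau> \<in> {s..t}" for \<tau>
    unfolding G_def using DERIV_add[OF DERIV_const[of "L s"] integral_has_real_derivative[OF ch that]] by simp
  define H where "H \<tau> = G \<tau> powr (1 - a) + (a - 1) * c * \<tau>" for \<tau>
  define H' where "H' \<tau> = (1 - a) * G \<tau> powr (- a) * ?h \<tau> + (a - 1) * c" for \<tau>
  have dH: "(H has_real_derivative H' \<tau>) (at \<tau> within {s..t})" if "\<tau> \<in> {s..t}" for \<tau>
  proof -
    have "((\<lambda>\<tau>. G \<tau> powr (1 - a)) has_real_derivative (1 - a) * G \<tau> powr (- a) * ?h \<tau>) (at \<tau> within {s..t})"
      using DERIV_chain2[OF has_real_derivative_powr[OF Gpos[OF that], of "1 - a"] dG[OF that]] by simp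
    moreover have "((\<lambda>\<tau>. (a - 1) * c * \<tau>) has_real_derivative (a - 1) * c) (at \<tau> within {s..t})"
      by (auto intro!: derivative_eq_intros)
    ultimately show ?thesis unfolding H_def H'_def by (rule DERIV_add)
  qed
  have H'0: "H' \<tau> \<ge> 0" if "\<tau> \<in> {s..t}" for \<tau>
  proof -
    have "L \<tau> powr a \<le> G \<tau> powr a" using GL[OF that] pos[OF that] a by (intro powr_mono2) auto
    then have "G \<tau> powr (- a) * L \<tau> powr a \<le> 1"
      using Gpos[OF that] by (simp add: powr_minus field_simps)
    then have "(a - 1) * c * (G \<tau> powr (- a) * L \<tau> powr a) \<le> (a - 1) * c * 1"
      using a c by (intro mult_left_mono) auto
    then show ?thesis unfolding H'_def by (simp add: algebra_simps)
  qed
  have "H s \<le> H t"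
  proof (rule DERIV_nonneg_imp_increasing_open[of s t H])
    fix \<tau> assume \<tau>: "s < \<tau>" "\<tau> < t"
    have "(H has_real_derivative H' \<tau>) (at \<tau>)"
      using dH[of \<tau>] \<tau> at_within_Icc_at[of s \<tau> t] by simp
    then show "\<exists>y. (H has_real_derivative y) (at \<tau>) \<and> 0 \<le> y" using H'0[of \<tau>] \<tau> by auto
  next
    show "continuous_on {s..t} H" using dH by (rule DERIV_continuous_on)
  qed (use st in simp)
  \<comment> \<open>The exponent is negative, so \<open>L t \<le> G t\<close> is reversed in the
    direction needed.\<close>
  moreover have "G t powr (1 - a) \<le> L t powr (1 - a)"
    using GL[of t] pos[of t] st a by (intro powr_mono2') auto
  ultimately show ?thesis by (simp add: H_def G_def algebra_simps)
qed

section \<open>The energy of a weak solution\<close>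

lemma Lnorm2_continuous_on:
  assumes "\<And>t. t \<in> S \<Longrightarrow> f t \<in> Lspace 2 M"
    and "\<And>t. t \<in> S \<Longrightarrow> ((\<lambda>s. Lnorm 2 M (\<lambda>x. f s x - f t x)) \<longlongrightarrow> 0) (at t within S)"
  shows "continuous_on S (\<lambda>t::real. Lnorm 2 M (f t))"
  unfolding continuous_on_def
proof
  fix t assume t: "t \<in> S"
  have "\<forall>\<^sub>F s in at t within S. norm (Lnorm 2 M (f s) - Lnorm 2 M (f t)) \<le> Lnorm 2 M (\<lambda>x. f s x - f t x)"
    unfolding eventually_at_filter real_norm_def
    by (intro always_eventually allI impI Lnorm2_triangle_rev assms(1) t)
  then have "((\<lambda>s. Lnorm 2 M (f s) - Lnorm 2 M (f t)) \<longlongrightarrow> 0) (at t within S)"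
    using assms(2)[OF t] by (rule Lim_null_comparison)
  then show "((\<lambda>s. Lnorm 2 M (f s)) \<longlongrightarrow> Lnorm 2 M (f t)) (at t within S)"
    by (rule LIM_zero_cancel)
qed

text \<open>Passes from the restricted Lebesgue integrals in the increment formulas to the gauge
  integral in the comparison lemma.\<close>

lemma integral_leb_on_interval:
  fixes F :: "real \<Rightarrow> real"
  assumes F: "continuous_on {0..T} F" and st: "0 < s" "s < t" "t < T"
  shows "integrable (leb_on {0<..<T}) (\<lambda>\<tau>. indicator {s<..t} \<tau> * F \<tau>)"
    and "(LINT \<tau>|leb_on {0<..<T}. indicator {s<..t} \<tau> * F \<tau>) = integral {s..t} F"
proof -
  have i: "integrable lborel (\<lambda>\<tau>. indicator {s..t} \<tau> *\<^sub>R F \<tau>)"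
    using st by (intro borel_integrable_compact continuous_on_subset[OF F]) auto
  from integrable_mult_indicator[OF _ this, of "{s<..t}"]
  have i2: "integrable lborel (\<lambda>\<tau>. indicator {s<..t} \<tau> *\<^sub>R indicator {s..t} \<tau> *\<^sub>R F \<tau>)" by simp
  have eq: "(\<lambda>\<tau>. indicator {0<..<T} \<tau> *\<^sub>R (indicator {s<..t} \<tau> * F \<tau>)) = (\<lambda>\<tau>. indicator {s<..t} \<tau> *\<^sub>R indicator {s..t} \<tau> *\<^sub>R F \<tau>)"
    using st by (intro ext) (auto simp: indicator_def)
  show "integrable (leb_on {0<..<T}) (\<lambda>\<tau>. indicator {s<..t} \<tau> * F \<tau>)"
    by (subst integrable_restrict_space) (simp_all only: eq i2, simp_all)
  have "(LINT \<tau>|leb_on {0<..<T}. indicator {s<..t} \<tau> * F \<tau>) =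
      (LINT \<tau>|lborel. indicator {s<..t} \<tau> *\<^sub>R indicator {s..t} \<tau> *\<^sub>R F \<tau>)"
    by (subst integral_restrict_space) (simp_all only: eq, simp_all)
  also have "\<dots> = (LINT \<tau>|lborel. indicator {s..t} \<tau> *\<^sub>R F \<tau>)"
  proof (rule integral_cong_AE)
    show "AE \<tau> in lborel. indicator {s<..t} \<tau> *\<^sub>R indicator {s..t} \<tau> *\<^sub>R F \<tau> = indicator {s..t} \<tau> *\<^sub>R F \<tau>"
      using AE_lborel_singleton[of s] by eventually_elim (auto simp: indicator_def)
  qed (use borel_measurable_integrable[OF i] borel_measurable_integrable[OF i2] in simp_all)
  also have "\<dots> = integral {s..t} F"
    using set_borel_integral_eq_integral(2)[of "{s..t}" F] i
    by (simp add: set_integrable_def set_lebesgue_integral_def)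
  finally show "(LINT \<tau>|leb_on {0<..<T}. indicator {s<..t} \<tau> * F \<tau>) = integral {s..t} F" .
qed

section \<open>Boundary integrals, the tested equation and growth of the energy\<close>

context C1_domain
begin

lemma H1_0_smooth_approx:
  assumes "w \<in> H1_0 \<Omega> \<sigma> \<Gamma>\<^sub>0"
  obtains v where "\<And>k. smooth (v k)" "(\<lambda>k. Lnorm 2 (leb_on \<Omega>) (\<lambda>x. v k x - w x)) \<longlonglongrightarrow> 0"
    "(\<lambda>k. Lnorm 2 \<sigma> (\<lambda>x. v k x - boundary_trace \<Omega> \<sigma> w x)) \<longlonglongrightarrow> 0"
proof -
  obtain v where v: "\<And>k. smooth (v k)" "(\<lambda>k. H1norm \<Omega> (\<lambda>x. v k x - w x)) \<longlonglongrightarrow> 0"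
      "(\<lambda>k. Lnorm 2 \<sigma> (\<lambda>x. v k x - boundary_trace \<Omega> \<sigma> w x)) \<longlonglongrightarrow> 0"
    using H1_0D(2)[OF assms] unfolding has_trace_def by blast
  show thesis
    by (rule that[OF v(1) H1_approx_tendsto(1)[OF H1_0D(1)[OF assms] v(1,2)] v(3)])
qed

lemma AE_boundary_indicator:
  assumes "w \<in> H1_0 \<Omega> \<sigma> \<Gamma>\<^sub>0" "\<Gamma>\<^sub>0 \<union> \<Gamma>\<^sub>1 = frontier \<Omega>"
  shows "AE x in \<sigma>. indicator \<Gamma>\<^sub>1 x * boundary_trace \<Omega> \<sigma> w x = boundary_trace \<Omega> \<sigma> w x"
  using AE_frontier H1_0D(3)[OF assms(1)]
proof eventually_elim
  case (elim x)
  then show ?case using assms(2) by (cases "x \<in> \<Gamma>\<^sub>1") auto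
qed

text \<open>\<open>\<sigma>\<close> is concentrated on the boundary and the trace vanishes on
  \<open>\<Gamma>\<^sub>0\<close>. This reconciles the weak formulation, which integrates over
  \<open>\<Gamma>\<^sub>1\<close>, with the time derivative of the trace, which lives on the whole
  boundary.\<close>

lemma boundary_pairing:
  assumes w: "w \<in> H1_0 \<Omega> \<sigma> \<Gamma>\<^sub>0" and \<Gamma>: "\<Gamma>\<^sub>0 \<union> \<Gamma>\<^sub>1 = frontier \<Omega>" "\<Gamma>\<^sub>1 \<in> sets \<sigma>"
    and h: "h \<in> borel_measurable \<sigma>"
  shows "(LINT x|restrict_space \<sigma> \<Gamma>\<^sub>1. h x * boundary_trace \<Omega> \<sigma> w x) = (LINT x|\<sigma>. h x * boundary_trace \<Omega> \<sigma> w x)"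
proof -
  have [measurable]: "boundary_trace \<Omega> \<sigma> w \<in> borel_measurable \<sigma>" "h \<in> borel_measurable \<sigma>" "\<Gamma>\<^sub>1 \<in> sets \<sigma>"
    using Lspace2_measurable[OF H1_0D(4)[OF w]] h \<Gamma> by auto
  have "(LINT x|restrict_space \<sigma> \<Gamma>\<^sub>1. h x * boundary_trace \<Omega> \<sigma> w x) =
      (LINT x|\<sigma>. indicator \<Gamma>\<^sub>1 x *\<^sub>R (h x * boundary_trace \<Omega> \<sigma> w x))"
    using \<Gamma>(2) by (intro integral_restrict_space) auto
  also have "\<dots> = (LINT x|\<sigma>. h x * boundary_trace \<Omega> \<sigma> w x)"
  proof (rule integral_cong_AE)
    show "AE x in \<sigma>. indicator \<Gamma>\<^sub>1 x *\<^sub>R (h x * boundary_trace \<Omega> \<sigma> w x) = h x * boundary_trace \<Omega> \<sigma> w x"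
      using AE_boundary_indicator[OF w \<Gamma>(1)] by eventually_elim (auto simp: indicator_def)
  qed measurable
  finally show ?thesis .
qed

lemma boundary_Lnorm:
  assumes w: "w \<in> H1_0 \<Omega> \<sigma> \<Gamma>\<^sub>0" and \<Gamma>: "\<Gamma>\<^sub>0 \<union> \<Gamma>\<^sub>1 = frontier \<Omega>" "\<Gamma>\<^sub>1 \<in> sets \<sigma>"
  shows "Lnorm 2 (restrict_space \<sigma> \<Gamma>\<^sub>1) (boundary_trace \<Omega> \<sigma> w) = Lnorm 2 \<sigma> (boundary_trace \<Omega> \<sigma> w)"
  using boundary_pairing[OF w \<Gamma> Lspace2_measurable[OF H1_0D(4)[OF w]]]
  by (simp add: Lnorm2_eq power2_eq_square)

lemma boundary_trace_diff_le:
  "\<exists>C\<ge>0. \<forall>\<Gamma>\<^sub>0 w w'. w \<in> H1_0 \<Omega> \<sigma> \<Gamma>\<^sub>0 \<longrightarrow> w' \<in> H1_0 \<Omega> \<sigma> \<Gamma>\<^sub>0 \<longrightarrow>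
     (Lnorm 2 \<sigma> (\<lambda>x. boundary_trace \<Omega> \<sigma> w x - boundary_trace \<Omega> \<sigma> w' x))\<^sup>2 \<le>
     C * ((Lnorm 2 (leb_on \<Omega>) (\<lambda>x. w x - w' x))\<^sup>2 +
       Lnorm 2 (leb_on \<Omega>) (\<lambda>x. w x - w' x) * H1norm \<Omega> (\<lambda>x. w x - w' x))"
proof -
  obtain C where C: "C \<ge> 0" "\<And>w g. has_trace \<Omega> \<sigma> w g \<Longrightarrow> (Lnorm 2 \<sigma> g)\<^sup>2 \<le>
     C * ((Lnorm 2 (leb_on \<Omega>) w)\<^sup>2 + Lnorm 2 (leb_on \<Omega>) w * Lnorm 2 (leb_on \<Omega>) (weak_grad \<Omega> w))"
    using trace_inequality by blast
  show ?thesis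
  proof (intro exI[of _ C] conjI C(1) allI impI)
    fix \<Gamma>\<^sub>0 w w' assume w: "w \<in> H1_0 \<Omega> \<sigma> \<Gamma>\<^sub>0" "w' \<in> H1_0 \<Omega> \<sigma> \<Gamma>\<^sub>0"
    let ?d = "\<lambda>x. w x - w' x"
    have "(Lnorm 2 \<sigma> (\<lambda>x. boundary_trace \<Omega> \<sigma> w x - boundary_trace \<Omega> \<sigma> w' x))\<^sup>2 \<le>
       C * ((Lnorm 2 (leb_on \<Omega>) ?d)\<^sup>2 + Lnorm 2 (leb_on \<Omega>) ?d * Lnorm 2 (leb_on \<Omega>) (weak_grad \<Omega> ?d))"
      by (rule C(2)[OF has_trace_diff[OF H1_0D(2)[OF w(1)] H1_0D(2)[OF w(2)]]])
    also have "\<dots> \<le> C * ((Lnorm 2 (leb_on \<Omega>) ?d)\<^sup>2 + Lnorm 2 (leb_on \<Omega>) ?d * H1norm \<Omega> ?d)"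
      by (intro mult_left_mono add_left_mono Lnorm2_le_H1norm Lnorm_nonneg C(1))
    finally show "(Lnorm 2 \<sigma> (\<lambda>x. boundary_trace \<Omega> \<sigma> w x - boundary_trace \<Omega> \<sigma> w' x))\<^sup>2 \<le>
       C * ((Lnorm 2 (leb_on \<Omega>) ?d)\<^sup>2 + Lnorm 2 (leb_on \<Omega>) ?d * H1norm \<Omega> ?d)" .
  qed
qed

text \<open>In the interpolated inequality each term on the right carries a factor of the
  \<open>L\<^sup>2\<close> norm of the difference, so convergence in \<open>L\<^sup>2\<close>
  together with a mere bound in \<open>H\<^sup>1\<close> suffices.\<close>

lemma boundary_trace_tendsto:
  assumes w: "\<And>k. w k \<in> H1_0 \<Omega> \<sigma> \<Gamma>\<^sub>0" "w' \<in> H1_0 \<Omega> \<sigma> \<Gamma>\<^sub>0"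
    and lim: "((\<lambda>k. Lnorm 2 (leb_on \<Omega>) (\<lambda>x. w k x - w' x)) \<longlongrightarrow> 0) F"
    and bound: "\<And>k. H1norm \<Omega> (\<lambda>x. w k x - w' x) \<le> B"
  shows "((\<lambda>k. Lnorm 2 \<sigma> (\<lambda>x. boundary_trace \<Omega> \<sigma> (w k) x - boundary_trace \<Omega> \<sigma> w' x)) \<longlongrightarrow> 0) F"
proof -
  obtain C where C: "C \<ge> 0" "\<And>w w'. w \<in> H1_0 \<Omega> \<sigma> \<Gamma>\<^sub>0 \<Longrightarrow> w' \<in> H1_0 \<Omega> \<sigma> \<Gamma>\<^sub>0 \<Longrightarrow>
     (Lnorm 2 \<sigma> (\<lambda>x. boundary_trace \<Omega> \<sigma> w x - boundary_trace \<Omega> \<sigma> w' x))\<^sup>2 \<le>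
     C * ((Lnorm 2 (leb_on \<Omega>) (\<lambda>x. w x - w' x))\<^sup>2 +
       Lnorm 2 (leb_on \<Omega>) (\<lambda>x. w x - w' x) * H1norm \<Omega> (\<lambda>x. w x - w' x))"
    using boundary_trace_diff_le by blast
  let ?d = "\<lambda>k. Lnorm 2 (leb_on \<Omega>) (\<lambda>x. w k x - w' x)"
  have "norm (Lnorm 2 \<sigma> (\<lambda>x. boundary_trace \<Omega> \<sigma> (w k) x - boundary_trace \<Omega> \<sigma> w' x)) \<le>
      sqrt (C * ((?d k)\<^sup>2 + ?d k * B))" for k
  proof -
    have "(Lnorm 2 \<sigma> (\<lambda>x. boundary_trace \<Omega> \<sigma> (w k) x - boundary_trace \<Omega> \<sigma> w' x))\<^sup>2 \<le>
        C * ((?d k)\<^sup>2 + ?d k * H1norm \<Omega> (\<lambda>x. w k x - w' x))"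
      by (rule C(2)[OF w])
    also have "\<dots> \<le> C * ((?d k)\<^sup>2 + ?d k * B)"
      by (intro mult_left_mono add_left_mono bound Lnorm_nonneg C(1))
    finally show ?thesis by (simp add: Lnorm_nonneg real_le_rsqrt)
  qed
  then have "\<forall>\<^sub>F k in F. norm (Lnorm 2 \<sigma> (\<lambda>x. boundary_trace \<Omega> \<sigma> (w k) x - boundary_trace \<Omega> \<sigma> w' x)) \<le>
      sqrt (C * ((?d k)\<^sup>2 + ?d k * B))"
    by (intro always_eventually allI)
  moreover have "((\<lambda>k. sqrt (C * ((?d k)\<^sup>2 + ?d k * B))) \<longlongrightarrow> 0) F"
    using tendsto_real_sqrt[OF tendsto_mult[OF tendsto_const[of C] tendsto_add[OF tendsto_power[OF lim, of 2]
          tendsto_mult[OF lim tendsto_const[of B]]]]] by simp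
  ultimately show ?thesis by (rule Lim_null_comparison)
qed

text \<open>The weak formulation holds almost everywhere in time for each fixed test function. The values of
  the simple functions that approximate \<open>u\<close> form a countable set, so it holds simultaneously for all
  of them and, by continuity in \<open>H\<^sup>1\<close>, for \<open>u t\<close> itself.\<close>

lemma weak_formulation_solution:
  assumes \<Gamma>: "\<Gamma>\<^sub>0 \<union> \<Gamma>\<^sub>1 = frontier \<Omega>" "\<Gamma>\<^sub>1 \<in> sets \<sigma>" and p: "p > 1"
    and emb: "\<And>w. w \<in> H1_0 \<Omega> \<sigma> \<Gamma>\<^sub>0 \<Longrightarrow> w \<in> Lspace p (leb_on \<Omega>) \<and> Lnorm p (leb_on \<Omega>) w powr p \<le> K * H1norm \<Omega> w powr p"
    and u: "u \<in> Linf_H1_0 \<Omega> \<sigma> \<Gamma>\<^sub>0 T" "\<And>t. t \<in> {0<..<T} \<Longrightarrow> u t \<in> H1_0 \<Omega> \<sigma> \<Gamma>\<^sub>0"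
    and v2: "AE t in leb_on {0<..<T}. v t \<in> Lspace 2 (leb_on \<Omega>)"
    and z2: "AE t in leb_on {0<..<T}. z t \<in> Lspace 2 \<sigma>"
    and weak: "\<And>\<phi>. \<phi> \<in> H1_0 \<Omega> \<sigma> \<Gamma>\<^sub>0 \<Longrightarrow> AE t in leb_on {0<..<T}.
      (LINT x|leb_on \<Omega>. v t x * \<phi> x) +
      (LINT x|leb_on \<Omega>. weak_grad \<Omega> (u t) x \<bullet> weak_grad \<Omega> \<phi> x) +
      (LINT x|restrict_space \<sigma> \<Gamma>\<^sub>1. z t x * boundary_trace \<Omega> \<sigma> \<phi> x) =
      (LINT x|leb_on \<Omega>. \<bar>u t x\<bar> powr (p - 2) * u t x * \<phi> x)"
  shows "AE t in leb_on {0<..<T}.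
    (LINT x|leb_on \<Omega>. v t x * u t x) + (LINT x|\<sigma>. z t x * boundary_trace \<Omega> \<sigma> (u t) x) =
    Lnorm p (leb_on \<Omega>) (u t) powr p - (Lnorm 2 (leb_on \<Omega>) (weak_grad \<Omega> (u t)))\<^sup>2"
proof -
  let ?N = "leb_on {0<..<T} :: real measure"
  from u(1) obtain s :: "nat \<Rightarrow> real \<Rightarrow> 'a \<Rightarrow> real" where s: "\<And>k. simple_function ?N (s k)"
    "\<And>k t. t \<in> {0<..<T} \<Longrightarrow> s k t \<in> H1_0 \<Omega> \<sigma> \<Gamma>\<^sub>0"
    "AE t in ?N. (\<lambda>k. H1norm \<Omega> (\<lambda>x. s k t x - u t x)) \<longlonglongrightarrow> 0"
    unfolding Linf_H1_0_def by blast
  \<comment> \<open>All values of all approximating simple functions: a countable union of finite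
    sets, over which the exceptional null sets can be united.\<close>
  define D where "D = (\<Union>k. s k ` {0<..<T})"
  have "finite (s k ` {0<..<T})" for k
    using s(1)[of k] by (simp add: simple_function_def space_restrict_space)
  then have D: "countable D"
    unfolding D_def by (intro countable_UN[OF countableI_type] countable_finite)
  have "D \<subseteq> H1_0 \<Omega> \<sigma> \<Gamma>\<^sub>0" unfolding D_def using s(2) by auto
  then have "AE t in ?N. \<forall>\<phi>\<in>D. (LINT x|leb_on \<Omega>. v t x * \<phi> x) +
      (LINT x|leb_on \<Omega>. weak_grad \<Omega> (u t) x \<bullet> weak_grad \<Omega> \<phi> x) +
      (LINT x|restrict_space \<sigma> \<Gamma>\<^sub>1. z t x * boundary_trace \<Omega> \<sigma> \<phi> x) =
      (LINT x|leb_on \<Omega>. \<bar>u t x\<bar> powr (p - 2) * u t x * \<phi> x)"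
    unfolding AE_ball_countable[OF D] using weak by blast
  with s(3) v2 z2 AE_space show ?thesis
  proof eventually_elim
    case (elim t)
    then have t: "t \<in> {0<..<T}" by (simp add: space_restrict_space)
    define \<phi> where "\<phi> k = s k t" for k
    have \<phi>: "\<phi> k \<in> H1_0 \<Omega> \<sigma> \<Gamma>\<^sub>0" "\<phi> k \<in> D" for k
      unfolding \<phi>_def D_def using s(2) t by blast+
    note ut = u(2)[OF t]
    have lim: "(\<lambda>k. H1norm \<Omega> (\<lambda>x. \<phi> k x - u t x)) \<longlonglongrightarrow> 0" using elim(1) by (simp add: \<phi>_def)
    then obtain B where B: "\<And>k. H1norm \<Omega> (\<lambda>x. \<phi> k x - u t x) \<le> B"
      using convergent_imp_Bseq[OF convergentI[OF lim]] by (auto simp: Bseq_def abs_le_iff)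
    have z: "f \<longlonglongrightarrow> 0" if "\<And>k. 0 \<le> f k" "\<And>k. f k \<le> H1norm \<Omega> (\<lambda>x. \<phi> k x - u t x)" for f :: "nat \<Rightarrow> real"
      by (rule tendsto_sandwich[OF _ _ tendsto_const lim]) (use that in auto)
    have l0: "(\<lambda>k. Lnorm 2 (leb_on \<Omega>) (\<lambda>x. \<phi> k x - u t x)) \<longlonglongrightarrow> 0"
      by (rule z) (rule Lnorm_nonneg Lnorm2_le_H1norm)+
    have lg: "(\<lambda>k. Lnorm 2 (leb_on \<Omega>) (\<lambda>x. weak_grad \<Omega> (\<phi> k) x - weak_grad \<Omega> (u t) x)) \<longlonglongrightarrow> 0"
      unfolding H1_diff(3)[OF open_domain bounded_domain H1_0D(1)[OF \<phi>(1)] H1_0D(1)[OF ut], symmetric]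
      by (rule z) (rule Lnorm_nonneg Lnorm2_le_H1norm)+
    have lt: "(\<lambda>k. Lnorm 2 \<sigma> (\<lambda>x. boundary_trace \<Omega> \<sigma> (\<phi> k) x - boundary_trace \<Omega> \<sigma> (u t) x)) \<longlonglongrightarrow> 0"
      by (rule boundary_trace_tendsto[OF \<phi>(1) ut l0 B])
    \<comment> \<open>\<open>emb\<close> is applied to the difference, so convergence in
      \<open>H\<^sup>1\<close> gives convergence in \<open>L\<^sup>p\<close>, as the nonlinear term
      requires.\<close>
    have lp: "(\<lambda>k. Lnorm p (leb_on \<Omega>) (\<lambda>x. \<phi> k x - u t x) powr p) \<longlonglongrightarrow> 0"
    proof (rule Lim_null_comparison[OF always_eventually], rule allI)
      show "norm (Lnorm p (leb_on \<Omega>) (\<lambda>x. \<phi> k x - u t x) powr p) \<le> K * H1norm \<Omega> (\<lambda>x. \<phi> k x - u t x) powr p" for k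
        using emb[OF H1_0_diff[OF \<phi>(1) ut]] by simp
      have "(\<lambda>k. H1norm \<Omega> (\<lambda>x. \<phi> k x - u t x) powr p) \<longlonglongrightarrow> 0"
        using tendsto_zero_powrI[OF lim tendsto_const[of p]] p by (simp add: H1norm_def)
      then show "(\<lambda>k. K * H1norm \<Omega> (\<lambda>x. \<phi> k x - u t x) powr p) \<longlonglongrightarrow> 0"
        by (rule tendsto_mult_right_zero)
    qed
    have L1: "(\<lambda>k. LINT x|leb_on \<Omega>. v t x * \<phi> k x) \<longlonglongrightarrow> (LINT x|leb_on \<Omega>. v t x * u t x)"
      using Lspace2_inner_tendsto[OF H1_Lspace2[OF H1_0D(1)[OF \<phi>(1)]] H1_Lspace2[OF H1_0D(1)[OF ut]] elim(2) l0] by simp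
    have L2: "(\<lambda>k. LINT x|leb_on \<Omega>. weak_grad \<Omega> (u t) x \<bullet> weak_grad \<Omega> (\<phi> k) x) \<longlonglongrightarrow>
        (Lnorm 2 (leb_on \<Omega>) (weak_grad \<Omega> (u t)))\<^sup>2"
      using Lspace2_inner_tendsto[OF weak_grad_Lspace2[OF H1_0D(1)[OF \<phi>(1)]] weak_grad_Lspace2[OF H1_0D(1)[OF ut]]
          weak_grad_Lspace2[OF H1_0D(1)[OF ut]] lg]
      by (simp add: Lnorm2_square power2_norm_eq_inner)
    have L3: "(\<lambda>k. LINT x|restrict_space \<sigma> \<Gamma>\<^sub>1. z t x * boundary_trace \<Omega> \<sigma> (\<phi> k) x) \<longlonglongrightarrow>
        (LINT x|\<sigma>. z t x * boundary_trace \<Omega> \<sigma> (u t) x)"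
      unfolding boundary_pairing[OF \<phi>(1) \<Gamma> Lspace2_measurable[OF elim(3)]]
      using Lspace2_inner_tendsto[OF H1_0D(4)[OF \<phi>(1)] H1_0D(4)[OF ut] elim(3) lt] by simp
    have L4: "(\<lambda>k. LINT x|leb_on \<Omega>. \<bar>u t x\<bar> powr (p - 2) * u t x * \<phi> k x) \<longlonglongrightarrow> Lnorm p (leb_on \<Omega>) (u t) powr p"
      using emb[OF H1_0_diff[OF \<phi>(1) ut]] emb[OF ut] by (intro power_pairing_tendsto[OF p _ _ lp]) auto
    have "(\<lambda>k. (LINT x|leb_on \<Omega>. v t x * \<phi> k x) +
      (LINT x|leb_on \<Omega>. weak_grad \<Omega> (u t) x \<bullet> weak_grad \<Omega> (\<phi> k) x) +
      (LINT x|restrict_space \<sigma> \<Gamma>\<^sub>1. z t x * boundary_trace \<Omega> \<sigma> (\<phi> k) x)) =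
      (\<lambda>k. LINT x|leb_on \<Omega>. \<bar>u t x\<bar> powr (p - 2) * u t x * \<phi> k x)"
      using elim(5) \<phi>(2) by (intro ext) blast
    with LIMSEQ_unique[OF _ L4] tendsto_add[OF tendsto_add[OF L1 L2] L3]
    have "(LINT x|leb_on \<Omega>. v t x * u t x) + (Lnorm 2 (leb_on \<Omega>) (weak_grad \<Omega> (u t)))\<^sup>2 +
        (LINT x|\<sigma>. z t x * boundary_trace \<Omega> \<sigma> (u t) x) = Lnorm p (leb_on \<Omega>) (u t) powr p"
      by simp
    then show ?case by simp
  qed
qed

text \<open>The boundary term runs over all of the boundary, where the time derivative of the trace
  is given. For a partitioned boundary and an element of \<open>H1_0\<close> it equals the term over
  \<open>\<Gamma>\<^sub>1\<close>.\<close>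

definition energy :: "('a \<Rightarrow> real) \<Rightarrow> real" where
  "energy w = ((Lnorm 2 (leb_on \<Omega>) w)\<^sup>2 + (Lnorm 2 \<sigma> (boundary_trace \<Omega> \<sigma> w))\<^sup>2) / 2"

text \<open>The approximate chain rules in \<open>\<Omega>\<close> and on the boundary are added.
  The equation tested with \<open>u\<close> replaces the sum of the two pairings by the power term
  minus the squared gradient norm, and the latter is dropped.\<close>

lemma solution_energy_growth:
  assumes \<Gamma>: "\<Gamma>\<^sub>0 \<union> \<Gamma>\<^sub>1 = frontier \<Omega>" "\<Gamma>\<^sub>1 \<in> sets \<sigma>" and p: "p > 1"
    and emb: "\<And>w. w \<in> H1_0 \<Omega> \<sigma> \<Gamma>\<^sub>0 \<Longrightarrow> w \<in> Lspace p (leb_on \<Omega>) \<and> Lnorm p (leb_on \<Omega>) w powr p \<le> K * H1norm \<Omega> w powr p"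
    and sol: "weak_solution \<Omega> \<sigma> \<Gamma>\<^sub>0 \<Gamma>\<^sub>1 p u\<^sub>0 T u"
    and H: "\<And>t. t \<in> {0..T} \<Longrightarrow> u t \<in> H1_0 \<Omega> \<sigma> \<Gamma>\<^sub>0"
    and bound: "\<And>t. t \<in> {0..T} \<Longrightarrow> H1norm \<Omega> (u t) \<le> B"
    and pos: "\<And>t. t \<in> {0..T} \<Longrightarrow> energy (u t) > 0"
    and growth: "\<And>t. t \<in> {0..T} \<Longrightarrow> Lnorm p (leb_on \<Omega>) (u t) powr p \<le> c * energy (u t) powr a"
  shows "continuous_on {0..T} (\<lambda>t. energy (u t))"
    and "\<And>s t. 0 < s \<Longrightarrow> s < t \<Longrightarrow> t < T \<Longrightarrow>
      energy (u t) - energy (u s) \<le> integral {s..t} (\<lambda>\<tau>. c * energy (u \<tau>) powr a)"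
proof -
  let ?N = "leb_on {0<..<T} :: real measure"
  let ?tr = "\<lambda>t. boundary_trace \<Omega> \<sigma> (u t)"
  from sol obtain v z where v: "has_L2_time_deriv T \<Omega> (leb_on \<Omega>) u v" and z: "has_L2_time_deriv T UNIV \<sigma> ?tr z"
    and weak: "\<forall>\<phi>\<in>H1_0 \<Omega> \<sigma> \<Gamma>\<^sub>0. AE t in ?N. (LINT x|leb_on \<Omega>. v t x * \<phi> x) +
      (LINT x|leb_on \<Omega>. weak_grad \<Omega> (u t) x \<bullet> weak_grad \<Omega> \<phi> x) +
      (LINT x|restrict_space \<sigma> \<Gamma>\<^sub>1. z t x * boundary_trace \<Omega> \<sigma> \<phi> x) =
      (LINT x|leb_on \<Omega>. \<bar>u t x\<bar> powr (p - 2) * u t x * \<phi> x)"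
    unfolding weak_solution_def by blast
  have u: "u \<in> Linf_H1_0 \<Omega> \<sigma> \<Gamma>\<^sub>0 T" and cont: "\<And>t. t \<in> {0..T} \<Longrightarrow>
      ((\<lambda>s. Lnorm 2 (leb_on \<Omega>) (\<lambda>x. u s x - u t x)) \<longlongrightarrow> 0) (at t within {0..T})"
    using sol by (auto simp: weak_solution_def)
  interpret I: L2_time_derivative "leb_on \<Omega>" T \<Omega> u v
  proof
    show "u t \<in> Lspace 2 (leb_on \<Omega>)" if "t \<in> {0..T}" for t
      by (rule H1_Lspace2[OF H1_0D(1)[OF H[OF that]]])
    show "\<exists>\<psi>. test_function \<Omega> \<psi> \<and> Lnorm 2 (leb_on \<Omega>) (\<lambda>x. \<psi> x - u t x) < e" if te: "t \<in> {0..T}" "0 < e" for t e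
    proof -
      obtain w where w: "\<And>k. smooth (w k)" "(\<lambda>k. Lnorm 2 (leb_on \<Omega>) (\<lambda>x. w k x - u t x)) \<longlonglongrightarrow> 0"
        using H1_0_smooth_approx[OF H[OF te(1)]] by blast
      have "AE x in leb_on \<Omega>. x \<in> \<Omega>" by (rule AE_I2) (simp add: space_restrict_space)
      then show ?thesis
        by (rule leb.test_function_approx[OF open_domain _ H1_Lspace2[OF H1_0D(1)[OF H[OF te(1)]]] w te(2)])
    qed
  qed (use cont v in auto)
  interpret J: L2_time_derivative \<sigma> T UNIV ?tr z
  proof
    show "?tr t \<in> Lspace 2 \<sigma>" if "t \<in> {0..T}" for t by (rule H1_0D(4)[OF H[OF that]])
    show "((\<lambda>s. Lnorm 2 \<sigma> (\<lambda>x. ?tr s x - ?tr t x)) \<longlongrightarrow> 0) (at t within {0..T})" if t: "t \<in> {0..T}" for t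
    proof -
      \<comment> \<open>The convergence lemma asks for membership and bounds at all parameters;
        outside the interval the function is frozen at its value at \<open>t\<close>, which does not
        affect the limit.\<close>
      define u' where "u' s = (if s \<in> {0..T} then u s else u t)" for s
      have u': "u' s \<in> H1_0 \<Omega> \<sigma> \<Gamma>\<^sub>0" "H1norm \<Omega> (u' s) \<le> B" for s
        using H bound t by (auto simp: u'_def)
      have ev: "\<forall>\<^sub>F s in at t within {0..T}. u' s = u s"
        unfolding eventually_at_filter by (intro always_eventually) (simp add: u'_def)
      have "H1norm \<Omega> (\<lambda>x. u' s x - u t x) \<le> 2 * (B + B)" for s
        by (rule order_trans[OF H1norm_triangle_diff[OF open_domain bounded_domain H1_0D(1)[OF u'(1)] H1_0D(1)[OF H[OF t]]]])
           (intro mult_left_mono add_mono u'(2) bound t, simp)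
      moreover have "((\<lambda>s. Lnorm 2 (leb_on \<Omega>) (\<lambda>x. u' s x - u t x)) \<longlongrightarrow> 0) (at t within {0..T})"
        by (rule Lim_transform_eventually[OF cont[OF t]]) (use ev in eventually_elim, simp)
      ultimately have "((\<lambda>s. Lnorm 2 \<sigma> (\<lambda>x. boundary_trace \<Omega> \<sigma> (u' s) x - ?tr t x)) \<longlongrightarrow> 0) (at t within {0..T})"
        by (intro boundary_trace_tendsto[OF u'(1) H[OF t]])
      then show ?thesis
        by (rule Lim_transform_eventually) (use ev in eventually_elim, simp)
    qed
    show "\<exists>\<psi>. test_function UNIV \<psi> \<and> Lnorm 2 \<sigma> (\<lambda>x. \<psi> x - ?tr t x) < e" if te: "t \<in> {0..T}" "0 < e" for t e
    proof -
      obtain w where w: "\<And>k. smooth (w k)" "(\<lambda>k. Lnorm 2 \<sigma> (\<lambda>x. w k x - ?tr t x)) \<longlonglongrightarrow> 0"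
        using H1_0_smooth_approx[OF H[OF te(1)]] by blast
      show ?thesis
        by (rule surf.test_function_approx[OF open_UNIV _ H1_0D(4)[OF H[OF te(1)]] w te(2)]) simp
    qed
  qed (use z in auto)
  have "continuous_on {0..T} (\<lambda>t. Lnorm 2 (leb_on \<Omega>) (u t))" "continuous_on {0..T} (\<lambda>t. Lnorm 2 \<sigma> (?tr t))"
    by (rule Lnorm2_continuous_on[OF I.f_Lspace2 I.f_continuous] Lnorm2_continuous_on[OF J.f_Lspace2 J.f_continuous]; assumption)+
  then show cE: "continuous_on {0..T} (\<lambda>t. energy (u t))"
    unfolding energy_def by (intro continuous_intros) auto
  have cP: "continuous_on {0..T} (\<lambda>t. c * energy (u t) powr a)"
    by (intro continuous_on_mult continuous_on_const continuous_on_powr cE) (use pos in force)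
  have id: "AE t in ?N. (LINT x|leb_on \<Omega>. v t x * u t x) + (LINT x|\<sigma>. z t x * ?tr t x) =
      Lnorm p (leb_on \<Omega>) (u t) powr p - (Lnorm 2 (leb_on \<Omega>) (weak_grad \<Omega> (u t)))\<^sup>2"
    by (rule weak_formulation_solution[OF \<Gamma> p emb u H I.AE_v_Lspace2 J.AE_v_Lspace2 bspec[OF weak]]) auto
  fix s t assume st: "0 < s" "s < t" "t < T"
  let ?E = "\<lambda>\<tau>. c * energy (u \<tau>) powr a"
  let ?V = "LINT \<tau>|?N. Lnorm 2 (leb_on \<Omega>) (v \<tau>) + Lnorm 2 \<sigma> (z \<tau>)"
  have V: "integrable ?N (\<lambda>\<tau>. Lnorm 2 (leb_on \<Omega>) (v \<tau>) + Lnorm 2 \<sigma> (z \<tau>))" "?V \<ge> 0"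
    using I.Lnorm_v_integrable J.Lnorm_v_integrable by (auto intro!: integral_nonneg_AE simp: Lnorm_nonneg)
  have "energy (u t) - energy (u s) \<le> integral {s..t} ?E + e * ?V" if e: "e > 0" for e
  proof -
    obtain f where f: "integrable ?N f"
      "(Lnorm 2 (leb_on \<Omega>) (u t))\<^sup>2 - (Lnorm 2 (leb_on \<Omega>) (u s))\<^sup>2 = (LINT \<tau>|?N. f \<tau>)"
      "AE \<tau> in ?N. \<bar>f \<tau> - 2 * (indicator {s<..t} \<tau> * (LINT x|leb_on \<Omega>. v \<tau> x * u \<tau> x))\<bar> \<le>
        2 * e * Lnorm 2 (leb_on \<Omega>) (v \<tau>)"
      using I.norm_square_increment_approx[OF e st] by blast
    obtain g where g: "integrable ?N g"
      "(Lnorm 2 \<sigma> (?tr t))\<^sup>2 - (Lnorm 2 \<sigma> (?tr s))\<^sup>2 = (LINT \<tau>|?N. g \<tau>)"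
      "AE \<tau> in ?N. \<bar>g \<tau> - 2 * (indicator {s<..t} \<tau> * (LINT x|\<sigma>. z \<tau> x * ?tr \<tau> x))\<bar> \<le>
        2 * e * Lnorm 2 \<sigma> (z \<tau>)"
      using J.norm_square_increment_approx[OF e st] by blast
    have "2 * (energy (u t) - energy (u s)) = (LINT \<tau>|?N. f \<tau> + g \<tau>)"
      using f(1,2) g(1,2) by (simp add: energy_def field_simps)
    also have "\<dots> \<le> (LINT \<tau>|?N. 2 * (indicator {s<..t} \<tau> * ?E \<tau>) +
        2 * e * (Lnorm 2 (leb_on \<Omega>) (v \<tau>) + Lnorm 2 \<sigma> (z \<tau>)))"
    proof (rule integral_mono_AE)
      show "integrable ?N (\<lambda>\<tau>. 2 * (indicator {s<..t} \<tau> * ?E \<tau>) +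
          2 * e * (Lnorm 2 (leb_on \<Omega>) (v \<tau>) + Lnorm 2 \<sigma> (z \<tau>)))"
        by (intro Bochner_Integration.integrable_add integrable_mult_right integral_leb_on_interval(1)[OF cP st] V(1))
      show "AE \<tau> in ?N. f \<tau> + g \<tau> \<le> 2 * (indicator {s<..t} \<tau> * ?E \<tau>) +
          2 * e * (Lnorm 2 (leb_on \<Omega>) (v \<tau>) + Lnorm 2 \<sigma> (z \<tau>))"
        using f(3) g(3) id AE_space
      proof eventually_elim
        case (elim \<tau>)
        let ?v = "LINT x|leb_on \<Omega>. v \<tau> x * u \<tau> x" and ?z = "LINT x|\<sigma>. z \<tau> x * ?tr \<tau> x"
        have "\<tau> \<in> {0..T}" using elim(4) by (simp add: space_restrict_space)
        from growth[OF this] have "?v + ?z \<le> ?E \<tau>"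
          unfolding elim(3) using zero_le_power2[of "Lnorm 2 (leb_on \<Omega>) (weak_grad \<Omega> (u \<tau>))"] by linarith
        then have "indicator {s<..t} \<tau> * (?v + ?z) \<le> indicator {s<..t} \<tau> * ?E \<tau>"
          by (intro mult_left_mono) auto
        moreover have "f \<tau> + g \<tau> - 2 * (indicator {s<..t} \<tau> * (?v + ?z)) \<le>
            2 * e * (Lnorm 2 (leb_on \<Omega>) (v \<tau>) + Lnorm 2 \<sigma> (z \<tau>))"
          using abs_le_D1[OF elim(1)] abs_le_D1[OF elim(2)] by (simp add: algebra_simps)
        ultimately show ?case by simp
      qed
    qed (use f(1) g(1) in simp)
    also have "\<dots> = 2 * integral {s..t} ?E + 2 * e * ?V"
      using integral_leb_on_interval[OF cP st] V(1)
      by (subst Bochner_Integration.integral_add) (simp_all only: integral_mult_right_zero integrable_mult_right)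
    finally show ?thesis by simp
  qed
  note le = this
  show "energy (u t) - energy (u s) \<le> integral {s..t} ?E"
  proof (rule field_le_epsilon)
    fix e :: real assume e: "e > 0"
    \<comment> \<open>The chain rule error is the accuracy times the fixed integral
      \<open>?V\<close>; the added 1 covers \<open>?V = 0\<close>.\<close>
    have "e / (?V + 1) * ?V \<le> e" using V(2) e by (simp add: field_simps)
    then show "energy (u t) - energy (u s) \<le> integral {s..t} ?E + e"
      using le[of "e / (?V + 1)"] V(2) e by (simp add: add_nonneg_pos)
  qed
qed

end

section \<open>The lower bound for the blow-up time\<close>

theorem theorem3p6:
  fixes \<Omega> \<Gamma>\<^sub>0 \<Gamma>\<^sub>1 :: "'a::euclidean_space set" and \<sigma> :: "'a measure"
    and p \<theta> S\<^sub>3 S\<^sub>4 C :: real and n :: nat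
    and u\<^sub>0 :: "'a \<Rightarrow> real" and u :: "real \<Rightarrow> 'a \<Rightarrow> real" and T\<^sub>m\<^sub>a\<^sub>x :: ereal
  assumes dim: "n = DIM('a)"
    and domain: "open \<Omega>" "bounded \<Omega>" "C1_boundary \<Omega>"
    and surface: "surface_measure \<Omega> \<sigma>"
    and parts: "\<Gamma>\<^sub>0 \<in> sets \<sigma>" "\<Gamma>\<^sub>1 \<in> sets \<sigma>" "\<Gamma>\<^sub>0 \<union> \<Gamma>\<^sub>1 = frontier \<Omega>" "\<Gamma>\<^sub>0 \<inter> \<Gamma>\<^sub>1 = {}"
      "closure \<Gamma>\<^sub>0 \<inter> closure \<Gamma>\<^sub>1 = {}" "emeasure \<sigma> \<Gamma>\<^sub>0 > 0"
    and exponent: "2 < p" "ereal p \<le> 1 + sobolev_exponent n / 2" "p < 2 + 4 / real n"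
    and datum: "u\<^sub>0 \<in> H1_0 \<Omega> \<sigma> \<Gamma>\<^sub>0"
    and solution: "maximal_weak_solution \<Omega> \<sigma> \<Gamma>\<^sub>0 \<Gamma>\<^sub>1 p u\<^sub>0 T\<^sub>m\<^sub>a\<^sub>x u"
    and blow_up: "blows_up \<Omega> T\<^sub>m\<^sub>a\<^sub>x u"
    and unstable: "\<And>t. 0 \<le> t \<Longrightarrow> ereal t < T\<^sub>m\<^sub>a\<^sub>x \<Longrightarrow> u t \<in> N_minus \<Omega> \<sigma> \<Gamma>\<^sub>0 p"
    and theta: "\<theta> = real n * (p - 2) / (2 * p)"
    and S3_pos: "S\<^sub>3 > 0"
    and gagliardo_nirenberg: "\<And>w. w \<in> H1_0 \<Omega> \<sigma> \<Gamma>\<^sub>0 \<Longrightarrow>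
      w \<in> Lspace p (leb_on \<Omega>) \<and>
      Lnorm p (leb_on \<Omega>) w powr p \<le>
        S\<^sub>3 * Lnorm 2 (leb_on \<Omega>) w powr (p * (1 - \<theta>))
           * Lnorm 2 (leb_on \<Omega>) (weak_grad \<Omega> w) powr (p * \<theta>)"
    and S4: "S\<^sub>4 = S\<^sub>3 powr (2 / (2 - p * \<theta>)) * 2 powr ((p - p * \<theta>) / (2 - p * \<theta>))"
    and C: "C = (2 - p * \<theta>) / (S\<^sub>4 * (p - 2)) * 2 powr ((p - 2) / (2 - p * \<theta>))"
  shows "2 - p * \<theta> > 0 \<and> C > 0 \<and>
    T\<^sub>m\<^sub>a\<^sub>x \<ge> ereal (C /
      ((Lnorm 2 (leb_on \<Omega>) u\<^sub>0)\<^sup>2 + (Lnorm 2 (restrict_space \<sigma> \<Gamma>\<^sub>1) (boundary_trace \<Omega> \<sigma> u\<^sub>0))\<^sup>2)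
        powr (2 * (p - 2) / (4 - real n * (p - 2))))"
proof -
  interpret C1_domain \<Omega> \<sigma> by standard (use domain surface in auto)
  define \<beta> where "\<beta> = p * \<theta>"
  define \<alpha> where "\<alpha> = p - \<beta>"
  define a where "a = \<alpha> / (2 - \<beta>)"
  have n: "real n \<ge> 1" using DIM_positive[where 'a='a] unfolding dim by linarith
  have \<beta>_eq: "\<beta> = real n * (p - 2) / 2" using exponent(1) by (simp add: \<beta>_def theta)
  \<comment> \<open>The subcriticality condition, rewritten as \<open>\<beta> < 2\<close>.\<close>
  have "real n * (p - 2) < real n * (4 / real n)" using exponent(3) n by (intro mult_strict_left_mono) auto
  then have \<beta>: "0 < \<beta>" "\<beta> < 2" using n exponent(1) by (auto simp: \<beta>_eq)
  have \<alpha>: "0 < \<alpha>" "p * (1 - \<theta>) = \<alpha>"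
    using \<beta>(2) exponent(1) by (simp add: \<alpha>_def, simp add: \<alpha>_def \<beta>_def algebra_simps)
  have a1: "a - 1 = (p - 2) / (2 - \<beta>)" using \<beta> by (simp add: a_def \<alpha>_def field_simps)
  have a: "a > 1" using \<beta> exponent(1) by (simp add: a_def \<alpha>_def field_simps)
  have S4_eq: "S\<^sub>4 = S\<^sub>3 powr (2 / (2 - \<beta>)) * 2 powr a"
    by (simp add: S4 a_def \<alpha>_def \<beta>_def)
  have S4_pos: "S\<^sub>4 > 0" using S3_pos by (simp add: S4_eq)
  \<comment> \<open>In terms of \<open>a\<close> the constant is the factor
    \<open>2 powr (a - 1)\<close> from doubling the initial energy, divided by the slope of the
    comparison.\<close>
  have C_eq: "C = 2 powr (a - 1) / ((a - 1) * S\<^sub>4)"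
    using \<beta> exponent(1) S4_pos unfolding C a1 \<beta>_def[symmetric] by (simp add: field_simps)
  have C_pos: "C > 0" using a S4_pos by (simp add: C_eq)
  have e_eq: "2 * (p - 2) / (4 - real n * (p - 2)) = a - 1"
    using \<beta> unfolding a1 \<beta>_eq by (simp add: field_simps)
  obtain T where T: "T\<^sub>m\<^sub>a\<^sub>x = ereal T" "0 < T"
    using solution blow_up unfolding maximal_weak_solution_def weak_solution_before_def blows_up_def
    by (cases T\<^sub>m\<^sub>a\<^sub>x) auto
  have sol: "weak_solution \<Omega> \<sigma> \<Gamma>\<^sub>0 \<Gamma>\<^sub>1 p u\<^sub>0 t u" if "0 < t" "t < T" for t
    using solution that T unfolding maximal_weak_solution_def weak_solution_before_def by auto
  have H: "u t \<in> H1_0 \<Omega> \<sigma> \<Gamma>\<^sub>0" and K: "K_functional \<Omega> p (u t) < 0" if "0 \<le> t" "t < T" for t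
    using unstable[OF that(1)] that(2) by (auto simp: T N_minus_def)
  let ?A = "\<lambda>t. Lnorm 2 (leb_on \<Omega>) (u t)" and ?G = "\<lambda>t. Lnorm 2 (leb_on \<Omega>) (weak_grad \<Omega> (u t))"
    and ?P = "\<lambda>t. Lnorm p (leb_on \<Omega>) (u t) powr p"
  have GN: "w \<in> Lspace p (leb_on \<Omega>)"
    "Lnorm p (leb_on \<Omega>) w powr p \<le> S\<^sub>3 * Lnorm 2 (leb_on \<Omega>) w powr \<alpha> * Lnorm 2 (leb_on \<Omega>) (weak_grad \<Omega> w) powr \<beta>"
    if "w \<in> H1_0 \<Omega> \<sigma> \<Gamma>\<^sub>0" for w
    using gagliardo_nirenberg[OF that] by (simp_all add: \<alpha>(2) \<beta>_def)
  \<comment> \<open>Both norms in the interpolation inequality are at most the full norm, and their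
    exponents \<open>\<alpha>\<close> and \<open>\<beta>\<close> add up to \<open>p\<close>.\<close>
  have emb: "w \<in> Lspace p (leb_on \<Omega>) \<and> Lnorm p (leb_on \<Omega>) w powr p \<le> S\<^sub>3 * H1norm \<Omega> w powr p"
    if w: "w \<in> H1_0 \<Omega> \<sigma> \<Gamma>\<^sub>0" for w
  proof -
    have "S\<^sub>3 * Lnorm 2 (leb_on \<Omega>) w powr \<alpha> * Lnorm 2 (leb_on \<Omega>) (weak_grad \<Omega> w) powr \<beta> \<le>
        S\<^sub>3 * H1norm \<Omega> w powr \<alpha> * H1norm \<Omega> w powr \<beta>"
      using S3_pos \<alpha>(1) \<beta>(1)
      by (intro mult_mono mult_left_mono powr_mono2 Lnorm2_le_H1norm Lnorm_nonneg mult_nonneg_nonneg) auto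
    also have "\<dots> = S\<^sub>3 * H1norm \<Omega> w powr p" by (simp add: powr_add[symmetric] \<alpha>_def mult.assoc)
    finally show ?thesis using GN[OF w] by simp
  qed
  have unst: "?P t \<le> S\<^sub>3 powr (2 / (2 - \<beta>)) * (?A t)\<^sup>2 powr a" "0 < ?A t" "(?G t)\<^sup>2 < ?P t"
    if t: "0 \<le> t" "t < T" for t
  proof -
    show G: "(?G t)\<^sup>2 < ?P t" using K[OF t] by (simp add: K_functional_def)
    show "?P t \<le> S\<^sub>3 powr (2 / (2 - \<beta>)) * (?A t)\<^sup>2 powr a" "0 < ?A t"
      unfolding a_def
      by (rule unstable_power_bound[OF Lnorm_nonneg Lnorm_nonneg S3_pos less_imp_le[OF \<beta>(1)] \<beta>(2) \<alpha>(1) G GN(2)[OF H[OF t]]])+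
  qed
  have E_pos: "energy (u t) > 0" and A_le: "(?A t)\<^sup>2 \<le> 2 * energy (u t)" if t: "0 \<le> t" "t < T" for t
    using unst(2)[OF t] by (simp_all add: energy_def add_pos_nonneg)
  have P_le: "?P t \<le> S\<^sub>4 * energy (u t) powr a" if t: "0 \<le> t" "t < T" for t
  proof -
    have "(?A t)\<^sup>2 powr a \<le> (2 * energy (u t)) powr a"
      using A_le[OF t] a by (intro powr_mono2) auto
    also have "\<dots> = 2 powr a * energy (u t) powr a" using E_pos[OF t] by (simp add: powr_mult)
    finally have "S\<^sub>3 powr (2 / (2 - \<beta>)) * (?A t)\<^sup>2 powr a \<le> S\<^sub>3 powr (2 / (2 - \<beta>)) * (2 powr a * energy (u t) powr a)"
      by (rule mult_left_mono) simp
    then show ?thesis using unst(1)[OF t] by (simp add: S4_eq mult.assoc)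
  qed
  have growth: "continuous_on {0..t} (\<lambda>t. energy (u t))"
    "\<And>r s. 0 < r \<Longrightarrow> r < s \<Longrightarrow> s < t \<Longrightarrow>
      energy (u s) - energy (u r) \<le> integral {r..s} (\<lambda>\<tau>. S\<^sub>4 * energy (u \<tau>) powr a)" if t: "0 < t" "t < T" for t
  proof -
    have "continuous_on {0..t} ?A"
      using sol[OF t] by (intro Lnorm2_continuous_on) (auto simp: weak_solution_def)
    then have "compact (?A ` {0..t})" by (intro compact_continuous_image) auto
    then obtain R where R: "\<And>y. y \<in> ?A ` {0..t} \<Longrightarrow> \<bar>y\<bar> \<le> R"
      using compact_imp_bounded[of "?A ` {0..t}"] unfolding bounded_real by blast
    \<comment> \<open>\<open>R\<close> bounds the norm over \<open>\<Omega>\<close> on the compact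
      interval; the second summand bounds \<open>?P\<close>, and with it the squared gradient norm,
      at each time of the interval.\<close>
    define B where "B = sqrt (R\<^sup>2 + S\<^sub>3 powr (2 / (2 - \<beta>)) * (R\<^sup>2) powr a)"
    have B: "H1norm \<Omega> (u \<tau>) \<le> B" if \<tau>: "\<tau> \<in> {0..t}" for \<tau>
    proof -
      have t': "0 \<le> \<tau>" "\<tau> < T" using \<tau> t by auto
      have A2: "(?A \<tau>)\<^sup>2 \<le> R\<^sup>2" using R[OF imageI[OF \<tau>]] by (simp add: abs_le_square_iff[symmetric])
      then have "(?A \<tau>)\<^sup>2 powr a \<le> (R\<^sup>2) powr a" using a by (intro powr_mono2) auto
      then have "S\<^sub>3 powr (2 / (2 - \<beta>)) * (?A \<tau>)\<^sup>2 powr a \<le> S\<^sub>3 powr (2 / (2 - \<beta>)) * (R\<^sup>2) powr a"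
        by (rule mult_left_mono) simp
      then have "(?A \<tau>)\<^sup>2 + (?G \<tau>)\<^sup>2 \<le> R\<^sup>2 + S\<^sub>3 powr (2 / (2 - \<beta>)) * (R\<^sup>2) powr a"
        using unst(1,3)[OF t'] A2 by linarith
      then show ?thesis unfolding H1norm_def B_def by (rule real_sqrt_le_mono)
    qed
    have p1: "p > 1" using exponent(1) by simp
    have mem: "u \<tau> \<in> H1_0 \<Omega> \<sigma> \<Gamma>\<^sub>0" "energy (u \<tau>) > 0" "?P \<tau> \<le> S\<^sub>4 * energy (u \<tau>) powr a" if "\<tau> \<in> {0..t}" for \<tau>
      using H[of \<tau>] E_pos[of \<tau>] P_le[of \<tau>] that t by auto
    note G = solution_energy_growth[OF parts(3,2) p1 emb sol[OF t] mem(1) B mem(2,3)]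
    show "continuous_on {0..t} (\<lambda>t. energy (u t))" by (rule G(1))
    show "energy (u s) - energy (u r) \<le> integral {r..s} (\<lambda>\<tau>. S\<^sub>4 * energy (u \<tau>) powr a)"
      if "0 < r" "r < s" "s < t" for r s by (rule G(2)[OF _ _ _ _ _ that])
  qed
  have decay: "energy (u r) powr (1 - a) - energy (u s) powr (1 - a) \<le> (a - 1) * S\<^sub>4 * (s - r)"
    if rs: "0 < r" "r < s" "s < T" for r s
  proof -
    \<comment> \<open>The increment inequality holds strictly inside the interval of a weak
      solution, so a slightly longer interval is needed to reach \<open>s\<close>.\<close>
    obtain t where t: "s < t" "t < T" using dense[OF rs(3)] by blast
    have t0: "0 < t" using rs t by simp
    show ?thesis
    proof (rule power_growth_comparison[OF rs(2) a less_imp_le[OF S4_pos]])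
      show "continuous_on {r..s} (\<lambda>\<tau>. energy (u \<tau>))"
        using rs t by (intro continuous_on_subset[OF growth(1)[OF t0 t(2)]]) auto
      show "energy (u \<tau>) > 0" if "\<tau> \<in> {r..s}" for \<tau> using E_pos[of \<tau>] that rs by simp
      show "energy (u \<tau>) - energy (u r) \<le> integral {r..\<tau>} (\<lambda>r. S\<^sub>4 * energy (u r) powr a)" if "\<tau> \<in> {r<..s}" for \<tau>
        using that rs t by (intro growth(2)[OF t0 t(2)]) auto
    qed
  qed
  define X where "X = energy (u 0) powr (1 - a)"
  \<comment> \<open>The decay estimate starts at positive times only; continuity of the energy at 0
    from the right extends it to the initial time.\<close>
  have decay0: "X \<le> energy (u s) powr (1 - a) + (a - 1) * S\<^sub>4 * s" if s: "0 < s" "s < T" for s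
  proof (rule tendsto_upperbound)
    have "((\<lambda>r. energy (u r)) \<longlongrightarrow> energy (u 0)) (at_right 0)"
      by (rule continuous_on_Icc_at_rightD[OF growth(1)[OF s] s(1)])
    then show "((\<lambda>r. energy (u r) powr (1 - a)) \<longlongrightarrow> X) (at_right 0)"
      unfolding X_def using E_pos[of 0] T(2) by (intro tendsto_powr tendsto_const) auto
    have "\<forall>\<^sub>F r in at_right 0. r \<in> {0<..<s}" by (rule eventually_at_right_real[OF s(1)])
    then show "\<forall>\<^sub>F r in at_right 0. energy (u r) powr (1 - a) \<le> energy (u s) powr (1 - a) + (a - 1) * S\<^sub>4 * s"
    proof eventually_elim
      case (elim r)
      have "(a - 1) * S\<^sub>4 * (s - r) \<le> (a - 1) * S\<^sub>4 * s"
        using elim a S4_pos by (intro mult_left_mono) auto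
      then show ?case using decay[of r s] elim s by simp
    qed
  qed simp
  have X_le: "X \<le> (a - 1) * S\<^sub>4 * T"
  proof (rule ccontr)
    assume "\<not> X \<le> (a - 1) * S\<^sub>4 * T"
    define \<eta> where "\<eta> = X - (a - 1) * S\<^sub>4 * T"
    have \<eta>: "\<eta> > 0" using \<open>\<not> X \<le> _\<close> by (simp add: \<eta>_def)
    \<comment> \<open>If the bound failed by \<open>\<eta>\<close>, then
      \<open>energy (u s) powr (1 - a) \<ge> \<eta>\<close> up to the blow-up time; the negative
      exponent turns this into the upper bound \<open>R\<close> for the energy.\<close>
    define R where "R = \<eta> powr (1 / (1 - a))"
    \<comment> \<open>\<open>2 * R\<close> bounds the squared norm of \<open>u\<close>, and the
      other term bounds the squared norm of its gradient through \<open>?P\<close>; a bounded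
      \<open>H\<^sup>1\<close> norm contradicts blow-up.\<close>
    define Q where "Q = sqrt (2 * R + S\<^sub>4 * R powr a)"
    have bound: "H1norm \<Omega> (u s) \<le> Q" if s: "0 < s" "s < T" for s
    proof -
      have s': "0 \<le> s" "s < T" using s by auto
      have "(a - 1) * S\<^sub>4 * s \<le> (a - 1) * S\<^sub>4 * T"
        using s a S4_pos by (intro mult_left_mono) auto
      then have "\<eta> \<le> energy (u s) powr (1 - a)" using decay0[OF s] by (simp add: \<eta>_def)
      then have "(energy (u s) powr (1 - a)) powr (1 / (1 - a)) \<le> \<eta> powr (1 / (1 - a))"
        using \<eta> a by (intro powr_mono2') auto
      then have ER: "energy (u s) \<le> R" using E_pos[OF s'] a by (simp add: powr_powr R_def)
      then have "S\<^sub>4 * energy (u s) powr a \<le> S\<^sub>4 * R powr a"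
        using E_pos[OF s'] a S4_pos by (intro mult_left_mono powr_mono2) auto
      then have "(?A s)\<^sup>2 + (?G s)\<^sup>2 \<le> 2 * R + S\<^sub>4 * R powr a"
        using A_le[OF s'] P_le[OF s'] unst(3)[OF s'] ER by linarith
      then show ?thesis unfolding H1norm_def Q_def by (rule real_sqrt_le_mono)
    qed
    have "filterlim (\<lambda>t. H1norm \<Omega> (u t)) at_top (at_left T)"
      using blow_up by (simp add: blows_up_def T)
    then have "\<forall>\<^sub>F t in at_left T. Q < H1norm \<Omega> (u t)" by (simp add: filterlim_at_top_dense)
    moreover have "\<forall>\<^sub>F t in at_left T. t \<in> {0<..<T}" by (rule eventually_at_left_real[OF T(2)])
    ultimately have "\<forall>\<^sub>F t in at_left T. False"
      by eventually_elim (use bound in force)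
    then show False by (simp add: trivial_limit_at_left_real)
  qed
  \<comment> \<open>The initial condition only identifies \<open>u 0\<close> and the datum almost
    everywhere in \<open>\<Omega>\<close>; equality of their boundary norms needs uniqueness of the
    trace.\<close>
  have "AE x in leb_on \<Omega>. u 0 x = u\<^sub>0 x" using sol[of "T / 2"] T(2) by (simp add: weak_solution_def)
  moreover have H0: "u 0 \<in> H1_0 \<Omega> \<sigma> \<Gamma>\<^sub>0" using H[of 0] T(2) by simp
  ultimately have "Lnorm 2 (leb_on \<Omega>) (u 0) = Lnorm 2 (leb_on \<Omega>) u\<^sub>0"
    "Lnorm 2 \<sigma> (boundary_trace \<Omega> \<sigma> (u 0)) = Lnorm 2 \<sigma> (boundary_trace \<Omega> \<sigma> u\<^sub>0)"
    using H1_Lspace2[OF H1_0D(1)[OF H0]] H1_Lspace2[OF H1_0D(1)[OF datum]] H1_0D(4)[OF H0] H1_0D(4)[OF datum]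
      has_trace_unique[OF H1_0D(2)[OF H0] H1_0D(2)[OF datum]]
    by (auto intro!: Lnorm2_cong_AE Lspace2_measurable)
  then have E0: "(Lnorm 2 (leb_on \<Omega>) u\<^sub>0)\<^sup>2 + (Lnorm 2 (restrict_space \<sigma> \<Gamma>\<^sub>1) (boundary_trace \<Omega> \<sigma> u\<^sub>0))\<^sup>2 = 2 * energy (u 0)"
    unfolding boundary_Lnorm[OF datum parts(3,2)] by (simp add: energy_def)
  have E0_pos: "energy (u 0) > 0" using E_pos[of 0] T(2) by simp
  have "C / (2 * energy (u 0)) powr (a - 1) = X / ((a - 1) * S\<^sub>4)"
  proof -
    have "X = 1 / energy (u 0) powr (a - 1)"
      using powr_minus_divide[of "energy (u 0)" "a - 1"] by (simp add: X_def)
    then show ?thesis using E0_pos by (simp add: C_eq powr_mult)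
  qed
  also have "\<dots> \<le> T"
    using X_le a S4_pos by (simp add: divide_le_eq mult.commute)
  finally have "C / (2 * energy (u 0)) powr (a - 1) \<le> T" .
  then show ?thesis
    unfolding E0 e_eq using \<beta>(2) C_pos by (simp add: T \<beta>_def)
qed

end
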